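(* Let $\mathcal{U}$ be a quantum Lie algebra with structure constants $\sigma^{kl}_{ij}$, $C^k_{ij}$. Let $Q$ be the BRST operator, acting from the right on the space $\bigoplus_{n\ge0}M_n$ of wedge polynomials in the ghosts $\gamma_i$ with coefficients in $\mathcal{U}$. Let ${\bf i}$ be the map from wedge polynomials to $q$-antisymmetric chains of the bar complex of $\mathcal{U}$, $${\bf i}\bigl(a\,\gamma_{i_1}\wedge\dots\wedge\gamma_{i_n}\bigr)=a\otimes (A_{1\to n})^{k_1\dots k_n}_{i_1\dots i_n}\,\chi_{k_1}\otimes\dots\otimes\chi_{k_n},\qquad a\in\mathcal{U}.$$ Then: 1. $Q^2=0$; 2. ${\bf i}$ is a chain map: $b\circ{\bf i}={\bf i}\circ Q$, where $b$ is the bar differential.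
   Context: Matrix convention. Fix a ground field. A tensor $M^{k_1\dots k_m}_{i_1\dots i_n}$ is regarded as a matrix with row multi-index $(i_1,\dots,i_n)$ (lower) and column multi-index $(k_1,\dots,k_m)$ (upper); products are matrix products in this sense, $(MM')^{l}_{i}=\sum_k M^{k}_{i}M'^{l}_{k}$. Repeated indices are summed. Small indices run over $1,\dots,N$, capital ones over $0,1,\dots,N$. Quantum Lie algebra. Let $\sigma=(\sigma^{kl}_{ij})$ be an invertible $N^2\times N^2$ matrix having eigenvalue $1$, and $C=(C^k_{ij})$ an $N^2\times N$ matrix. Define the $(N+1)^2\times(N+1)^2$ matrix $R=(R^{CD}_{AB})$ by $$R^{kl}_{ij}=\sigma^{kl}_{ij},\qquad R^{0k}_{ij}=C^k_{ij},\qquad R^{0A}_{B0}=R^{A0}_{0B}=\delta^A_B,$$ all other components being zero. It is required that $R$ satisfies the Yang-Baxter equation $R_{\underline{1}}R_{\underline{2}}R_{\underline{1}}=R_{\underline{2}}R_{\underline{1}}R_{\underline{2}}$, where $R_{\underline{k}}$ is $R$ acting in the $k$-th and $(k+1)$-st tensor factors. The quantum Lie algebra $\mathcal{U}$ is the unital associative algebra with generators $\chi_1,\dots,\chi_N$ and relations $\chi_i\chi_j-\sigma^{kl}_{ij}\chi_k\chi_l=C^k_{ij}\chi_k$. It is assumed that there is an $N^2\times N$ matrix $t=(t^k_{ij})$ with $C=(1-\sigma)t$. Antisymmetrizers. Let $\sigma_k$ denote $\sigma$ acting in the factors $k,k+1$. Put $A_{1\to 1}=1$ and, for $n\ge 2$,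 $A_{1\to n}=f_{1\to n}A_{1\to n-1}$, where $f_{1\to n}=1-\sigma_{n-1}+\sigma_{n-2}\sigma_{n-1}-\dots+(-1)^{n-1}\sigma_1\sigma_2\cdots\sigma_{n-1}$. The height $h$ of $\sigma$ is the number such that $A_{1\to h}\neq 0$ and $A_{1\to n}=0$ for all $n>h$ (put $h=\infty$ if there is none). Ghosts. The $\gamma_i$ generate the quantum wedge algebra: $\gamma_{i_1}\wedge\dots\wedge\gamma_{i_n}=(A_{1\to n})^{k_1\dots k_n}_{i_1\dots i_n}\gamma_{k_1}\otimes\dots\otimes\gamma_{k_n}$, i.e. $w^{i_1\dots i_n}\gamma_{i_1}\wedge\dots\wedge\gamma_{i_n}=0$ iff the row vector $w$ satisfies $wA_{1\to n}=0$. The $\Omega^i$ generate the wedge algebra in which $\Omega^{j_n}\wedge\dots\wedge\Omega^{j_1}v_{j_1\dots j_n}=0$ iff the column vector $v$ satisfies $A_{1\to n}v=0$. The cross relations are (the product of $\gamma$'s, and of $\Omega$'s, being $\wedge$) $$\gamma_i\Omega^j=-\Omega^m(\sigma^{-1})^{kj}_{mi}\gamma_k+\delta^j_i,\quad \chi_i\Omega^j=\Omega^m\bigl(\sigma^{kj}_{mi}\chi_k+C^j_{mi}\bigr),\quad \gamma_i\chi_j=\sigma^{kl}_{ij}\chi_k\gamma_l+C^k_{ij}\gamma_k .$$ Wedge polynomials and right action. $M_n$ is the space of linear combinations of $a\,\gamma_{i_1}\wedge\dots\wedge\gamma_{i_n}$, $a\in\mathcal{U}$ (that is, $\mathcal{U}$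 tensored with the degree-$n$ part of the wedge algebra of the $\gamma$'s; $M_0=\mathcal{U}$). The elements $\gamma_j,\chi_j,\Omega^j$ act on wedge polynomials from the right: $\gamma_j$ by right wedge multiplication; $\chi_j$ by writing it on the right, moving it to the left through all $\gamma$'s by the cross relation and multiplying it into the coefficient $a$ from the right; $\Omega^j$ by writing it on the right, moving it to the left through all $\gamma$'s by the cross relation, and discarding the term in which an $\Omega$ has reached the coefficient $a$ (the right action of $\Omega$ on $a\in\mathcal{U}$ is zero). A product acts from the right with its leftmost factor acting first. BRST operator. For $r\ge1$ define the $N^{r+1}\times N^{r}$ matrix $(AXA)_r$ by $$(-1)^{r+1}\bigl((AXA)_r\bigr)^{i_1\dots i_r}_{j_1\dots j_{r+1}}=\Bigl[(1-R_{\underline r}^2)(1+R_{\underline{r-1}}R_{\underline r}^2)\cdots\bigl(1+(-1)^{r}R_{\underline1}\cdots R_{\underline{r-1}}R_{\underline r}^2\bigr)\Bigr]^{k_1\dots k_r\,0}_{j_1\dots j_r j_{r+1}}(A_{1\to r})^{i_1\dots i_r}_{k_1\dots k_r},$$ where the factors in brackets are $1-(-1)^{r-k}R_{\underline k}R_{\underline{k+1}}\cdots R_{\underline{r-1}}R_{\underline r}^2$ for $k=r,r-1,\dots,1$, in this order, and all $i,j,k$ indices run over $1,\dots,N$. This matrix can be written as $A_{1\to r+1}X_rA_{1\to r}$ for some $N^{r+1}\times N^r$ matrix $X_r$. Then $$Q=\Omega^i\chi_i+\sum_{r=1}^{h-1}Q_{(r)},\qquad Q_{(r)}=\Omega^{j_{r+1}}\wedge\dots\wedge\Omega^{j_1}\,(X_r)^{i_1\dots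 i_r}_{j_1\dots j_{r+1}}\,\gamma_{i_1}\wedge\dots\wedge\gamma_{i_r}$$ (this depends only on $(AXA)_r$; for example $(AXA)_1=-C$ and $Q_{(1)}=-\Omega^{j_2}\wedge\Omega^{j_1}t^{i}_{j_1j_2}\gamma_i$). On each wedge polynomial only finitely many terms act nontrivially. $Q$ maps $M_n$ to $M_{n-1}$, and $M_0$ to $0$. Bar complex. $C_n(\mathcal{U})=\mathcal{U}^{\otimes n}$, $b:C_{n+1}(\mathcal{U})\to C_n(\mathcal{U})$, $b(a_1\otimes\dots\otimes a_{n+1})=\sum_{i=1}^{n}(-1)^{n-i}a_1\otimes\dots\otimes a_ia_{i+1}\otimes\dots\otimes a_{n+1}$ for $n\ge1$, and $b=0$ on $C_1(\mathcal{U})$. The $q$-antisymmetric chains are the span of $a\otimes (A_{1\to n})^{k_1\dots k_n}_{i_1\dots i_n}\chi_{k_1}\otimes\dots\otimes\chi_{k_n}\in C_{n+1}(\mathcal{U})$; the map ${\bf i}$ sends $M_n$ onto the span of these. It is part of the setting that ${\bf i}$ is one-to-one (the generators $\chi_i$ are linearly independent in $\mathcal{U}$). *)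

theory Defs
  imports "HOL-Analysis.Analysis" "HOL-Library.Poly_Mapping" "HOL-Library.Extended_Nat"
begin

section \<open>Matrices indexed by words\<close>

text \<open>
  The small indices form a finite type \<open>'n\<close>, so that \<open>N = CARD('n)\<close>; the capital indices
  \<open>0, 1, \<dots>, N\<close> form the type \<open>'n option\<close>, with \<open>None\<close> for the index \<open>0\<close>. A tensor is a matrix
  whose row is the lower and whose column is the upper multi-index, so
  \<open>\<sigma> $ (i, j) $ (k, l)\<close> is the component of \<open>\<sigma>\<close> with lower indices \<open>i j\<close> and upper indices \<open>k l\<close>.
  Where the number of indices varies, multi-indices are lists.
\<close>

type_synonym ('i, 'a) word_matrix = "'i list \<Rightarrow> 'i list \<Rightarrow> 'a"

definition wm_one :: "nat \<Rightarrow> ('i, 'a::semiring_1) word_matrix" where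
  "wm_one n = (\<lambda>I J. if I = J \<and> length I = n then 1 else 0)"

definition wm_mult ::
    "nat \<Rightarrow> ('i, 'a::semiring_1) word_matrix \<Rightarrow> ('i, 'a) word_matrix \<Rightarrow> ('i, 'a) word_matrix" where
  "wm_mult n M M' = (\<lambda>I K. \<Sum>J | length J = n. M I J * M' J K)"

definition wm_prod :: "nat \<Rightarrow> ('i, 'a::semiring_1) word_matrix list \<Rightarrow> ('i, 'a) word_matrix" where
  "wm_prod n Ms = foldr (wm_mult n) Ms (wm_one n)"

text \<open>The matrix \<open>M\<close> acting in the tensor factors \<open>k\<close> and \<open>k + 1\<close>, which are numbered from \<open>1\<close>.\<close>

definition on_factors ::
    "nat \<Rightarrow> 'a::zero^('i \<times> 'i)^('i \<times> 'i) \<Rightarrow> ('i::finite, 'a) word_matrix" where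
  "on_factors k M = (\<lambda>I J.
     if 1 \<le> k \<and> k < length I \<and> length J = length I
        \<and> take (k - 1) J = take (k - 1) I \<and> drop (k + 1) J = drop (k + 1) I
     then M $ (I ! (k - 1), I ! k) $ (J ! (k - 1), J ! k) else 0)"

section \<open>The matrix \<open>R\<close> and the antisymmetrizers\<close>

definition R_matrix ::
    "'a::field^('n \<times> 'n)^('n \<times> 'n) \<Rightarrow> 'a^'n^('n \<times> 'n)
      \<Rightarrow> 'a^('n option \<times> 'n option)^('n::finite option \<times> 'n option)" where
  "R_matrix \<sigma> C = (\<chi> p q. case p of
       (Some i, Some j) \<Rightarrow>
         (case q of (Some k, Some l) \<Rightarrow> \<sigma> $ (i, j) $ (k, l)
                  | (None, Some k) \<Rightarrow> C $ (i, j) $ k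
                  | _ \<Rightarrow> 0)
     | (A, B) \<Rightarrow> if q = (B, A) then 1 else 0)"

definition yang_baxter :: "'a::field^('i \<times> 'i)^('i::finite \<times> 'i) \<Rightarrow> bool" where
  "yang_baxter R \<longleftrightarrow>
     wm_prod 3 [on_factors 1 R, on_factors 2 R, on_factors 1 R]
   = wm_prod 3 [on_factors 2 R, on_factors 1 R, on_factors 2 R]"

text \<open>
  The matrices \<open>f\<close> and \<open>A\<close> on the first \<open>m\<close> of \<open>n\<close> tensor factors. The \<open>j\<close>-th term of the former is
  the product of the \<open>\<sigma>\<close>'s at the factors \<open>m - j, \<dots>, m - 1\<close>.
\<close>

definition partial_antisym ::
    "'a::field^('n \<times> 'n)^('n::finite \<times> 'n) \<Rightarrow> nat \<Rightarrow> nat \<Rightarrow> ('n, 'a) word_matrix" where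
  "partial_antisym \<sigma> n m = (\<lambda>I J.
     \<Sum>j<m. (-1) ^ j * wm_prod n (map (\<lambda>k. on_factors k \<sigma>) [m - j..<m]) I J)"

fun antisym_on ::
    "'a::field^('n \<times> 'n)^('n::finite \<times> 'n) \<Rightarrow> nat \<Rightarrow> nat \<Rightarrow> ('n, 'a) word_matrix" where
  "antisym_on \<sigma> n 0 = wm_one n"
| "antisym_on \<sigma> n (Suc 0) = wm_one n"
| "antisym_on \<sigma> n (Suc (Suc m)) =
     wm_mult n (partial_antisym \<sigma> n (Suc (Suc m))) (antisym_on \<sigma> n (Suc m))"

abbreviation antisym ::
    "'a::field^('n \<times> 'n)^('n::finite \<times> 'n) \<Rightarrow> nat \<Rightarrow> ('n, 'a) word_matrix" where
  "antisym \<sigma> n \<equiv> antisym_on \<sigma> n n"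

definition is_height :: "'a::field^('n \<times> 'n)^('n::finite \<times> 'n) \<Rightarrow> nat \<Rightarrow> bool" where
  "is_height \<sigma> h \<longleftrightarrow> antisym \<sigma> h \<noteq> (\<lambda>_ _. 0) \<and> (\<forall>n>h. antisym \<sigma> n = (\<lambda>_ _. 0))"

definition height :: "'a::field^('n \<times> 'n)^('n::finite \<times> 'n) \<Rightarrow> enat" where
  "height \<sigma> = (if \<exists>h. is_height \<sigma> h then enat (THE h. is_height \<sigma> h) else \<infinity>)"

section \<open>Quantum Lie algebras\<close>

text \<open>
  \<open>lin_ext f\<close> is the additive extension of a map given on monomials with coefficients; finitely
  supported functions serve as elements of free vector spaces, of the free algebra (on words), and
  of the tensor product of an algebra with the tensor algebra.
\<close>

definition lin_ext :: "('w \<Rightarrow> 'c \<Rightarrow> 'v) \<Rightarrow> ('w \<Rightarrow>\<^sub>0 'c::zero) \<Rightarrow> 'v::comm_monoid_add" where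
  "lin_ext f p = (\<Sum>w\<in>Poly_Mapping.keys p. f w (Poly_Mapping.lookup p w))"

definition free_scale :: "'a::field \<Rightarrow> ('w \<Rightarrow>\<^sub>0 'a) \<Rightarrow> ('w \<Rightarrow>\<^sub>0 'a)" where
  "free_scale c p = Poly_Mapping.map ((*) c) p"

global_interpretation free: vector_space free_scale
  by unfold_locales
    (auto intro!: poly_mapping_eqI simp: free_scale_def Poly_Mapping.map.rep_eq lookup_add when_def
      distrib_right mult.assoc simp flip: distrib_left)

locale algebra_over_field = vector_space smul
  for smul :: "'a::field \<Rightarrow> 'u::ring_1 \<Rightarrow> 'u" +
  assumes smul_mult_left: "smul c x * y = smul c (x * y)"
    and smul_mult_right: "x * smul c y = smul c (x * y)"

definition eval_free ::
    "('a::field \<Rightarrow> 'u::ring_1 \<Rightarrow> 'u) \<Rightarrow> ('n \<Rightarrow> 'u) \<Rightarrow> ('n list \<Rightarrow>\<^sub>0 'a) \<Rightarrow> 'u" where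
  "eval_free smul gen = lin_ext (\<lambda>w c. smul c (prod_list (map gen w)))"

text \<open>The two-sided ideal generated by the defining relations, which the words \<open>u\<close>, \<open>v\<close> surround.\<close>

definition relation_ideal ::
    "'a::field^('n \<times> 'n)^('n \<times> 'n) \<Rightarrow> 'a^'n^('n::finite \<times> 'n) \<Rightarrow> ('n list \<Rightarrow>\<^sub>0 'a) set" where
  "relation_ideal \<sigma> C = free.span
     {Poly_Mapping.single (u @ [i, j] @ v) 1
        - (\<Sum>k\<in>UNIV. \<Sum>l\<in>UNIV. Poly_Mapping.single (u @ [k, l] @ v) (\<sigma> $ (i, j) $ (k, l)))
        - (\<Sum>k\<in>UNIV. Poly_Mapping.single (u @ [k] @ v) (C $ (i, j) $ k))
      | u i j v. True}"

text \<open>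
  The algebra with generators \<open>gen\<close> and relations \<open>gen i * gen j - \<sigma> gen k * gen l = C gen k\<close> is
  determined up to isomorphism by \<open>generated\<close> and \<open>relations\<close>.
\<close>

locale quantum_lie_algebra = algebra_over_field smul
  for \<sigma> :: "'a::field^('n \<times> 'n)^('n::finite \<times> 'n)"
    and C :: "'a^'n^('n::finite \<times> 'n)"
    and smul :: "'a \<Rightarrow> 'u::ring_1 \<Rightarrow> 'u" and gen :: "'n::finite \<Rightarrow> 'u" +
  assumes invertible_sigma: "invertible \<sigma>"
    and eigenvalue_1: "\<exists>v. v \<noteq> 0 \<and> \<sigma> *v v = v"
    and yang_baxter_R: "yang_baxter (R_matrix \<sigma> C)"
    and C_factors: "\<exists>t. C = (mat 1 - \<sigma>) ** t"
    and generated: "range (eval_free smul gen) = UNIV"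
    and relations: "eval_free smul gen p = 0 \<longleftrightarrow> p \<in> relation_ideal \<sigma> C"

section \<open>Wedge polynomials and the right actions\<close>

text \<open>
  A finitely supported \<open>w\<close> on words stands for the sum of the \<open>w I \<otimes> \<gamma> I\<close>, an element of the
  algebra tensored with the tensor algebra of the \<open>\<gamma>\<close>'s. The map \<open>wedge\<close> replaces \<open>\<otimes>\<close> by
  \<open>\<and>\<close>, which is a combination of tensor products by means of the antisymmetrizer. So wedge
  polynomials are the elements of \<open>range wedge\<close>, and \<open>w\<close> is a coefficient family of \<open>wedge w\<close>.
  The generators act on coefficient families.
\<close>

definition wscale ::
    "('a::field \<Rightarrow> 'u::ring_1 \<Rightarrow> 'u) \<Rightarrow> 'a \<Rightarrow> ('n list \<Rightarrow>\<^sub>0 'u) \<Rightarrow> ('n list \<Rightarrow>\<^sub>0 'u)" where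
  "wscale smul c w = Poly_Mapping.map (smul c) w"

definition wedge ::
    "'a::field^('n \<times> 'n)^('n::finite \<times> 'n) \<Rightarrow> ('a \<Rightarrow> 'u::ring_1 \<Rightarrow> 'u)
      \<Rightarrow> ('n list \<Rightarrow>\<^sub>0 'u) \<Rightarrow> ('n list \<Rightarrow>\<^sub>0 'u)" where
  "wedge \<sigma> smul = lin_ext (\<lambda>I a. \<Sum>K | length K = length I.
     Poly_Mapping.single K (smul (antisym \<sigma> (length I) I K) a))"

definition wedge_polynomials ::
    "'a::field^('n \<times> 'n)^('n::finite \<times> 'n) \<Rightarrow> ('a \<Rightarrow> 'u::ring_1 \<Rightarrow> 'u)
      \<Rightarrow> ('n list \<Rightarrow>\<^sub>0 'u) set" where
  "wedge_polynomials \<sigma> smul = range (wedge \<sigma> smul)"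

definition gamma_act :: "'n \<Rightarrow> ('n list \<Rightarrow>\<^sub>0 'u::ring_1) \<Rightarrow> ('n list \<Rightarrow>\<^sub>0 'u)" where
  "gamma_act j = lin_ext (\<lambda>I a. Poly_Mapping.single (I @ [j]) a)"

text \<open>
  In the next two recursions the word is reversed: its head is the rightmost \<open>\<gamma>\<close>, the first
  one to be passed by the \<open>\<chi>\<close> or \<open>\<Omega>\<close> coming from the right.
\<close>

primrec chi_monomial ::
    "'a::field^('n \<times> 'n)^('n \<times> 'n) \<Rightarrow> 'a^'n^('n::finite \<times> 'n) \<Rightarrow> ('a \<Rightarrow> 'u::ring_1 \<Rightarrow> 'u)
      \<Rightarrow> ('n \<Rightarrow> 'u) \<Rightarrow> 'n list \<Rightarrow> 'u \<Rightarrow> 'n \<Rightarrow> ('n list \<Rightarrow>\<^sub>0 'u)" where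
  "chi_monomial \<sigma> C smul gen [] a j = Poly_Mapping.single [] (a * gen j)"
| "chi_monomial \<sigma> C smul gen (i # I) a j =
     (\<Sum>k\<in>UNIV. \<Sum>l\<in>UNIV. wscale smul (\<sigma> $ (i, j) $ (k, l))
        (gamma_act l (chi_monomial \<sigma> C smul gen I a k)))
   + (\<Sum>k\<in>UNIV. Poly_Mapping.single (rev I @ [k]) (smul (C $ (i, j) $ k) a))"

definition chi_act ::
    "'a::field^('n \<times> 'n)^('n \<times> 'n) \<Rightarrow> 'a^'n^('n::finite \<times> 'n) \<Rightarrow> ('a \<Rightarrow> 'u::ring_1 \<Rightarrow> 'u)
      \<Rightarrow> ('n \<Rightarrow> 'u) \<Rightarrow> 'n \<Rightarrow> ('n list \<Rightarrow>\<^sub>0 'u) \<Rightarrow> ('n list \<Rightarrow>\<^sub>0 'u)" where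
  "chi_act \<sigma> C smul gen j = lin_ext (\<lambda>I a. chi_monomial \<sigma> C smul gen (rev I) a j)"

primrec omega_monomial ::
    "'a::field^('n \<times> 'n)^('n::finite \<times> 'n) \<Rightarrow> ('a \<Rightarrow> 'u::ring_1 \<Rightarrow> 'u)
      \<Rightarrow> 'n list \<Rightarrow> 'u \<Rightarrow> 'n \<Rightarrow> ('n list \<Rightarrow>\<^sub>0 'u)" where
  "omega_monomial \<sigma> smul [] a j = 0"
| "omega_monomial \<sigma> smul (i # I) a j =
     - (\<Sum>m\<in>UNIV. \<Sum>k\<in>UNIV. wscale smul (matrix_inv \<sigma> $ (m, i) $ (k, j))
          (gamma_act k (omega_monomial \<sigma> smul I a m)))
     + (if i = j then Poly_Mapping.single (rev I) a else 0)"

definition omega_act ::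
    "'a::field^('n \<times> 'n)^('n::finite \<times> 'n) \<Rightarrow> ('a \<Rightarrow> 'u::ring_1 \<Rightarrow> 'u)
      \<Rightarrow> 'n \<Rightarrow> ('n list \<Rightarrow>\<^sub>0 'u) \<Rightarrow> ('n list \<Rightarrow>\<^sub>0 'u)" where
  "omega_act \<sigma> smul j = lin_ext (\<lambda>I a. omega_monomial \<sigma> smul (rev I) a j)"

section \<open>The BRST operator\<close>

definition AXA_factor ::
    "'a::field^('n \<times> 'n)^('n \<times> 'n) \<Rightarrow> 'a^'n^('n::finite \<times> 'n) \<Rightarrow> nat \<Rightarrow> nat
      \<Rightarrow> ('n option, 'a) word_matrix" where
  "AXA_factor \<sigma> C r k = (\<lambda>I J. wm_one (r + 1) I J
     - (-1) ^ (r - k) *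
       wm_prod (r + 1) (map (\<lambda>m. on_factors m (R_matrix \<sigma> C)) ([k..<r] @ [r, r])) I J)"

definition AXA ::
    "'a::field^('n \<times> 'n)^('n \<times> 'n) \<Rightarrow> 'a^'n^('n::finite \<times> 'n) \<Rightarrow> nat \<Rightarrow> ('n, 'a) word_matrix" where
  "AXA \<sigma> C r = (\<lambda>J I. (-1) ^ (r + 1) *
     (\<Sum>K | length K = r.
        wm_prod (r + 1) (map (AXA_factor \<sigma> C r) (rev [1..<r + 1]))
          (map Some J) (map Some K @ [None])
        * antisym \<sigma> r K I))"

definition BRST_coefficients ::
    "'a::field^('n \<times> 'n)^('n \<times> 'n) \<Rightarrow> 'a^'n^('n::finite \<times> 'n)
      \<Rightarrow> (nat \<Rightarrow> ('n, 'a) word_matrix) \<Rightarrow> bool" where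
  "BRST_coefficients \<sigma> C X \<longleftrightarrow> (\<forall>r\<ge>1.
     wm_mult r (wm_mult (r + 1) (antisym \<sigma> (r + 1)) (X r)) (antisym \<sigma> r) = AXA \<sigma> C r)"

text \<open>
  In \<open>fold\<close> the head of the list acts first: these are the last \<open>\<Omega>\<close> index of \<open>J\<close> and the first
  \<open>\<gamma>\<close> index of \<open>I\<close>.
\<close>

definition BRST_term ::
    "'a::field^('n \<times> 'n)^('n::finite \<times> 'n) \<Rightarrow> ('a \<Rightarrow> 'u::ring_1 \<Rightarrow> 'u)
      \<Rightarrow> (nat \<Rightarrow> ('n, 'a) word_matrix) \<Rightarrow> nat \<Rightarrow> ('n list \<Rightarrow>\<^sub>0 'u) \<Rightarrow> ('n list \<Rightarrow>\<^sub>0 'u)" where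
  "BRST_term \<sigma> smul X r w =
     (\<Sum>J | length J = r + 1. \<Sum>I | length I = r.
        fold gamma_act I (wscale smul (X r J I) (fold (omega_act \<sigma> smul) (rev J) w)))"

text \<open>
  The sum over \<open>r\<close> is finite, as \<open>BRST_term \<sigma> smul X r w = 0\<close> unless \<open>w\<close> contains a word of
  length at least \<open>r + 1\<close>.
\<close>

definition BRST_coeff ::
    "'a::field^('n \<times> 'n)^('n \<times> 'n) \<Rightarrow> 'a^'n^('n::finite \<times> 'n) \<Rightarrow> ('a \<Rightarrow> 'u::ring_1 \<Rightarrow> 'u)
      \<Rightarrow> ('n \<Rightarrow> 'u) \<Rightarrow> (nat \<Rightarrow> ('n, 'a) word_matrix) \<Rightarrow> ('n list \<Rightarrow>\<^sub>0 'u) \<Rightarrow> ('n list \<Rightarrow>\<^sub>0 'u)" where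
  "BRST_coeff \<sigma> C smul gen X w =
     (\<Sum>i\<in>UNIV. chi_act \<sigma> C smul gen i (omega_act \<sigma> smul i w))
   + Sum_any (\<lambda>r. if 1 \<le> r \<and> enat r < height \<sigma> then BRST_term \<sigma> smul X r w else 0)"

text \<open>
  \<open>Q\<close> on wedge polynomials. The \<open>THE\<close> is meaningful only if the result does not depend on the
  coefficient family \<open>w\<close> of \<open>m\<close>.
\<close>

definition BRST ::
    "'a::field^('n \<times> 'n)^('n \<times> 'n) \<Rightarrow> 'a^'n^('n::finite \<times> 'n) \<Rightarrow> ('a \<Rightarrow> 'u::ring_1 \<Rightarrow> 'u)
      \<Rightarrow> ('n \<Rightarrow> 'u) \<Rightarrow> (nat \<Rightarrow> ('n, 'a) word_matrix) \<Rightarrow> ('n list \<Rightarrow>\<^sub>0 'u) \<Rightarrow> ('n list \<Rightarrow>\<^sub>0 'u)" where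
  "BRST \<sigma> C smul gen X m =
     (THE m'. \<exists>w. m = wedge \<sigma> smul w \<and> m' = wedge \<sigma> smul (BRST_coeff \<sigma> C smul gen X w))"

section \<open>The bar complex\<close>

text \<open>
  The direct sum of all tensor powers of \<open>'u\<close> over \<open>'a\<close>: the free vector space on lists
  (a list standing for the tensor product of its entries) modulo multilinearity. Its elements
  are cosets.
\<close>

definition multilinear_relations ::
    "('a::field \<Rightarrow> 'u::ring_1 \<Rightarrow> 'u) \<Rightarrow> ('u list \<Rightarrow>\<^sub>0 'a) set" where
  "multilinear_relations smul = free.span
     ({Poly_Mapping.single (xs @ [a + b] @ ys) 1 - Poly_Mapping.single (xs @ [a] @ ys) 1
         - Poly_Mapping.single (xs @ [b] @ ys) 1 | xs a b ys. True}
      \<union> {Poly_Mapping.single (xs @ [smul c a] @ ys) 1 - Poly_Mapping.single (xs @ [a] @ ys) c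
         | xs c a ys. True})"

definition tensor_class ::
    "('a::field \<Rightarrow> 'u::ring_1 \<Rightarrow> 'u) \<Rightarrow> ('u list \<Rightarrow>\<^sub>0 'a) \<Rightarrow> ('u list \<Rightarrow>\<^sub>0 'a) set" where
  "tensor_class smul p = {q. q - p \<in> multilinear_relations smul}"

text \<open>
  With entries numbered from \<open>0\<close>, the product of the entries \<open>p\<close> and \<open>p + 1\<close> of a list of length
  \<open>n + 1\<close> has the sign \<open>(-1) ^ (n - 1 - p)\<close>.
\<close>

definition bar_free :: "('u::ring_1 list \<Rightarrow>\<^sub>0 'a::field) \<Rightarrow> ('u list \<Rightarrow>\<^sub>0 'a)" where
  "bar_free = lin_ext (\<lambda>as c. \<Sum>p<length as - 1.
     Poly_Mapping.single (take p as @ [as ! p * as ! (p + 1)] @ drop (p + 2) as)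
       ((-1) ^ (length as - 2 - p) * c))"

definition bar ::
    "('a::field \<Rightarrow> 'u::ring_1 \<Rightarrow> 'u) \<Rightarrow> ('u list \<Rightarrow>\<^sub>0 'a) set \<Rightarrow> ('u list \<Rightarrow>\<^sub>0 'a) set" where
  "bar smul T = (THE T'. \<exists>p. T = tensor_class smul p \<and> T' = tensor_class smul (bar_free p))"

text \<open>
  The map to chains. No antisymmetrizer appears because a wedge polynomial is already expanded
  into tensor products: it is enough to replace each \<open>\<gamma>\<close> by the corresponding \<open>gen\<close>.
\<close>

definition chain_of ::
    "('a::field \<Rightarrow> 'u::ring_1 \<Rightarrow> 'u) \<Rightarrow> ('n \<Rightarrow> 'u) \<Rightarrow> ('n list \<Rightarrow>\<^sub>0 'u) \<Rightarrow> ('u list \<Rightarrow>\<^sub>0 'a) set" where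
  "chain_of smul gen m =
     tensor_class smul (lin_ext (\<lambda>K a. Poly_Mapping.single (a # map gen K) 1) m)"

lemma (in algebra_over_field) chain_of_wedge_monomial:
  fixes \<sigma> :: "'a^('n \<times> 'n)^('n::finite \<times> 'n)"
  shows "chain_of smul gen (wedge \<sigma> smul (Poly_Mapping.single I a)) =
   tensor_class smul (\<Sum>K | length K = length I.
     Poly_Mapping.single (a # map gen K) (antisym \<sigma> (length I) I K))"
proof -
  let ?n = "length I"
  let ?c = "antisym \<sigma> ?n I"
  let ?W = "{K::'n list. length K = ?n}"
  let ?S = "multilinear_relations smul"
  have fin: "finite ?W"
    using finite_lists_length_eq[of "UNIV :: 'n set" ?n] by simp
  have "wedge \<sigma> smul (Poly_Mapping.single I a)
      = (\<Sum>K\<in>?W. Poly_Mapping.single K (smul (?c K) a))"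
    by (cases "a = 0") (simp_all add: wedge_def lin_ext_def)
  moreover define p where "p = (\<Sum>K\<in>?W. Poly_Mapping.single K (smul (?c K) a))"
  ultimately have w: "wedge \<sigma> smul (Poly_Mapping.single I a) = p" by simp
  have look: "Poly_Mapping.lookup p K = (if K \<in> ?W then smul (?c K) a else 0)" for K
    using fin by (auto simp: p_def lookup_sum lookup_single when_def sum.delta)
  have keys: "Poly_Mapping.keys p = {K \<in> ?W. smul (?c K) a \<noteq> 0}"
    by (auto simp: in_keys_iff look split: if_splits)
  have sc: "Poly_Mapping.single (xs @ [smul c b] @ ys) 1 - Poly_Mapping.single (xs @ [b] @ ys) c \<in> ?S"
    for xs c b ys
    unfolding multilinear_relations_def by (intro free.span_base UnI2 CollectI exI conjI) auto
  have zero: "Poly_Mapping.single (0 # ys) 1 \<in> ?S" for ys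
    using sc[of "[]" 0 0 ys] by simp
  have diff: "lin_ext (\<lambda>K b. Poly_Mapping.single (b # map gen K) 1) p
      - (\<Sum>K\<in>?W. Poly_Mapping.single (a # map gen K) (?c K)) \<in> ?S" (is "?l - ?r \<in> _")
  proof -
    have l: "?l = (\<Sum>K\<in>?W. if smul (?c K) a \<noteq> 0
        then Poly_Mapping.single (smul (?c K) a # map gen K) 1 else 0)"
      unfolding lin_ext_def keys using fin
      by (subst sum.inter_filter[symmetric]) (auto simp: look intro!: sum.cong)
    have "(if smul (?c K) a \<noteq> 0 then Poly_Mapping.single (smul (?c K) a # map gen K) 1 else 0)
        - Poly_Mapping.single (a # map gen K) (?c K) \<in> ?S" for K
    proof (cases "smul (?c K) a = 0")
      case False
      then show ?thesis using sc[of "[]" "?c K" a "map gen K"] by simp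
    next
      case True
      have "Poly_Mapping.single (0 # map gen K) 1 - Poly_Mapping.single (a # map gen K) (?c K) \<in> ?S"
        using sc[of "[]" "?c K" a "map gen K"] True by simp
      from free.span_diff[OF this[unfolded multilinear_relations_def]
          zero[of "map gen K", unfolded multilinear_relations_def]]
      show ?thesis using True by (simp add: multilinear_relations_def)
    qed
    then show ?thesis
      unfolding l sum_subtractf[symmetric] multilinear_relations_def by (intro free.span_sum) auto
  qed
  have cls: "tensor_class smul x = tensor_class smul y" if "x - y \<in> ?S" for x y
  proof -
    have "q - x \<in> ?S \<longleftrightarrow> q - y \<in> ?S" for q
      using free.span_add[of "q - x" _ "x - y"] free.span_diff[of "q - y" _ "x - y"] that
      unfolding multilinear_relations_def by fastforce
    then show ?thesis by (simp add: tensor_class_def)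
  qed
  show ?thesis
    unfolding chain_of_def w by (rule cls[OF diff])
qed

end

theory Submission
  imports Defs
begin

text \<open>
  Extend the alphabet by a letter \<open>0\<close> with \<open>\<chi>\<^sub>0 = 1\<close>, so that \<open>\<sigma>\<close> and \<open>C\<close> together become \<open>R\<close>. On words of
  length \<open>n\<close> without \<open>0\<close> the \<open>\<Omega>\<close>'s act by shuffles in \<open>R\<^sup>-\<^sup>1\<close>, and a \<open>\<chi>\<close> acts by
  \<open>R\<^bsub>n-1\<^esub> \<cdots> R\<^sub>1\<close> followed by the multiplication of the first letter into the coefficient. Let
  \<open>F\<^sub>k\<close> be the product of the first \<open>k\<close> bracketed factors in the definition of \<open>AXA\<close> and \<open>N\<^sub>k\<close> the
  signed sum over the ways to move \<open>k\<close> letters to the end by \<open>R\<^sup>-\<^sup>1\<close>. Then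
  \<open>\<Sum>\<^sub>k (-1)\<^sup>k N\<^bsub>k+1\<^esub> F\<^sub>k\<close> is the shuffle \<open>1 - R\<^bsub>n-1\<^esub> + R\<^bsub>n-2\<^esub> R\<^bsub>n-1\<^esub> - \<dots>\<close>, and this never carries a
  \<open>0\<close> to the last place. The first term of \<open>Q\<close> lacks the words with a \<open>0\<close> in the last place, since there is no
  \<open>\<Omega>\<^sup>0\<close>; the terms \<open>Q\<^bsub>(r)\<^esub>\<close> contribute exactly these. So \<open>Q\<close> becomes \<open>(-1)\<^bsup>n-1\<^esup> A\<^bsub>1\<rightarrow>n\<^esub>(R)\<close> followed by the
  multiplication of the first letter into the coefficient.

  By the relations of the algebra, the multiplication of two adjacent entries of a chain takes \<open>1 - R\<close>
  to the negative sum of the removals of a \<open>0\<close> from the two places. Since \<open>A\<^bsub>1\<rightarrow>n\<^esub>(R)\<close> is right divisible by every \<open>1 - R\<^sub>p\<close>,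
  the bar differential of an antisymmetric chain telescopes to the same expression, whence
  \<open>b \<circ> i = i \<circ> Q\<close>. As \<open>i\<close> is one-to-one, \<open>Q\<close> is well defined and \<open>Q\<^sup>2 = 0\<close> follows from \<open>b\<^sup>2 = 0\<close>.
\<close>

section \<open>Shuffles in a braid representation\<close>

text \<open>\<open>BRST_coefficients\<close> fixes \<open>X r\<close> only between two
  antisymmetrizers, so each term of Q has to be rewritten until \<open>X r\<close> stands between
  them. The right one comes from \<open>wedge\<close>: the antisymmetrizer of the n - 1 remaining
  letters has that of the last r letters as a left factor. The left one must come out of r + 1
  successive \<Omega>'s, which braid by the inverse of \<sigma>. Letters taken to the end one by one
  arrive in every order; these orders differ from the reversed one by crossings in R itself, and the
  signed sum of these crossings is the antisymmetrizer in R.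

  The bracketed factors of \<open>AXA\<close> are those that Abel summation produces from the
  recursion of N at the last letter: of the two final factors R, one completes the product that
  cancels crossings in the inverse of R, the other belongs to the recursion of the shuffle.

  R creates zeros but never loses one. So operators may be computed on the extended alphabet, where
  the braid relations hold, and the words with a 0 discarded at the end of a product by
  \<open>zero_free\<close>.\<close>

definition ascending :: "(nat \<Rightarrow> 'b::ring_1) \<Rightarrow> nat \<Rightarrow> nat \<Rightarrow> 'b" where
  "ascending r i j = prod_list (map r [i..<j])"

definition descending :: "(nat \<Rightarrow> 'b::ring_1) \<Rightarrow> nat \<Rightarrow> nat \<Rightarrow> 'b" where
  "descending r i j = prod_list (map r (rev [i..<j]))"

lemma ascending_same [simp]: "j \<le> i \<Longrightarrow> ascending r i j = 1"
  and descending_same [simp]: "j \<le> i \<Longrightarrow> descending r i j = 1"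
  by (simp_all add: ascending_def descending_def)

lemma ascending_snoc: "i \<le> j \<Longrightarrow> ascending r i (Suc j) = ascending r i j * r j"
  and descending_snoc: "i \<le> j \<Longrightarrow> descending r i (Suc j) = r j * descending r i j"
  by (simp_all add: ascending_def descending_def)

lemma ascending_Cons: "i < j \<Longrightarrow> ascending r i j = r i * ascending r (Suc i) j"
  and descending_Cons: "i < j \<Longrightarrow> descending r i j = descending r (Suc i) j * r i"
  by (simp_all add: ascending_def descending_def upt_conv_Cons)

text \<open>
  All of the following act on the letters \<open>p, \<dots>, p + m\<close> and thus use the generators
  \<open>r p, \<dots>, r (p + m - 1)\<close>.
\<close>

primrec last_shuffle :: "(nat \<Rightarrow> 'b::ring_1) \<Rightarrow> nat \<Rightarrow> nat \<Rightarrow> 'b" where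
  "last_shuffle r p 0 = 1"
| "last_shuffle r p (Suc m) = 1 - last_shuffle r p m * r (p + m)"

primrec last_unshuffle :: "(nat \<Rightarrow> 'b::ring_1) \<Rightarrow> nat \<Rightarrow> nat \<Rightarrow> 'b" where
  "last_unshuffle r p 0 = 1"
| "last_unshuffle r p (Suc m) = 1 - r (p + m) * last_unshuffle r p m"

fun first_shuffle :: "(nat \<Rightarrow> 'b::ring_1) \<Rightarrow> nat \<Rightarrow> nat \<Rightarrow> 'b" where
  "first_shuffle r p 0 = 1"
| "first_shuffle r p (Suc m) = 1 - first_shuffle r (Suc p) m * r p"

fun first_unshuffle :: "(nat \<Rightarrow> 'b::ring_1) \<Rightarrow> nat \<Rightarrow> nat \<Rightarrow> 'b" where
  "first_unshuffle r p 0 = 1"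
| "first_unshuffle r p (Suc m) = 1 - r p * first_unshuffle r (Suc p) m"

primrec antisymmetrizer :: "(nat \<Rightarrow> 'b::ring_1) \<Rightarrow> nat \<Rightarrow> nat \<Rightarrow> 'b" where
  "antisymmetrizer r p 0 = 1"
| "antisymmetrizer r p (Suc m) = last_shuffle r p (Suc m) * antisymmetrizer r p m"

primrec iterated_shuffle :: "(nat \<Rightarrow> 'b::ring_1) \<Rightarrow> nat \<Rightarrow> nat \<Rightarrow> nat \<Rightarrow> 'b" where
  "iterated_shuffle r p m 0 = 1"
| "iterated_shuffle r p m (Suc k) = last_shuffle r p m * iterated_shuffle r p (m - 1) k"

fun unshuffles :: "(nat \<Rightarrow> 'b::ring_1) \<Rightarrow> nat \<Rightarrow> nat \<Rightarrow> nat \<Rightarrow> 'b" where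
  "unshuffles r p 0 m = 1"
| "unshuffles r p (Suc d) m = unshuffles r (Suc p) d m * first_unshuffle r p (Suc (d + m))"

lemma last_shuffle_sum:
  "last_shuffle r p m = (\<Sum>j<Suc m. (-1) ^ j * ascending r (p + m - j) (p + m))"
proof (induction m)
  case (Suc m)
  have "(\<Sum>j<Suc (Suc m). (-1) ^ j * ascending r (p + Suc m - j) (p + Suc m))
      = 1 + (\<Sum>j<Suc m. (-1) ^ Suc j * ascending r (p + m - j) (Suc (p + m)))"
    by (subst sum.lessThan_Suc_shift) simp
  also have "(\<Sum>j<Suc m. (-1) ^ Suc j * ascending r (p + m - j) (Suc (p + m)))
      = - ((\<Sum>j<Suc m. (-1) ^ j * ascending r (p + m - j) (p + m)) * r (p + m))"
    unfolding sum_distrib_right sum_negf[symmetric]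
    by (intro sum.cong) (simp_all add: ascending_snoc mult.assoc)
  finally show ?case using Suc by simp
qed simp

text \<open>The longest summand, which moves the letter p, is split off; the defining recursion
  works at the other end, at the last letter.\<close>

lemma last_shuffle_peel:
  "last_shuffle r p (Suc m)
    = last_shuffle r (Suc p) m + (-1) ^ Suc m * ascending r p (Suc (p + m))"
proof (induction m)
  case 0
  then show ?case by (simp add: ascending_def)
next
  case (Suc m)
  have "last_shuffle r p (Suc (Suc m)) = 1 - last_shuffle r p (Suc m) * r (Suc (p + m))" by simp
  also have "\<dots> = last_shuffle r (Suc p) (Suc m)
      + (-1) ^ Suc (Suc m) * (ascending r p (Suc (p + m)) * r (Suc (p + m)))"
    unfolding Suc by (simp add: algebra_simps)
  finally show ?case by (simp add: ascending_snoc)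
qed

lemma first_shuffle_peel:
  "first_shuffle r p (Suc m) = first_shuffle r p m + (-1) ^ Suc m * descending r p (Suc (p + m))"
proof (induction m arbitrary: p)
  case 0
  then show ?case by (simp add: descending_def)
next
  case (Suc m)
  have "first_shuffle r p (Suc (Suc m)) = 1 - first_shuffle r (Suc p) (Suc m) * r p" by simp
  also have "\<dots> = first_shuffle r p (Suc m)
      + (-1) ^ Suc (Suc m) * (descending r (Suc p) (Suc (Suc p + m)) * r p)"
    unfolding Suc.IH[of "Suc p"] by (simp add: algebra_simps)
  finally show ?case by (simp add: descending_Cons[of p])
qed

section \<open>Transport of shuffles along intertwiners\<close>

lemma prod_list_intertwine:
  fixes y :: "'b::ring_1"
  assumes "\<And>k. k \<in> set ks \<Longrightarrow> r k * y = y * q k"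
  shows "prod_list (map r ks) * y = y * prod_list (map q ks)"
  using assms
proof (induction ks)
  case (Cons k ks)
  have "prod_list (map r (k # ks)) * y = r k * (prod_list (map r ks) * y)"
    by (simp add: mult.assoc)
  also have "prod_list (map r ks) * y = y * prod_list (map q ks)" using Cons by simp
  also have "r k * (y * prod_list (map q ks)) = (r k * y) * prod_list (map q ks)"
    by (simp only: mult.assoc)
  also have "r k * y = y * q k" using Cons.prems by simp
  finally show ?case by (simp add: mult.assoc)
qed simp

text \<open>The second family \<open>q\<close> and the offset \<open>p'\<close> are free because the
  intertwiner may shift the places by one, shorten the words by a letter or lengthen them by a
  suffix.\<close>

lemma last_shuffle_intertwine:
  assumes "\<And>i. i < m \<Longrightarrow> r (p + i) * y = y * q (p' + i)"
  shows "last_shuffle r p m * y = y * last_shuffle q p' m"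
  using assms
proof (induction m)
  case (Suc m)
  have "last_shuffle r p (Suc m) * y = y - last_shuffle r p m * (r (p + m) * y)"
    by (simp add: left_diff_distrib mult.assoc)
  also have "r (p + m) * y = y * q (p' + m)" using Suc.prems by simp
  also have "last_shuffle r p m * (y * q (p' + m)) = y * last_shuffle q p' m * q (p' + m)"
    using Suc by (simp flip: mult.assoc)
  finally show ?case by (simp add: right_diff_distrib mult.assoc)
qed simp

lemma first_shuffle_intertwine:
  assumes "\<And>i. i < m \<Longrightarrow> r (p + i) * y = y * q (p' + i)"
  shows "first_shuffle r p m * y = y * first_shuffle q p' m"
  using assms
proof (induction m arbitrary: p p')
  case (Suc m)
  have "first_shuffle r p (Suc m) * y = y - first_shuffle r (Suc p) m * (r p * y)"
    by (simp add: left_diff_distrib mult.assoc)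
  also have "r p * y = y * q p'" using Suc.prems[of 0] by simp
  also have "first_shuffle r (Suc p) m * (y * q p') = y * first_shuffle q (Suc p') m * q p'"
    using Suc.IH[of "Suc p" "Suc p'"] Suc.prems[of "Suc i" for i] by (simp flip: mult.assoc)
  finally show ?case by (simp add: right_diff_distrib mult.assoc)
qed simp

lemma antisymmetrizer_intertwine:
  assumes "\<And>i. i < m \<Longrightarrow> r (p + i) * y = y * q (p' + i)"
  shows "antisymmetrizer r p m * y = y * antisymmetrizer q p' m"
  using assms
proof (induction m)
  case (Suc m)
  have "antisymmetrizer r p (Suc m) * y = last_shuffle r p (Suc m) * (antisymmetrizer r p m * y)"
    by (simp add: mult.assoc)
  also have "antisymmetrizer r p m * y = y * antisymmetrizer q p' m" using Suc by simp
  also have "last_shuffle r p (Suc m) * (y * antisymmetrizer q p' m)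
      = y * last_shuffle q p' (Suc m) * antisymmetrizer q p' m"
    using last_shuffle_intertwine[of "Suc m" r p y q p'] Suc.prems by (simp flip: mult.assoc)
  finally show ?case by (simp add: mult.assoc)
qed simp

lemma iterated_shuffle_intertwine:
  assumes "\<And>i. i < m \<Longrightarrow> r (p + i) * y = y * q (p' + i)"
  shows "iterated_shuffle r p m k * y = y * iterated_shuffle q p' m k"
  using assms
proof (induction k arbitrary: m)
  case (Suc k)
  have "iterated_shuffle r p m (Suc k) * y = last_shuffle r p m * (iterated_shuffle r p (m - 1) k * y)"
    by (simp add: mult.assoc)
  also have "iterated_shuffle r p (m - 1) k * y = y * iterated_shuffle q p' (m - 1) k"
    using Suc by simp
  also have "last_shuffle r p m * (y * iterated_shuffle q p' (m - 1) k)
      = y * last_shuffle q p' m * iterated_shuffle q p' (m - 1) k"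
    using last_shuffle_intertwine[of m r p y q p'] Suc.prems by (simp flip: mult.assoc)
  finally show ?case by (simp add: mult.assoc)
qed simp

section \<open>Factorizations of the antisymmetrizer\<close>

locale braid =
  fixes r :: "nat \<Rightarrow> 'b::ring_1"
  assumes braid: "r k * r (Suc k) * r k = r (Suc k) * r k * r (Suc k)"
    and far: "Suc i < j \<Longrightarrow> r i * r j = r j * r i"
begin

lemma far_ascending: "j < k \<Longrightarrow> ascending r i j * r k = r k * ascending r i j"
  and far_descending: "j < k \<Longrightarrow> descending r i j * r k = r k * descending r i j"
  unfolding ascending_def descending_def by (intro prod_list_intertwine far; simp)+

text \<open>A crossing is pulled through the strand that \<open>ascending\<close> carries across it.
  The braid relation is used once, where the strand meets the crossing; all other generators commute
  with it.\<close>

lemma ascending_shift: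
  assumes "i \<le> k" "Suc k < j"
  shows "ascending r i j * r k = r (Suc k) * ascending r i j"
proof -
  have "Suc (Suc k) \<le> j" using assms by simp
  then show ?thesis
  proof (induction j rule: nat_induct_at_least)
    case base
    have "ascending r i (Suc (Suc k)) * r k = ascending r i k * (r k * r (Suc k) * r k)"
      using assms by (simp add: ascending_snoc mult.assoc)
    also have "\<dots> = ascending r i k * r (Suc k) * r k * r (Suc k)"
      unfolding braid by (simp only: mult.assoc)
    also have "\<dots> = r (Suc k) * ascending r i (Suc (Suc k))"
      using assms by (simp add: far_ascending ascending_snoc mult.assoc)
    finally show ?case .
  next
    case (Suc j)
    have "ascending r i (Suc j) * r k = ascending r i j * (r j * r k)"
      using assms Suc.hyps by (simp add: ascending_snoc mult.assoc)
    also have "r j * r k = r k * r j" using Suc.hyps by (intro far[symmetric]) simp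
    also have "ascending r i j * (r k * r j) = r (Suc k) * (ascending r i j * r j)"
      using Suc.IH by (simp flip: mult.assoc)
    finally show ?case using assms Suc.hyps by (simp add: ascending_snoc)
  qed
qed

lemma descending_shift:
  assumes "i \<le> k" "Suc k < j"
  shows "r k * descending r i j = descending r i j * r (Suc k)"
proof -
  have "Suc (Suc k) \<le> j" using assms by simp
  then show ?thesis
  proof (induction j rule: nat_induct_at_least)
    case base
    have "r k * descending r i (Suc (Suc k)) = (r k * r (Suc k) * r k) * descending r i k"
      using assms by (simp add: descending_snoc mult.assoc)
    also have "\<dots> = r (Suc k) * r k * (r (Suc k) * descending r i k)"
      unfolding braid by (simp only: mult.assoc)
    also have "\<dots> = descending r i (Suc (Suc k)) * r (Suc k)"
      using assms by (simp add: far_descending[symmetric] descending_snoc mult.assoc)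
    finally show ?case .
  next
    case (Suc j)
    have "r k * descending r i (Suc j) = (r k * r j) * descending r i j"
      using assms Suc.hyps by (simp add: descending_snoc mult.assoc)
    also have "r k * r j = r j * r k" using Suc.hyps by (intro far) simp
    also have "(r j * r k) * descending r i j = (r j * descending r i j) * r (Suc k)"
      using Suc.IH by (simp add: mult.assoc)
    finally show ?case using assms Suc.hyps by (simp add: descending_snoc)
  qed
qed

lemma last_shuffle_descending:
  "last_shuffle r p m * descending r p (Suc (p + m))
    = descending r p (Suc (p + m)) * last_shuffle r (Suc p) m"
  by (rule last_shuffle_intertwine) (simp add: descending_shift)

text \<open>Both sides sum over the choices of one letter for the last place and another for the
  first, made in the two possible orders. In the induction only the summand of
  \<open>first_shuffle\<close> that moves the last letter fails to commute with the new generator;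
  it is split off by \<open>first_shuffle_peel\<close>.\<close>

lemma last_first_shuffle:
  "last_shuffle r p (Suc m) * first_shuffle r p m
    = first_shuffle r p (Suc m) * last_shuffle r (Suc p) m"
proof (induction m)
  case (Suc m)
  let ?f = "last_shuffle r" and ?g = "first_shuffle r"
  let ?d = "descending r p (Suc (p + m))" and ?d' = "descending r p (Suc (Suc (p + m)))"
  let ?x = "r (Suc (p + m))"
  have d': "?d' = ?x * ?d" by (simp add: descending_snoc)
  have g_far: "?g p m * ?x = ?x * ?g p m"
    by (rule first_shuffle_intertwine) (rule far, simp)
  have "?f p (Suc (Suc m)) * ?g p (Suc m)
      = ?g p (Suc m) - ?f p (Suc m) * (?x * ?g p (Suc m))"
    by (simp add: left_diff_distrib mult.assoc del: first_shuffle.simps)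
  also have "?x * ?g p (Suc m) = ?g p m * ?x + (-1) ^ Suc m * ?d'"
    unfolding first_shuffle_peel d' using g_far
    by (cases "even m") (simp_all add: right_diff_distrib distrib_left)
  also have "?f p (Suc m) * (?g p m * ?x + (-1) ^ Suc m * ?d')
      = ?f p (Suc m) * ?g p m * ?x + (-1) ^ Suc m * (?f p (Suc m) * ?d')"
    by (cases "even m") (simp_all add: distrib_left mult.assoc right_diff_distrib del: first_shuffle.simps last_shuffle.simps)
  also have "?f p (Suc m) * ?g p m = ?g p (Suc m) * ?f (Suc p) m" by (rule Suc)
  also have "?f p (Suc m) * ?d' = ?d' * ?f (Suc p) (Suc m)"
    using last_shuffle_descending[of p "Suc m"] by simp
  also have "?g p (Suc m) - (?g p (Suc m) * ?f (Suc p) m * ?x + (-1) ^ Suc m * (?d' * ?f (Suc p) (Suc m)))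
      = (?g p (Suc m) + (-1) ^ Suc (Suc m) * ?d') * ?f (Suc p) (Suc m)"
    by (simp add: algebra_simps del: first_shuffle.simps)
  also have "?g p (Suc m) + (-1) ^ Suc (Suc m) * ?d' = ?g p (Suc (Suc m))"
    using first_shuffle_peel[of r p "Suc m"] by simp
  finally show ?case .
qed simp

lemma far_antisymmetrizer:
  assumes "p + m < k \<or> Suc k < p"
  shows "antisymmetrizer r p m * r k = r k * antisymmetrizer r p m"
proof (rule antisymmetrizer_intertwine)
  fix i assume "i < m"
  with assms show "r (p + i) * r k = r k * r (p + i)"
    using far[of "p + i" k] far[of k "p + i"] by fastforce
qed

text \<open>The mirror image of the defining recursion. The new generator commutes with the
  antisymmetrizer two steps back, so the induction hypothesis can be used on one side of it and the
  definition on the other.\<close>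

lemma antisymmetrizer_last_unshuffle:
  "antisymmetrizer r p (Suc m) = antisymmetrizer r p m * last_unshuffle r p (Suc m)"
proof (induction m)
  case (Suc m)
  let ?A = "antisymmetrizer r p" and ?f = "last_shuffle r p" and ?u = "last_unshuffle r p"
  let ?x = "r (p + Suc m)"
  have x: "?A m * ?x = ?x * ?A m" by (rule far_antisymmetrizer) simp
  have "?A (Suc (Suc m)) = ?A (Suc m) - ?f (Suc m) * ?x * ?A (Suc m)"
    by (simp add: left_diff_distrib)
  also have "?f (Suc m) * ?x * ?A (Suc m) = ?f (Suc m) * (?x * ?A m) * ?u (Suc m)"
    unfolding Suc by (simp add: mult.assoc)
  also have "\<dots> = ?A (Suc m) * ?x * ?u (Suc m)"
    unfolding x[symmetric] by (simp only: mult.assoc antisymmetrizer.simps)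
  finally show ?case by (simp add: right_diff_distrib mult.assoc)
qed simp

lemma antisymmetrizer_first_shuffle:
  "antisymmetrizer r p (Suc m) = first_shuffle r p (Suc m) * antisymmetrizer r (Suc p) m"
proof (induction m)
  case (Suc m)
  have "antisymmetrizer r p (Suc (Suc m))
      = last_shuffle r p (Suc (Suc m)) * (first_shuffle r p (Suc m) * antisymmetrizer r (Suc p) m)"
    by (simp only: antisymmetrizer.simps(2)[of r p "Suc m"] Suc)
  also have "\<dots> = first_shuffle r p (Suc (Suc m)) * last_shuffle r (Suc p) (Suc m)
      * antisymmetrizer r (Suc p) m"
    by (simp only: last_first_shuffle flip: mult.assoc)
  finally show ?case by (simp only: mult.assoc antisymmetrizer.simps)
qed simp

lemma antisymmetrizer_first_unshuffle:
  "antisymmetrizer r p (Suc m) = antisymmetrizer r (Suc p) m * first_unshuffle r p (Suc m)"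
proof (induction m arbitrary: p)
  case (Suc m)
  let ?A = "antisymmetrizer r" and ?g = "first_shuffle r (Suc p) (Suc m)"
    and ?u = "first_unshuffle r (Suc p) (Suc m)"
  have x: "?A (Suc (Suc p)) m * r p = r p * ?A (Suc (Suc p)) m" by (rule far_antisymmetrizer) simp
  have "?A p (Suc (Suc m)) = first_shuffle r p (Suc (Suc m)) * ?A (Suc p) (Suc m)"
    by (rule antisymmetrizer_first_shuffle)
  also have "\<dots> = ?A (Suc p) (Suc m) - ?g * r p * ?A (Suc p) (Suc m)"
    by (simp only: first_shuffle.simps(2)[of r p] left_diff_distrib mult_1_left)
  also have "?g * r p * ?A (Suc p) (Suc m) = ?g * (r p * ?A (Suc (Suc p)) m) * ?u"
    unfolding Suc by (simp only: mult.assoc)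
  also have "\<dots> = ?A (Suc p) (Suc m) * r p * ?u"
    unfolding x[symmetric] antisymmetrizer_first_shuffle[of "Suc p" m] by (simp only: mult.assoc)
  finally show ?case
    by (simp only: right_diff_distrib mult.assoc first_unshuffle.simps(2)[of r p "Suc m"] mult_1_right)
qed simp

text \<open>The definition hands down the right factors of the shorter antisymmetrizer, which are
  all but the last. The last one is reached by \<open>antisymmetrizer_first_shuffle\<close>, through
  the letters from \<open>Suc p\<close> on.\<close>

lemma antisymmetrizer_right_factor:
  assumes "i < m"
  obtains b where "antisymmetrizer r p m = b * (1 - r (p + i))"
proof -
  have "\<exists>b. antisymmetrizer r p m = b * (1 - r (p + i))"
    using assms
  proof (induction m arbitrary: p i)
    case (Suc m)
    show ?case
    proof (cases "m = 0")
      case True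
      then show ?thesis using Suc by (intro exI[of _ 1]) simp
    next
      case False
      show ?thesis
      proof (cases "i < m")
        case True
        with Suc.IH[of i p] obtain b where "antisymmetrizer r p m = b * (1 - r (p + i))" by auto
        then show ?thesis
          by (intro exI[of _ "last_shuffle r p (Suc m) * b"]) (simp only: antisymmetrizer.simps mult.assoc)
      next
        case i: False
        with Suc.prems False have i': "i = Suc (i - 1)" "i - 1 < m" by auto
        with Suc.IH[of "i - 1" "Suc p"] obtain b
          where "antisymmetrizer r (Suc p) m = b * (1 - r (Suc p + (i - 1)))" by auto
        moreover have "Suc p + (i - 1) = p + i" using i' by simp
        ultimately show ?thesis
          by (intro exI[of _ "first_shuffle r p (Suc m) * b"])
            (simp only: antisymmetrizer_first_shuffle mult.assoc)
      qed
    qed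
  qed simp
  then show thesis using that by blast
qed

text \<open>A decomposition by cosets of the permutations of the last m + 1 letters. Their
  antisymmetrizer comes out on the left, where it will meet \<open>X r\<close>.\<close>

lemma antisymmetrizer_unshuffles:
  "antisymmetrizer r p (d + m) = antisymmetrizer r (p + d) m * unshuffles r p d m"
proof (induction d arbitrary: p)
  case (Suc d)
  have "antisymmetrizer r p (Suc d + m)
      = antisymmetrizer r (Suc p) (d + m) * first_unshuffle r p (Suc (d + m))"
    by (simp only: add_Suc antisymmetrizer_first_unshuffle)
  then show ?case unfolding Suc by (simp add: mult.assoc del: first_unshuffle.simps)
qed simp

end

text \<open>
  The signed sum over the ways to move \<open>k\<close> of the letters \<open>p, \<dots>, p + m\<close> to the end, in
  reversed order.
\<close>

fun to_end :: "(nat \<Rightarrow> 'b::ring_1) \<Rightarrow> nat \<Rightarrow> nat \<Rightarrow> nat \<Rightarrow> 'b" where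
  "to_end s p m 0 = 1"
| "to_end s p 0 (Suc k) = (if k = 0 then 1 else 0)"
| "to_end s p (Suc m) (Suc k) = to_end s (Suc p) m (Suc k)
     + (-1) ^ Suc m * to_end s (Suc p) m k * ascending s p (Suc (p + m))"

section \<open>Shuffles in the inverse braiding\<close>

lemma to_end_eq_0: "Suc m < k \<Longrightarrow> to_end s p m k = 0"
proof (induction m arbitrary: p k)
  case 0
  then show ?case by (cases k) auto
next
  case (Suc m)
  then show ?case by (cases k) auto
qed

text \<open>Inverses are required only for places in a range: on words of length n the operators
  \<open>factor_op n k M\<close> vanish for k outside 1, ..., n - 1, while the braid relations
  persist there because both sides are 0.\<close>

locale invertible_braid = braid r for r :: "nat \<Rightarrow> 'b::ring_1" +
  fixes s :: "nat \<Rightarrow> 'b" and lo hi :: nat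
  assumes right_inverse: "lo \<le> k \<Longrightarrow> k < hi \<Longrightarrow> r k * s k = 1"
    and left_inverse: "lo \<le> k \<Longrightarrow> k < hi \<Longrightarrow> s k * r k = 1"
begin

lemma ascending_descending_inverse:
  assumes "lo \<le> i" "j \<le> hi"
  shows "ascending s i j * descending r i j = 1"
    and "descending r i j * ascending s i j = 1"
    and "descending s i j * ascending r i j = 1"
proof -
  have *: "ascending s i j * descending r i j = 1 \<and> descending r i j * ascending s i j = 1
      \<and> descending s i j * ascending r i j = 1" if "i \<le> j"
    using that assms(2)
  proof (induction j rule: dec_induct)
    case (step j)
    let ?a = "ascending s i j" and ?d = "descending r i j"
      and ?d' = "descending s i j" and ?a' = "ascending r i j"
    have "?a * s j * (r j * ?d) = ?a * (s j * r j) * ?d" by (simp only: mult.assoc)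
    moreover have "(r j * ?d) * (?a * s j) = r j * (?d * ?a) * s j" by (simp only: mult.assoc)
    moreover have "s j * ?d' * (?a' * r j) = s j * (?d' * ?a') * r j" by (simp only: mult.assoc)
    ultimately show ?case
      using step assms by (simp add: ascending_snoc descending_snoc left_inverse right_inverse)
  qed simp
  show "ascending s i j * descending r i j = 1" "descending r i j * ascending s i j = 1"
    "descending s i j * ascending r i j = 1"
    using * by (cases "i \<le> j"; simp)+
qed

lemma inverse_ascending_shift:
  assumes "lo \<le> i" "i \<le> k" "Suc k < j" "j \<le> hi"
  shows "ascending s i j * s k = s (Suc k) * ascending s i j"
proof -
  let ?S = "ascending s i j" and ?D = "descending r i j"
  note inv = ascending_descending_inverse[OF assms(1,4)]
  have D: "r k * ?D = ?D * r (Suc k)" using assms by (intro descending_shift)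
  have sk: "r k * s k = 1" "s (Suc k) * r (Suc k) = 1"
    using assms by (simp_all add: right_inverse left_inverse)
  have "?S * s k = (s (Suc k) * r (Suc k)) * ?S * s k" by (simp add: sk)
  also have "\<dots> = s (Suc k) * (?S * ?D) * r (Suc k) * ?S * s k" by (simp add: inv mult.assoc)
  also have "\<dots> = s (Suc k) * ?S * (?D * r (Suc k)) * ?S * s k" by (simp only: mult.assoc)
  also have "\<dots> = s (Suc k) * ?S * r k * (?D * ?S) * s k" by (simp only: mult.assoc flip: D)
  also have "\<dots> = s (Suc k) * ?S * (r k * s k)" by (simp add: inv mult.assoc)
  finally show ?thesis by (simp add: sk)
qed

lemma inverse_ascending_r_shift:
  assumes "lo \<le> i" "i \<le> k" "Suc k < j" "j \<le> hi"
  shows "r (Suc k) * ascending s i j = ascending s i j * r k"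
proof -
  let ?S = "ascending s i j" and ?D = "descending r i j"
  note inv = ascending_descending_inverse[OF assms(1,4)]
  have D: "r k * ?D = ?D * r (Suc k)" using assms by (intro descending_shift)
  have "r (Suc k) * ?S = ?S * (?D * r (Suc k)) * ?S" by (simp add: inv flip: mult.assoc)
  also have "\<dots> = ?S * r k * (?D * ?S)" by (simp only: mult.assoc flip: D)
  finally show ?thesis by (simp add: inv)
qed

text \<open>Carrying the last letter to the first place by r undoes the crossings in s of each
  summand: a letter that was moved to the end goes to the front instead, past the letters before it
  only. The number of crossings j becomes m - j, whence the sign.\<close>

lemma shuffle_to_first_shuffle:
  assumes "lo \<le> p" "p + m \<le> hi"
  shows "last_shuffle s p m * descending r p (p + m) = (-1) ^ m * first_shuffle r p m"
  using assms(2)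
proof (induction m)
  case (Suc m)
  let ?d = "descending r p (p + m)"
  have "last_shuffle s p (Suc m) * descending r p (p + Suc m)
      = r (p + m) * ?d - last_shuffle s p m * (s (p + m) * r (p + m)) * ?d"
    by (simp add: descending_snoc left_diff_distrib mult.assoc)
  also have "\<dots> = descending r p (Suc (p + m)) - (-1) ^ m * first_shuffle r p m"
    using Suc assms by (simp add: left_inverse descending_snoc)
  also have "\<dots> = (-1) ^ Suc m * first_shuffle r p (Suc m)"
    unfolding first_shuffle_peel by (cases "even m") simp_all
  finally show ?case .
qed simp

text \<open>The summands are split by whether the letter p is taken to the end. If so, it is first
  sent to the very end, and \<open>last_unshuffle\<close> in r brings it back to the place it has
  when taken at a later step: the crossings in s that it then does not make are undone by r. For k =
  Suc m every letter is taken, so the first part is 0.\<close>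

lemma iterated_shuffle_peel:
  assumes "lo \<le> p" "p + m < hi" "k \<le> Suc m"
  shows "iterated_shuffle s p (Suc m) (Suc k)
    = (if k \<le> m then iterated_shuffle s (Suc p) m (Suc k) else 0)
      + (-1) ^ Suc m * iterated_shuffle s (Suc p) m k * ascending s p (Suc (p + m))
        * last_unshuffle r (p + Suc m - k) k"
  using assms(2,3)
proof (induction k arbitrary: m)
  case 0
  then show ?case using last_shuffle_peel[of s p m] by simp
next
  case (Suc k)
  let ?I = "iterated_shuffle s" and ?T = "ascending s p"
  let ?O = "?I p m (Suc k)" and ?U = "last_unshuffle r (p + m - k) k"
  let ?T0 = "?T (p + m)" and ?T1 = "?T (Suc (p + m))"
  \<comment> \<open>After one other letter has been taken, the letter p stops one place earlier; the
    surplus crossing is cancelled by r.\<close>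
  have T0: "?T0 = ?T1 * r (p + m)"
    using Suc.prems assms(1) by (simp add: ascending_snoc mult.assoc left_inverse)
  have shift: "?T1 * ?O = ?I (Suc p) m (Suc k) * ?T1"
    by (rule iterated_shuffle_intertwine[symmetric])
      (use Suc.prems assms(1) in \<open>auto intro!: inverse_ascending_shift[symmetric]\<close>)
  have main: "last_shuffle s (Suc p) m * ?O = (if Suc k \<le> m then ?I (Suc p) m (Suc (Suc k)) else 0)
      - (-1) ^ Suc m * ?I (Suc p) m (Suc k) * ?T0 * ?U"
  proof (cases m)
    case 0
    then show ?thesis using Suc.prems by simp
  next
    case (Suc m')
    have "?O = (if k \<le> m' then ?I (Suc p) m' (Suc k) else 0)
        + (-1) ^ m * ?I (Suc p) m' k * ?T0 * ?U"
      using Suc.IH[of m'] Suc.prems Suc by simp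
    moreover have "?I (Suc p) m (Suc j) = last_shuffle s (Suc p) m * ?I (Suc p) m' j" for j
      using Suc by simp
    ultimately show ?thesis using Suc
      by (cases "even m'")
        (simp_all add: distrib_left right_diff_distrib mult.assoc
          del: iterated_shuffle.simps last_shuffle.simps)
  qed
  have "?I p (Suc m) (Suc (Suc k)) = last_shuffle s p (Suc m) * ?O" by simp
  also have "\<dots> = last_shuffle s (Suc p) m * ?O + (-1) ^ Suc m * (?T1 * ?O)"
    unfolding last_shuffle_peel by (simp only: distrib_right mult.assoc)
  also have "\<dots> = (if Suc k \<le> m then ?I (Suc p) m (Suc (Suc k)) else 0)
      + (-1) ^ Suc m * ?I (Suc p) m (Suc k) * ?T1 * (1 - r (p + m) * ?U)"
    unfolding main shift T0 by (simp add: right_diff_distrib mult.assoc del: iterated_shuffle.simps)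
  also have "1 - r (p + m) * ?U = last_unshuffle r (p + Suc m - Suc k) (Suc k)"
    using Suc.prems by simp
  finally show ?case .
qed

text \<open>Every moved letter contributes a \<open>last_unshuffle\<close> in r on the moved
  letters, and these multiply up to their antisymmetrizer. \<open>to_end\<close> retains a single
  order of arrival.\<close>

lemma iterated_shuffle_to_end:
  assumes "lo \<le> p" "p + m \<le> hi" "k \<le> m"
  shows "iterated_shuffle s p m (Suc k) = to_end s p m (Suc k) * antisymmetrizer r (p + m - k) k"
  using assms
proof (induction m arbitrary: p k)
  case 0
  then show ?case by simp
next
  case (Suc m)
  let ?I = "iterated_shuffle s" and ?T = "ascending s p (Suc (p + m))"
  let ?A = "antisymmetrizer r" and ?e = "p + Suc m - k"
  have 1: "(if k \<le> m then ?I (Suc p) m (Suc k) else 0) = to_end s (Suc p) m (Suc k) * ?A ?e k"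
    using Suc.IH[of "Suc p" k] Suc.prems by (auto simp: to_end_eq_0)
  have 2: "?I (Suc p) m k * ?T * last_unshuffle r ?e k = to_end s (Suc p) m k * ?T * ?A ?e k"
  proof (cases k)
    case (Suc k')
    have "?I (Suc p) m (Suc k') = to_end s (Suc p) m (Suc k') * ?A (Suc p + m - k') k'"
      using Suc.IH[of "Suc p" k'] Suc.prems Suc by simp
    \<comment> \<open>The antisymmetrizer of the letters moved so far passes
      \<open>ascending s\<close>, which shifts it by one place, and can then absorb the new
      unshuffle.\<close>
    moreover have "?A (Suc p + m - k') k' * ?T = ?T * ?A ?e k'"
    proof (rule antisymmetrizer_intertwine)
      fix i assume i: "i < k'"
      have "r (Suc (?e + i)) * ?T = ?T * r (?e + i)"
        using Suc.prems Suc i by (intro inverse_ascending_r_shift) auto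
      then show "r (Suc p + m - k' + i) * ?T = ?T * r (?e + i)"
        using Suc.prems Suc i by (simp add: Suc_diff_le)
    qed
    ultimately show ?thesis
      unfolding Suc antisymmetrizer_last_unshuffle by (simp only: mult.assoc)
  qed simp
  have "?I p (Suc m) (Suc k) = to_end s (Suc p) m (Suc k) * ?A ?e k
      + (-1) ^ Suc m * (to_end s (Suc p) m k * ?T * ?A ?e k)"
    using iterated_shuffle_peel[of p m k] Suc.prems 1 2 by (simp add: mult.assoc)
  then show ?case by (simp add: distrib_right left_diff_distrib mult.assoc)
qed

text \<open>\<open>to_end\<close> recurs on the first letter; this is its recursion on the last one.
  If the last letter stays, it is crossed by all k + 1 moved letters; if it is moved itself, only by
  the k others, as the order is reversed and it becomes the first of the moved letters.\<close>

lemma to_end_right: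
  assumes "lo \<le> p" "p + m < hi" "k \<le> Suc m"
  defines "e \<equiv> Suc (p + m)"
  shows "to_end s p (Suc m) (Suc k)
    = (-1) ^ Suc k * to_end s p m (Suc k) * descending s (e - Suc k) e
      + (-1) ^ k * to_end s p m k * descending s (e - k) e"
  using assms(1-3) unfolding e_def
proof (induction m arbitrary: p k)
  case 0
  then consider "k = 0" | "k = Suc 0" by linarith
  then show ?case
    by cases (simp_all add: ascending_def descending_def)
next
  case (Suc m)
  let ?e = "Suc (Suc (p + m))" and ?T = "ascending s p"
  let ?N = "to_end s (Suc p) m" and ?D = "\<lambda>k. descending s (?e - k) ?e"
  \<comment> \<open>The moves of the letter p and of the last letter are interchanged: if p goes
    first, to the place just before the last letter, the last letter has one letter more to
    cross.\<close>
  have sh: "?D k * ?T ?e = ?T (?e - 1) * ?D (Suc k)" if "k \<le> Suc m" for k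
    using that
  proof (induction k)
    case 0
    then show ?case by (simp add: ascending_snoc descending_def)
  next
    case (Suc k)
    have D: "?D (Suc j) = ?D j * s (?e - Suc j)" if "j < Suc (Suc m)" for j
    proof -
      have "Suc (?e - Suc j) = ?e - j" using that by simp
      then show ?thesis using descending_Cons[of "?e - Suc j" ?e s] by simp
    qed
    have "?D (Suc k) * ?T ?e = ?D k * (s (?e - Suc k) * ?T ?e)"
      using D[of k] Suc.prems by (simp add: mult.assoc)
    also have "s (?e - Suc k) * ?T ?e = ?T ?e * s (?e - Suc (Suc k))"
    proof -
      have "?T ?e * s (?e - Suc (Suc k)) = s (Suc (?e - Suc (Suc k))) * ?T ?e"
        using Suc.prems \<open>lo \<le> p\<close> \<open>p + Suc m < hi\<close> by (intro inverse_ascending_shift) auto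
      moreover have "Suc (?e - Suc (Suc k)) = ?e - Suc k" using Suc.prems by simp
      ultimately show ?thesis by simp
    qed
    also have "?D k * (?T ?e * s (?e - Suc (Suc k))) = ?T (?e - 1) * (?D (Suc k) * s (?e - Suc (Suc k)))"
      using Suc by (simp flip: mult.assoc)
    also have "?D (Suc k) * s (?e - Suc (Suc k)) = ?D (Suc (Suc k))"
      using D[of "Suc k"] Suc.prems by simp
    finally show ?case .
  qed
  have lo: "lo \<le> Suc p" and hi: "Suc p + m < hi" using Suc.prems by simp_all
  have peel: "(-1) ^ Suc j * to_end s p (Suc m) (Suc j) * ?D (Suc j)
      = (-1) ^ Suc j * ?N (Suc j) * ?D (Suc j)
        + (-1) ^ Suc (Suc m) * ((-1) ^ j * ?N j * ?D j * ?T ?e)" if "j \<le> Suc m" for j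
  proof -
    have "(-1) ^ Suc j * to_end s p (Suc m) (Suc j) * ?D (Suc j)
      = (-1) ^ Suc j * ?N (Suc j) * ?D (Suc j)
        + (-1) ^ Suc j * ((-1) ^ Suc m * ?N j) * (?T (?e - 1) * ?D (Suc j))"
      by (cases "even j"; cases "even m") (simp_all add: algebra_simps)
    also have "?T (?e - 1) * ?D (Suc j) = ?D j * ?T ?e" using sh[OF that] by simp
    finally show ?thesis by (cases "even j"; cases "even m") (simp_all add: mult.assoc)
  qed
  show ?case
  proof (cases k)
    case 0
    have "to_end s p (Suc (Suc m)) (Suc k)
        = to_end s (Suc p) (Suc m) (Suc 0) + (-1) ^ Suc (Suc m) * ?T ?e"
      by (simp add: 0)
    also have "to_end s (Suc p) (Suc m) (Suc 0) = - ?N (Suc 0) * ?D (Suc 0) + 1"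
      using Suc.IH[OF lo hi, of 0] by (simp add: descending_def)
    finally show ?thesis
      using peel[of 0] by (simp add: 0 algebra_simps descending_def del: to_end.simps(3))
  next
    case k: (Suc k')
    have s1: "to_end s (Suc p) (Suc m) (Suc k)
        = (-1) ^ Suc k * ?N (Suc k) * ?D (Suc k) + (-1) ^ k * ?N k * ?D k"
    proof (cases "k \<le> Suc m")
      case True
      then show ?thesis using Suc.IH[OF lo hi True] by simp
    next
      case False
      then show ?thesis by (simp add: to_end_eq_0)
    qed
    have s2: "to_end s (Suc p) (Suc m) k
        = (-1) ^ k * ?N k * ?D k + (-1) ^ k' * ?N k' * ?D k'"
      using Suc.IH[OF lo hi, of k'] Suc.prems k by simp
    have p1: "(-1) ^ Suc k * to_end s p (Suc m) (Suc k) * ?D (Suc k)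
      = (-1) ^ Suc k * ?N (Suc k) * ?D (Suc k)
        + (-1) ^ Suc (Suc m) * ((-1) ^ k * ?N k * ?D k * ?T ?e)"
    proof (cases "k \<le> Suc m")
      case True
      then show ?thesis by (rule peel)
    next
      case False
      then show ?thesis by (simp add: to_end_eq_0)
    qed
    have p2: "(-1) ^ k * to_end s p (Suc m) k * ?D k
      = (-1) ^ k * ?N k * ?D k
        + (-1) ^ Suc (Suc m) * ((-1) ^ k' * ?N k' * ?D k' * ?T ?e)"
      using peel[of k'] Suc.prems k by simp
    have "to_end s p (Suc (Suc m)) (Suc k)
        = to_end s (Suc p) (Suc m) (Suc k) + (-1) ^ Suc (Suc m) * to_end s (Suc p) (Suc m) k * ?T ?e"
      by simp
    then show ?thesis
      unfolding s1 s2
      using p1 p2 by (simp add: distrib_left distrib_right mult.assoc algebra_simps del: to_end.simps(3))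
  qed
qed

end

text \<open>
  In the notation of the paper, \<open>last_twist r e i\<close> is
  \<open>(-1) ^ i * R\<^sub>k \<cdots> R\<^sub>{e-2} R\<^sub>{e-1}\<^sup>2\<close> with \<open>k = e - 1 - i\<close>.
\<close>

definition last_twist :: "(nat \<Rightarrow> 'b::ring_1) \<Rightarrow> nat \<Rightarrow> nat \<Rightarrow> 'b" where
  "last_twist r e i = (-1) ^ i * ascending r (e - 1 - i) e * r (e - 1)"

primrec twist_product :: "(nat \<Rightarrow> 'b::ring_1) \<Rightarrow> nat \<Rightarrow> nat \<Rightarrow> 'b" where
  "twist_product r e 0 = 1"
| "twist_product r e (Suc k) = twist_product r e k * (1 - last_twist r e k)"

section \<open>Telescoping of the bracketed factors\<close>

context invertible_braid
begin

text \<open>By the bound on j + k all generators of the product lie at places beyond j, so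
  \<open>ascending_shift\<close> lowers each of them by one place.\<close>

lemma twist_product_ascending:
  assumes "j + k \<le> e"
  shows "twist_product r (Suc e) k * ascending r j (Suc e)
    = ascending r j (Suc e) * twist_product r e k"
  using assms
proof (induction k)
  case (Suc k)
  let ?a = "ascending r j (Suc e)"
  have "last_twist r (Suc e) k * ?a = ?a * last_twist r e k"
  proof -
    have "ascending r (e - k) l * ascending r j (Suc e) = ascending r j (Suc e) * ascending r (e - 1 - k) (l - 1)"
      if "e - k \<le> l" "l \<le> e" for l
      using that
    proof (induction l rule: dec_induct)
      case (step l)
      have 1: "ascending r j (Suc e) * r (l - 1) = r (Suc (l - 1)) * ascending r j (Suc e)"
        using step Suc.prems by (intro ascending_shift) auto
      have 2: "ascending r (e - 1 - k) l = ascending r (e - 1 - k) (l - 1) * r (l - 1)"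
        using ascending_snoc[of "e - 1 - k" "l - 1" r] step Suc.prems by simp
      have "ascending r (e - k) (Suc l) * ?a = ascending r (e - k) l * (r l * ?a)"
        using step by (simp add: ascending_snoc mult.assoc)
      also have "r l * ?a = ?a * r (l - 1)" using 1 step Suc.prems by simp
      also have "ascending r (e - k) l * (?a * r (l - 1)) = ?a * ascending r (e - 1 - k) l"
        using step 2 by (simp flip: mult.assoc)
      finally show ?case by simp
    qed simp
    from this[of e] have 1: "ascending r (e - k) e * ?a = ?a * ascending r (e - 1 - k) (e - 1)"
      by simp
    have 2: "r e * ?a = ?a * r (e - 1)"
      using ascending_shift[of j "e - 1" "Suc e"] Suc.prems by simp
    have "last_twist r (Suc e) k * ?a
        = (-1) ^ k * (ascending r (e - k) e * (r e * (r e * ?a)))"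
      by (simp add: last_twist_def ascending_snoc mult.assoc)
    also have "r e * (r e * ?a) = ?a * r (e - 1) * r (e - 1)"
      by (simp only: 2 mult.assoc[symmetric])
    also have "ascending r (e - k) e * (?a * r (e - 1) * r (e - 1))
        = ?a * (ascending r (e - 1 - k) (e - 1) * r (e - 1)) * r (e - 1)"
      by (simp only: 1 mult.assoc[symmetric])
    also have "ascending r (e - 1 - k) (e - 1) * r (e - 1) = ascending r (e - 1 - k) e"
      using ascending_snoc[of "e - 1 - k" "e - 1" r] Suc.prems by simp
    finally show ?thesis
      by (cases "even k") (simp_all add: last_twist_def mult.assoc)
  qed
  moreover have "twist_product r (Suc e) k * ?a = ?a * twist_product r e k" using Suc by simp
  ultimately show ?case
    by (simp add: right_diff_distrib left_diff_distrib mult.assoc) (simp flip: mult.assoc)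
qed simp

text \<open>By \<open>to_end_right\<close> each coefficient is a sum of two consecutive values of
  \<open>N'\<close> below. Abel summation turns this into differences of consecutive twist products,
  that is into \<open>twist_product\<close> times \<open>last_twist\<close>, and what is left is the
  recursion of \<open>last_shuffle\<close>.\<close>

lemma sum_to_end_twist_product:
  assumes "lo \<le> p" "p + m \<le> hi"
  shows "(\<Sum>k\<le>m. (-1) ^ k * to_end s p m (Suc k) * twist_product r (p + m) k) = last_shuffle r p m"
  using assms
proof (induction m)
  case (Suc m)
  let ?e = "Suc (p + m)" and ?N = "to_end s p m" and ?F = "twist_product r"
  define N' where "N' k = (-1) ^ k * ?N k * descending s (?e - k) ?e" for k
  have N'0: "N' 0 = 1" by (simp add: N'_def descending_def)
  \<comment> \<open>The boundary term of the Abel summation vanishes, since only m + 1 letters are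
    there to be moved.\<close>
  have N'_end: "N' (Suc (Suc m)) = 0" by (simp add: N'_def to_end_eq_0)
  \<comment> \<open>The \<open>ascending\<close> part of \<open>last_twist\<close> passes through
    the twist product, changing its end from \<open>?e\<close> to \<open>p + m\<close>, and cancels
    \<open>descending s\<close>. The second final generator of \<open>last_twist\<close>
    remains.\<close>
  have step: "N' (Suc k) * (?F ?e k * last_twist r ?e k) = - (?N (Suc k) * ?F (p + m) k * r (p + m))"
    if "k \<le> m" for k
  proof -
    let ?j = "p + m - k"
    have inv: "descending s ?j ?e * ascending r ?j ?e = 1"
      using that Suc.prems by (intro ascending_descending_inverse) auto
    have F: "?F ?e k * ascending r ?j ?e = ascending r ?j ?e * ?F (p + m) k"
      using that by (intro twist_product_ascending) simp
    have tw: "last_twist r ?e k = (-1) ^ k * ascending r ?j ?e * r (p + m)"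
      by (simp add: last_twist_def)
    have "N' (Suc k) * (?F ?e k * last_twist r ?e k)
        = - (?N (Suc k) * (descending s ?j ?e * (?F ?e k * ascending r ?j ?e)) * r (p + m))"
      unfolding N'_def tw by (cases "even k") (simp_all add: mult.assoc)
    also have "descending s ?j ?e * (?F ?e k * ascending r ?j ?e) = ?F (p + m) k"
      unfolding F by (simp add: inv flip: mult.assoc)
    finally show ?thesis .
  qed
  have "(\<Sum>k\<le>Suc m. (-1) ^ k * to_end s p (Suc m) (Suc k) * ?F (p + Suc m) k)
      = (\<Sum>k\<le>Suc m. (-1) ^ k * (N' (Suc k) + N' k) * ?F ?e k)"
    using Suc.prems by (intro sum.cong) (simp_all add: to_end_right N'_def del: to_end.simps)
  also have "\<dots> = 1 + (\<Sum>k\<le>m. (-1) ^ k * (N' (Suc k) * (?F ?e k * last_twist r ?e k)))"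
  proof -
    have "(\<Sum>k\<le>l. (-1) ^ k * (N' (Suc k) + N' k) * ?F ?e k)
      = 1 + (\<Sum>k<l. (-1) ^ k * (N' (Suc k) * (?F ?e k * last_twist r ?e k)))
        + (-1) ^ l * N' (Suc l) * ?F ?e l" for l
      by (induction l) (simp_all add: N'0 algebra_simps)
    from this[of "Suc m"] show ?thesis by (simp add: N'_end lessThan_Suc_atMost)
  qed
  also have "\<dots> = 1 - (\<Sum>k\<le>m. (-1) ^ k * ?N (Suc k) * ?F (p + m) k) * r (p + m)"
    by (simp add: step sum_distrib_right mult.assoc sum_negf)
  finally show ?case using Suc by simp
qed simp

end

section \<open>Operators on families of words\<close>

abbreviation (input) mon :: "'w \<Rightarrow> 'u \<Rightarrow> ('w \<Rightarrow>\<^sub>0 'u::zero)" where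
  "mon \<equiv> Poly_Mapping.single"

lemma lin_ext_superset:
  assumes "finite F" "Poly_Mapping.keys p \<subseteq> F" "\<And>w. f w 0 = 0"
  shows "lin_ext f p = (\<Sum>w\<in>F. f w (Poly_Mapping.lookup p w))"
  unfolding lin_ext_def using assms
  by (intro sum.mono_neutral_left) (auto simp: in_keys_iff)

lemma additive_zero: "(\<And>x y. f (x + y) = f x + f y) \<Longrightarrow> f 0 = 0"
  for f :: "'a::group_add \<Rightarrow> 'b::group_add"
  by (metis add.right_neutral add_left_cancel)

lemma lin_ext_add:
  fixes f :: "'w \<Rightarrow> 'c::ab_group_add \<Rightarrow> 'v::ab_group_add"
  assumes "\<And>w a b. f w (a + b) = f w a + f w b"
  shows "lin_ext f (p + q) = lin_ext f p + lin_ext f q"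
proof -
  have 0: "f w 0 = 0" for w using additive_zero[of "f w"] assms by blast
  let ?F = "Poly_Mapping.keys p \<union> Poly_Mapping.keys q"
  have "lin_ext f (p + q) = (\<Sum>w\<in>?F. f w (Poly_Mapping.lookup (p + q) w))"
    using keys_add[of p q] by (intro lin_ext_superset) (auto simp: 0)
  moreover have "lin_ext f p = (\<Sum>w\<in>?F. f w (Poly_Mapping.lookup p w))"
    "lin_ext f q = (\<Sum>w\<in>?F. f w (Poly_Mapping.lookup q w))"
    by (intro lin_ext_superset; auto simp: 0)+
  ultimately show ?thesis by (simp add: lookup_add assms sum.distrib)
qed

lemma lin_ext_single: "f w 0 = 0 \<Longrightarrow> lin_ext f (mon w a) = f w a"
  by (cases "a = 0") (simp_all add: lin_ext_def)

lemma poly_mapping_sum_single: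
  "p = (\<Sum>w\<in>Poly_Mapping.keys p. mon w (Poly_Mapping.lookup p w))"
  for p :: "'w \<Rightarrow>\<^sub>0 'c::comm_monoid_add"
  by (rule poly_mapping_eqI) (auto simp: lookup_sum lookup_single when_def in_keys_iff sum.delta')

lemma additive_sum:
  fixes f :: "'a::ab_group_add \<Rightarrow> 'b::ab_group_add"
  assumes "\<And>x y. f (x + y) = f x + f y"
  shows "f (sum g A) = (\<Sum>x\<in>A. f (g x))"
  by (induction A rule: infinite_finite_induct) (simp_all add: assms additive_zero[OF assms])

lemma additive_eqI:
  fixes f g :: "('w \<Rightarrow>\<^sub>0 'c::ab_group_add) \<Rightarrow> 'v::ab_group_add"
  assumes "\<And>x y. f (x + y) = f x + f y" "\<And>x y. g (x + y) = g x + g y"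
    and "\<And>w a. f (mon w a) = g (mon w a)"
  shows "f p = g p"
  by (subst (1 2) poly_mapping_sum_single) (simp add: additive_sum[of f] additive_sum[of g] assms)

text \<open>As a type of their own the additive operators are an instance of \<open>ring_1\<close>,
  so the shuffle calculus applies to them directly. Additivity is enough to test equality on
  monomials.\<close>

typedef (overloaded) ('w, 'u) endo =
    "{f :: ('w \<Rightarrow>\<^sub>0 'u::ring_1) \<Rightarrow> ('w \<Rightarrow>\<^sub>0 'u). \<forall>x y. f (x + y) = f x + f y}"
  morphisms app Endo
  by (rule exI[of _ "\<lambda>x. x"]) simp

setup_lifting type_definition_endo

text \<open>
  The operators act from the right: the left factor of a product acts first, as in the products
  of \<^const>\<open>wm_mult\<close>.
\<close>

instantiation endo :: (type, ring_1) ring_1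
begin

lift_definition zero_endo :: "('a, 'b) endo" is "\<lambda>_. 0" by simp
lift_definition one_endo :: "('a, 'b) endo" is "\<lambda>x. x" by simp
lift_definition plus_endo :: "('a, 'b) endo \<Rightarrow> ('a, 'b) endo \<Rightarrow> ('a, 'b) endo"
  is "\<lambda>f g x. f x + g x" by (simp add: algebra_simps)
lift_definition minus_endo :: "('a, 'b) endo \<Rightarrow> ('a, 'b) endo \<Rightarrow> ('a, 'b) endo"
  is "\<lambda>f g x. f x - g x" by (simp add: algebra_simps)
lift_definition uminus_endo :: "('a, 'b) endo \<Rightarrow> ('a, 'b) endo"
  is "\<lambda>f x. - f x" by simp
lift_definition times_endo :: "('a, 'b) endo \<Rightarrow> ('a, 'b) endo \<Rightarrow> ('a, 'b) endo"
  is "\<lambda>f g x. g (f x)" by simp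

instance
proof
  show "(0 :: ('a, 'b) endo) \<noteq> 1"
  proof
    assume "(0 :: ('a, 'b) endo) = 1"
    then have "app (0 :: ('a, 'b) endo) (mon w 1) = app 1 (mon w 1)" for w
      by simp
    then have "mon (w::'a) (1::'b) = 0" for w
      by (simp add: zero_endo.rep_eq one_endo.rep_eq)
    from arg_cong[OF this, of "\<lambda>p. Poly_Mapping.lookup p w" for w] show False
      by (metis lookup_single_eq lookup_zero zero_neq_one)
  qed
qed (transfer; simp add: fun_eq_iff algebra_simps)+

end

lemma app_simps [simp]:
  "app 0 v = 0" "app 1 v = v" "app (x + y) v = app x v + app y v" "app (x - y) v = app x v - app y v"
  "app (- x) v = - app x v" "app (x * y) v = app y (app x v)"
  by (transfer; simp)+

lemma app_add: "app x (v + w) = app x v + app x w"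
  by transfer simp

lemma app_zero [simp]: "app x 0 = 0"
  by (rule additive_zero) (rule app_add)

lemma app_uminus: "app x (- v) = - app x v"
  using app_add[of x v "- v"] by (simp add: eq_neg_iff_add_eq_0 add.commute)

lemma app_minus: "app x (v - w) = app x v - app x w"
  using app_add[of x v "- w"] by (simp add: app_uminus)

lemma app_sum: "app x (sum g A) = (\<Sum>i\<in>A. app x (g i))"
  by (rule additive_sum) (rule app_add)

lemma app_sum_left: "app (sum g A) v = (\<Sum>i\<in>A. app (g i) v)"
  by (induction A rule: infinite_finite_induct) simp_all

lemma app_neg_one_power: "app ((-1) ^ k * x) v = (if even k then app x v else - app x v)"
  by (cases "even k") simp_all

lemma endo_eqI:
  "(\<And>w a. app x (mon w a) = app y (mon w a)) \<Longrightarrow> x = y"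
  by (subst app_inject[symmetric], rule ext, rule additive_eqI) (auto simp: app_add)

definition lin_endo :: "('w \<Rightarrow> 'u \<Rightarrow> ('w \<Rightarrow>\<^sub>0 'u::ring_1)) \<Rightarrow> ('w, 'u) endo" where
  "lin_endo f = Endo (lin_ext f)"

lemma app_lin_endo:
  assumes "\<And>w a b. f w (a + b) = f w a + f w b"
  shows "app (lin_endo f) = lin_ext f"
  unfolding lin_endo_def by (rule Endo_inverse) (simp add: lin_ext_add assms)

lemma app_lin_endo_single:
  assumes "\<And>w a b. f w (a + b) = f w a + f w b"
  shows "app (lin_endo f) (mon w a) = f w a"
  using additive_zero[of "f w"] assms by (simp add: app_lin_endo lin_ext_single)

section \<open>Sums over words\<close>

lemma finite_words [simp]: "finite {J::'b::finite list. length J = n}"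
  using finite_lists_length_eq[of "UNIV :: 'b set" n] by simp

lemma sum_words_Suc:
  "(\<Sum>J | length J = Suc n. F J) = (\<Sum>x\<in>UNIV. \<Sum>J | length J = n. F (x # J :: 'b::finite list))"
proof -
  have "bij_betw (\<lambda>(x, J). x # J) (UNIV \<times> {J. length J = n}) {J::'b list. length J = Suc n}"
    by (rule bij_betwI[of _ _ _ "\<lambda>J. (hd J, tl J)"]) (auto simp: length_Suc_conv)
  from sum.reindex_bij_betw[OF this, of F, symmetric] show ?thesis
    by (simp add: sum.cartesian_product case_prod_beta)
qed

lemma sum_words_snoc:
  "(\<Sum>J | length J = Suc n. F J) = (\<Sum>J | length J = n. \<Sum>x\<in>UNIV. F (J @ [x] :: 'b::finite list))"
proof -
  have "bij_betw (\<lambda>(J, x). J @ [x]) ({J. length J = n} \<times> UNIV) {J::'b list. length J = Suc n}"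
    by (rule bij_betwI[of _ _ _ "\<lambda>J. (butlast J, last J)"]) (auto simp: length_Suc_conv_rev)
  from sum.reindex_bij_betw[OF this, of F, symmetric] show ?thesis
    by (simp add: sum.cartesian_product case_prod_beta)
qed

lemma sum_words_append:
  "(\<Sum>J | length J = m + n. F J)
    = (\<Sum>J | length J = m. \<Sum>K | length K = n. F (J @ K :: 'b::finite list))"
  by (induction m arbitrary: F) (simp_all add: sum_words_Suc cong: sum.cong)

lemma on_factors_middle:
  assumes "k = Suc (length P)" "length P' = length P" "length S' = length S"
  shows "on_factors k M (P @ [x, y] @ S) (P' @ [A, B] @ S')
    = (if P' = P \<and> S' = S then M $ (x, y) $ (A, B) else 0)"
proof -
  have "drop (k + 1) (P' @ [A, B] @ S') = S'" "drop (k + 1) (P @ [x, y] @ S) = S"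
    "take (k - 1) (P' @ [A, B] @ S') = P'" "take (k - 1) (P @ [x, y] @ S) = P"
    "(P' @ [A, B] @ S') ! (k - 1) = A" "(P' @ [A, B] @ S') ! k = B"
    "(P @ [x, y] @ S) ! (k - 1) = x" "(P @ [x, y] @ S) ! k = y"
    using assms by (simp_all add: nth_append)
  then show ?thesis unfolding on_factors_def using assms by (simp only:) simp
qed

lemma on_factors_out: "\<not> (1 \<le> k \<and> k < length I) \<Longrightarrow> on_factors k M I J = 0"
  unfolding on_factors_def by (rule if_not_P) blast

lemma word_split2:
  assumes "1 \<le> k" "k < length I"
  obtains P x y S where "I = P @ [x, y] @ S" "k = Suc (length P)"
proof
  show "I = take (k - 1) I @ [I ! (k - 1), I ! k] @ drop (Suc k) I"
    using id_take_nth_drop[of "k - 1" I] Cons_nth_drop_Suc[of k I] assms by simp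
  show "k = Suc (length (take (k - 1) I))" using assms by simp
qed

lemma sum_on_factors:
  fixes F :: "'b::finite list \<Rightarrow> 'a::zero \<Rightarrow> 'v::comm_monoid_add"
  assumes k: "k = Suc (length P)" and n: "n = length P + 2 + length S" and F0: "\<And>J. F J 0 = 0"
  shows "(\<Sum>J | length J = n. F J (on_factors k M (P @ [x, y] @ S) J))
    = (\<Sum>A\<in>UNIV. \<Sum>B\<in>UNIV. F (P @ [A, B] @ S) (M $ (x, y) $ (A, B)))"
proof -
  have "(\<Sum>J | length J = n. F J (on_factors k M (P @ [x, y] @ S) J))
    = (\<Sum>P' | length P' = length P. \<Sum>A\<in>UNIV. \<Sum>B\<in>UNIV. \<Sum>S' | length S' = length S.
        F (P' @ [A, B] @ S') (on_factors k M (P @ [x, y] @ S) (P' @ [A, B] @ S')))"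
  proof -
    have "n = length P + (Suc (Suc (length S)))" using n by simp
    then show ?thesis by (simp only: sum_words_append sum_words_Suc append_Cons append_Nil)
  qed
  also have "\<dots> = (\<Sum>P' | length P' = length P. \<Sum>A\<in>UNIV. \<Sum>B\<in>UNIV. \<Sum>S' | length S' = length S.
        if S' = S then if P' = P then F (P' @ [A, B] @ S') (M $ (x, y) $ (A, B)) else 0 else 0)"
    by (intro sum.cong refl) (subst on_factors_middle[OF k], auto simp: F0)
  also have "\<dots> = (\<Sum>P' | length P' = length P. if P' = P then
      \<Sum>A\<in>UNIV. \<Sum>B\<in>UNIV. F (P' @ [A, B] @ S) (M $ (x, y) $ (A, B)) else 0)"
    by (intro sum.cong refl) (auto simp: sum.delta)
  also have "\<dots> = (\<Sum>A\<in>UNIV. \<Sum>B\<in>UNIV. F (P @ [A, B] @ S) (M $ (x, y) $ (A, B)))"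
    by (simp add: sum.delta)
  finally show ?thesis .
qed

lemma sum_UNIV_pair: "(\<Sum>p\<in>UNIV. F p) = (\<Sum>A\<in>UNIV. \<Sum>B\<in>UNIV. F (A, B))"
  by (simp add: sum.cartesian_product)

context algebra_over_field
begin

text \<open>The identity on words of other lengths lets the relations between inverse operators hold
  in the whole ring, not merely on words of length n. On the latter a place out of range gives 0, as
  in \<open>on_factors\<close>.\<close>

definition factor_op :: "nat \<Rightarrow> nat \<Rightarrow> 'a^('c \<times> 'c)^('c \<times> 'c) \<Rightarrow> ('c::finite list, 'u) endo" where
  "factor_op n k M = lin_endo (\<lambda>I a. if length I = n
     then \<Sum>J | length J = n. mon J (smul (on_factors k M I J) a)
     else mon I a)"

lemma app_factor_op:
  "app (factor_op n k M) (mon I a) = (if length I = n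
     then \<Sum>J | length J = n. mon J (smul (on_factors k M I J) a)
     else mon I a)"
  unfolding factor_op_def
  by (subst app_lin_endo_single) (auto simp: single_add scale_right_distrib sum.distrib)

lemma app_factor_op_local:
  assumes "k = Suc (length P)" "n = length P + 2 + length S"
  shows "app (factor_op n k M) (mon (P @ [x, y] @ S) a)
    = (\<Sum>A\<in>UNIV. \<Sum>B\<in>UNIV. mon (P @ [A, B] @ S) (smul (M $ (x, y) $ (A, B)) a))"
  unfolding app_factor_op using assms(2)
  by (subst sum_on_factors[OF assms]) simp_all

lemma app_factor_op_out:
  assumes "\<not> (1 \<le> k \<and> k < n)" "length I = n"
  shows "app (factor_op n k M) (mon I a) = 0"
  using assms by (simp add: app_factor_op on_factors_out)

lemma factor_op_cases:
  assumes "\<And>I a. length I \<noteq> n \<Longrightarrow> app x (mon I a) = app y (mon I a)"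
    and "\<And>I a. length I = n \<Longrightarrow> \<not> (1 \<le> k \<and> k < n) \<Longrightarrow> app x (mon I a) = app y (mon I a)"
    and "\<And>P A B S a. k = Suc (length P) \<Longrightarrow> n = length P + 2 + length S \<Longrightarrow>
      app x (mon (P @ [A, B] @ S) a) = app y (mon (P @ [A, B] @ S) a)"
  shows "x = y"
proof (rule endo_eqI)
  fix I a
  show "app x (mon I a) = app y (mon I a)"
  proof (cases "length I = n \<and> 1 \<le> k \<and> k < n")
    case True
    then obtain P A B S where "I = P @ [A, B] @ S" "k = Suc (length P)"
      using word_split2[of k I] by blast
    then show ?thesis using assms(3)[of P S A B a] True by simp
  qed (use assms(1,2) in blast)
qed

lemma factor_op_mult:
  fixes M M' :: "'a^('c \<times> 'c)^('c::finite \<times> 'c)"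
  assumes "1 \<le> k" "k < n"
  shows "factor_op n k M * factor_op n k M' = factor_op n k (M ** M')"
proof (rule factor_op_cases[of n _ _ k])
  fix P S :: "'c list" and x y :: 'c and a :: 'u
  assume *: "k = Suc (length P)" "n = length P + 2 + length S"
  have "(\<Sum>A\<in>UNIV. \<Sum>B\<in>UNIV. \<Sum>D\<in>UNIV. \<Sum>E\<in>UNIV.
        mon (P @ [D, E] @ S) (smul (M $ (x, y) $ (A, B) * M' $ (A, B) $ (D, E)) a))
    = (\<Sum>p\<in>UNIV. \<Sum>D\<in>UNIV. \<Sum>E\<in>UNIV.
        mon (P @ [D, E] @ S) (smul (M $ (x, y) $ p * M' $ p $ (D, E)) a))"
    by (simp only: sum_UNIV_pair)
  also have "\<dots> = (\<Sum>D\<in>UNIV. \<Sum>E\<in>UNIV. \<Sum>p\<in>UNIV.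
        mon (P @ [D, E] @ S) (smul (M $ (x, y) $ p * M' $ p $ (D, E)) a))"
    by (subst sum.swap, intro sum.cong refl, rule sum.swap)
  also have "\<dots> = (\<Sum>D\<in>UNIV. \<Sum>E\<in>UNIV.
        mon (P @ [D, E] @ S) (smul ((M ** M') $ (x, y) $ (D, E)) a))"
    by (intro sum.cong refl)
      (simp add: matrix_matrix_mult_def scale_sum_left additive_sum[of "mon _"] single_add)
  finally show "app (factor_op n k M * factor_op n k M') (mon (P @ [x, y] @ S) a)
      = app (factor_op n k (M ** M')) (mon (P @ [x, y] @ S) a)"
    by (simp only: app_simps app_factor_op_local[OF *] app_sum scale_scale mult.commute)
qed (use assms in \<open>simp_all add: app_factor_op\<close>)

lemma factor_op_one:
  assumes "1 \<le> k" "k < n"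
  shows "factor_op n k (mat 1 :: 'a^('c \<times> 'c)^('c::finite \<times> 'c)) = 1"
proof (rule factor_op_cases[of n _ _ k])
  fix P S :: "'c list" and x y :: 'c and a :: 'u
  assume *: "k = Suc (length P)" "n = length P + 2 + length S"
  have "mon (P @ [A, B] @ S) (smul (mat 1 $ (x, y) $ (A, B)) a)
      = (if B = y then if A = x then mon (P @ [A, B] @ S) a else 0 else 0)" for A B
    by (auto simp: mat_def)
  then show "app (factor_op n k (mat 1)) (mon (P @ [x, y] @ S) a)
      = app 1 (mon (P @ [x, y] @ S) a)"
    by (simp only: app_factor_op_local[OF *]) (simp add: sum.delta)
qed (use assms in \<open>simp_all add: app_factor_op\<close>)

lemma factor_op_far:
  fixes M M' :: "'a^('c \<times> 'c)^('c::finite \<times> 'c)"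
  assumes "Suc i < j"
  shows "factor_op n i M * factor_op n j M' = factor_op n j M' * factor_op n i M"
proof (rule endo_eqI)
  fix I :: "'c list" and a
  show "app (factor_op n i M * factor_op n j M') (mon I a)
      = app (factor_op n j M' * factor_op n i M) (mon I a)"
  proof (cases "length I = n")
    case len: True
    show ?thesis
    proof (cases "1 \<le> i \<and> j < n")
      case True
      then have "1 \<le> i" "i < length I" using len assms by auto
      then obtain P x y T where I: "I = P @ [x, y] @ T" "i = Suc (length P)"
        by (rule word_split2)
      then have "1 \<le> j - i - 1" "j - i - 1 < length T" using len assms True by auto
      then obtain Q z w S where T: "T = Q @ [z, w] @ S" "j - i - 1 = Suc (length Q)"
        by (rule word_split2)
      have I': "I = (P @ [x, y] @ Q) @ [z, w] @ S" using I T by simp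
      have 1: "app (factor_op n i M) (mon ((P @ [x, y] @ Q) @ [z, w] @ S) b)
        = (\<Sum>A\<in>UNIV. \<Sum>B\<in>UNIV. mon ((P @ [A, B] @ Q) @ [z, w] @ S) (smul (M $ (x, y) $ (A, B)) b))"
        for x y z w b
        using app_factor_op_local[of i P n "Q @ [z, w] @ S" M x y b] I T len assms by simp
      have 2: "app (factor_op n j M') (mon ((P @ [x, y] @ Q) @ [z, w] @ S) b)
        = (\<Sum>A\<in>UNIV. \<Sum>B\<in>UNIV. mon ((P @ [x, y] @ Q) @ [A, B] @ S) (smul (M' $ (z, w) $ (A, B)) b))"
        for x y z w b
        using I T len assms by (intro app_factor_op_local) auto
      have "(\<Sum>A\<in>UNIV. \<Sum>B\<in>UNIV. \<Sum>D\<in>UNIV. \<Sum>E\<in>UNIV. F A B D E)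
          = (\<Sum>D\<in>UNIV. \<Sum>E\<in>UNIV. \<Sum>A\<in>UNIV. \<Sum>B\<in>UNIV. F A B D E)"
        for F :: "'c \<Rightarrow> 'c \<Rightarrow> 'c \<Rightarrow> 'c \<Rightarrow> ('c list \<Rightarrow>\<^sub>0 'u)"
      proof -
        have "(\<Sum>A\<in>UNIV. \<Sum>B\<in>UNIV. \<Sum>D\<in>UNIV. \<Sum>E\<in>UNIV. F A B D E)
            = (\<Sum>p\<in>UNIV. \<Sum>q\<in>UNIV. F (fst p) (snd p) (fst q) (snd q))"
          by (simp only: sum_UNIV_pair fst_conv snd_conv)
        also have "\<dots> = (\<Sum>q\<in>UNIV. \<Sum>p\<in>UNIV. F (fst p) (snd p) (fst q) (snd q))"
          by (rule sum.swap)
        finally show ?thesis by (simp only: sum_UNIV_pair fst_conv snd_conv)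
      qed
      then show ?thesis
        unfolding I' by (simp only: app_simps 1 2 app_sum scale_scale mult.commute)
    next
      case False
      then show ?thesis using len assms
        by (auto simp: app_factor_op on_factors_out app_sum)
    qed
  qed (simp add: app_factor_op)
qed

text \<open>\<open>h\<close> puts a word into a larger one, between a prefix and a suffix or into
  the extended alphabet. The lengths m and l differ for \<open>X r\<close>, which replaces r + 1
  letters by r.\<close>

definition acts ::
    "('i::finite list \<Rightarrow> 'w) \<Rightarrow> nat \<Rightarrow> nat \<Rightarrow> ('w, 'u) endo \<Rightarrow> ('i, 'a) word_matrix \<Rightarrow> bool" where
  "acts h m l x M \<longleftrightarrow> (\<forall>I a. length I = m \<longrightarrow>
     app x (mon (h I) a)
       = (\<Sum>J | length J = l. mon (h J) (smul (M I J) a)))"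

lemma actsD:
  "acts h m l x M \<Longrightarrow> length I = m \<Longrightarrow> app x (mon (h I) a)
     = (\<Sum>J | length J = l. mon (h J) (smul (M I J) a))"
  by (simp add: acts_def)

lemma single_smul_sum:
  "mon w (smul (sum f A) a) = (\<Sum>i\<in>A. mon w (smul (f i) a))"
  by (simp add: scale_sum_left additive_sum[of "mon w"] single_add)

lemma acts_mult:
  fixes h :: "'i::finite list \<Rightarrow> 'w"
  assumes "acts h m l x M" "acts h l k y M'"
  shows "acts h m k (x * y) (wm_mult l M M')"
  unfolding acts_def
proof (intro allI impI)
  fix I :: "'i list" and a assume I: "length I = m"
  have "app (x * y) (mon (h I) a)
      = (\<Sum>J | length J = l. \<Sum>K | length K = k. mon (h K) (smul (M I J * M' J K) a))"
    using I by (simp add: actsD[OF assms(1)] app_sum actsD[OF assms(2)] mult.commute)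
  also have "\<dots> = (\<Sum>K | length K = k. \<Sum>J | length J = l. mon (h K) (smul (M I J * M' J K) a))"
    by (rule sum.swap)
  finally show "app (x * y) (mon (h I) a)
      = (\<Sum>K | length K = k. mon (h K) (smul (wm_mult l M M' I K) a))"
    by (simp add: wm_mult_def single_smul_sum)
qed

lemma acts_one: "acts h m m 1 (wm_one m)"
proof -
  have "(\<Sum>J | length J = m. mon (h J) (smul (wm_one m I J) a))
      = (\<Sum>J | length J = m. if J = I then mon (h J) a else 0)"
    if "length I = m" for I and a :: 'u
    using that by (intro sum.cong) (auto simp: wm_one_def)
  then show ?thesis by (simp add: acts_def sum.delta)
qed

lemma acts_diff: "acts h m l x M \<Longrightarrow> acts h m l y M' \<Longrightarrow> acts h m l (x - y) (\<lambda>I J. M I J - M' I J)"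
  by (simp add: acts_def scale_left_diff_distrib single_diff sum_subtractf)

lemma acts_neg_one_power:
  "acts h m l x M \<Longrightarrow> acts h m l ((-1) ^ k * x) (\<lambda>I J. (-1) ^ k * M I J)"
  by (cases "even k") (simp_all add: acts_def scale_minus_left single_uminus sum_negf)

lemma acts_sum:
  fixes h :: "'i::finite list \<Rightarrow> 'w"
  assumes "\<And>i. i \<in> A \<Longrightarrow> acts h m l (x i) (M i)"
  shows "acts h m l (\<Sum>i\<in>A. x i) (\<lambda>I J. \<Sum>i\<in>A. M i I J)"
  unfolding acts_def
proof (intro allI impI)
  fix I :: "'i list" and a assume I: "length I = m"
  have "app (\<Sum>i\<in>A. x i) (mon (h I) a)
      = (\<Sum>i\<in>A. \<Sum>J | length J = l. mon (h J) (smul (M i I J) a))"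
    using I by (simp add: app_sum_left actsD[OF assms])
  also have "\<dots> = (\<Sum>J | length J = l. \<Sum>i\<in>A. mon (h J) (smul (M i I J) a))"
    by (rule sum.swap)
  finally show "app (\<Sum>i\<in>A. x i) (mon (h I) a)
      = (\<Sum>J | length J = l. mon (h J) (smul (\<Sum>i\<in>A. M i I J) a))"
    by (simp add: single_smul_sum)
qed

lemma acts_wm_prod:
  assumes "\<And>i. i \<in> set ks \<Longrightarrow> acts h m m (x i) (M i)"
  shows "acts h m m (prod_list (map x ks)) (wm_prod m (map M ks))"
  using assms by (induction ks) (simp_all add: wm_prod_def acts_one acts_mult)

lemma acts_factor_op:
  fixes M :: "'a^('c \<times> 'c)^('c::finite \<times> 'c)"
  assumes "n = length P + m + length S" "1 \<le> k" "k < m"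
  shows "acts (\<lambda>I. P @ I @ S) m m (factor_op n (length P + k) M) (on_factors k M)"
  unfolding acts_def
proof (intro allI impI)
  fix I :: "'c list" and a assume I: "length I = m"
  with assms have "1 \<le> k" "k < length I" by auto
  then obtain Q x y T where Q: "I = Q @ [x, y] @ T" "k = Suc (length Q)"
    by (rule word_split2)
  have "app (factor_op n (length P + k) M) (mon ((P @ Q) @ [x, y] @ (T @ S)) a)
      = (\<Sum>A\<in>UNIV. \<Sum>B\<in>UNIV. mon ((P @ Q) @ [A, B] @ (T @ S)) (smul (M $ (x, y) $ (A, B)) a))"
    using I Q assms by (intro app_factor_op_local) auto
  also have "\<dots> = (\<Sum>J | length J = m. mon (P @ J @ S) (smul (on_factors k M (Q @ [x, y] @ T) J) a))"
    using I Q by (subst sum_on_factors) auto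
  finally show "app (factor_op n (length P + k) M) (mon (P @ I @ S) a)
      = (\<Sum>J | length J = m. mon (P @ J @ S) (smul (on_factors k M I J) a))"
    using Q by simp
qed

text \<open>\<open>yang_baxter\<close> compares matrices on words of three letters;
  \<open>acts\<close> transports it to three neighbouring letters of a longer word. If the three
  places do not fit into the word, both sides contain a factor 0.\<close>

lemma braid_factor_op:
  fixes M :: "'a^('c \<times> 'c)^('c::finite \<times> 'c)"
  assumes "yang_baxter M"
  shows "braid (\<lambda>k. factor_op n k M)"
proof
  fix k
  let ?R = "\<lambda>k. factor_op n k M"
  show "?R k * ?R (Suc k) * ?R k = ?R (Suc k) * ?R k * ?R (Suc k)"
  proof (rule endo_eqI)
    fix I :: "'c list" and a
    show "app (?R k * ?R (Suc k) * ?R k) (mon I a)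
        = app (?R (Suc k) * ?R k * ?R (Suc k)) (mon I a)"
    proof (cases "length I = n")
      case len: True
      show ?thesis
      proof (cases "1 \<le> k \<and> Suc k < n")
        case True
        define P where "P = take (k - 1) I"
        define J where "J = take 3 (drop (k - 1) I)"
        define S where "S = drop 3 (drop (k - 1) I)"
        have I: "I = P @ J @ S" by (simp only: P_def J_def S_def append_take_drop_id)
        have l: "length P = k - 1" "length J = 3" using True len by (auto simp: P_def J_def)
        then have n: "n = length P + 3 + length S" using len I by auto
        have k: "length P + 1 = k" "length P + 2 = Suc k" using l True by auto
        have k': "Suc (length P) = k" using k by simp
        have "acts (\<lambda>I. P @ I @ S) 3 3 (prod_list (map (\<lambda>i. factor_op n (length P + i) M) [1, 2, 1]))
            (wm_prod 3 (map (\<lambda>i. on_factors i M) [1, 2, 1]))"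
          by (rule acts_wm_prod) (rule acts_factor_op[OF n], auto)
        from actsD[OF this l(2), of a] have 1: "app (?R k * ?R (Suc k) * ?R k) (mon I a)
          = (\<Sum>K | length K = 3. mon (P @ K @ S)
              (smul (wm_prod 3 [on_factors 1 M, on_factors 2 M, on_factors 1 M] J K) a))"
          by (simp add: k' I)
        have "acts (\<lambda>I. P @ I @ S) 3 3 (prod_list (map (\<lambda>i. factor_op n (length P + i) M) [2, 1, 2]))
            (wm_prod 3 (map (\<lambda>i. on_factors i M) [2, 1, 2]))"
          by (rule acts_wm_prod) (rule acts_factor_op[OF n], auto)
        from actsD[OF this l(2), of a] have 2: "app (?R (Suc k) * ?R k * ?R (Suc k)) (mon I a)
          = (\<Sum>K | length K = 3. mon (P @ K @ S)
              (smul (wm_prod 3 [on_factors 2 M, on_factors 1 M, on_factors 2 M] J K) a))"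
          by (simp add: k' I)
        show ?thesis using assms by (simp only: 1 2 yang_baxter_def)
      next
        case False
        then show ?thesis using len by (auto simp: app_factor_op on_factors_out app_sum)
      qed
    qed (simp add: app_factor_op)
  qed
qed (rule factor_op_far)

end

section \<open>The letter 0\<close>

lemma sum_option: "(\<Sum>A\<in>UNIV. F A) = F None + (\<Sum>k\<in>UNIV. F (Some k))" for F :: "'n::finite option \<Rightarrow> _"
  by (simp add: UNIV_option_conv sum.reindex)

lemma R_matrix_simps:
  "R_matrix \<sigma> C $ (Some i, Some j) $ (Some k, Some l) = \<sigma> $ (i, j) $ (k, l)"
  "R_matrix \<sigma> C $ (Some i, Some j) $ (None, Some k) = C $ (i, j) $ k"
  "R_matrix \<sigma> C $ (Some i, Some j) $ (A, None) = 0"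
  "R_matrix \<sigma> C $ (None, B) $ q = (if q = (B, None) then 1 else 0)"
  "R_matrix \<sigma> C $ (A, None) $ q = (if q = (None, A) then 1 else 0)"
  by (cases A; cases B; simp add: R_matrix_def)+

text \<open>Solved from R: after \<open>matrix_inv \<sigma>\<close>, R gives back the word i j
  together with words 0 k, whose coefficients come from \<open>matrix_inv \<sigma> ** C\<close>. The
  words k 0, which R turns into 0 k, are subtracted to cancel these.\<close>

definition R_inverse ::
    "'a::field^('n \<times> 'n)^('n \<times> 'n) \<Rightarrow> 'a^'n^('n \<times> 'n)
      \<Rightarrow> 'a^('n option \<times> 'n option)^('n::finite option \<times> 'n option)" where
  "R_inverse \<sigma> C = (\<chi> p q. case p of
       (Some i, Some j) \<Rightarrow>
         (case q of (Some k, Some l) \<Rightarrow> matrix_inv \<sigma> $ (i, j) $ (k, l)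
                  | (Some k, None) \<Rightarrow> - (matrix_inv \<sigma> ** C) $ (i, j) $ k
                  | _ \<Rightarrow> 0)
     | (A, B) \<Rightarrow> if q = (B, A) then 1 else 0)"

lemma R_inverse_simps:
  "R_inverse \<sigma> C $ (Some i, Some j) $ (Some k, Some l) = matrix_inv \<sigma> $ (i, j) $ (k, l)"
  "R_inverse \<sigma> C $ (Some i, Some j) $ (Some k, None) = - (matrix_inv \<sigma> ** C) $ (i, j) $ k"
  "R_inverse \<sigma> C $ (Some i, Some j) $ (None, B) = 0"
  "R_inverse \<sigma> C $ (None, B) $ q = (if q = (B, None) then 1 else 0)"
  "R_inverse \<sigma> C $ (A, None) $ q = (if q = (None, A) then 1 else 0)"
  by (cases A; cases B; simp add: R_inverse_def)+

lemma R_matrix_inverse: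
  fixes \<sigma> :: "'a::field^('n \<times> 'n)^('n::finite \<times> 'n)"
  assumes "invertible \<sigma>"
  shows "R_matrix \<sigma> C ** R_inverse \<sigma> C = mat 1" "R_inverse \<sigma> C ** R_matrix \<sigma> C = mat 1"
proof -
  have inv: "\<sigma> ** matrix_inv \<sigma> = mat 1" 
    using assms unfolding invertible_def matrix_inv_def by (rule someI2_ex) blast
  then have invC: "\<sigma> ** (matrix_inv \<sigma> ** C) = C" by (simp add: matrix_mul_assoc)
  have ss: "(\<Sum>k\<in>UNIV. \<Sum>l\<in>UNIV. \<sigma> $ p $ (k, l) * matrix_inv \<sigma> $ (k, l) $ q) = mat 1 $ p $ q" for p q
    unfolding inv[symmetric] by (simp add: matrix_matrix_mult_def sum_UNIV_pair)
  have sc: "(\<Sum>k\<in>UNIV. \<Sum>l\<in>UNIV. \<sigma> $ p $ (k, l) * (matrix_inv \<sigma> ** C) $ (k, l) $ q) = C $ p $ q" for p q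
    using arg_cong[OF invC, of "\<lambda>M. M $ p $ q"]
    by (simp add: matrix_matrix_mult_def[of \<sigma>] sum_UNIV_pair)
  have "(R_matrix \<sigma> C ** R_inverse \<sigma> C) $ (x, y) $ (z, w) = mat 1 $ (x, y) $ (z, w)" for x y z w
  proof (cases "x = None \<or> y = None")
    case True
    then have "R_matrix \<sigma> C $ (x, y) $ q = (if q = (y, x) then 1 else 0)" for q
      by (auto simp: R_matrix_simps)
    then have "(R_matrix \<sigma> C ** R_inverse \<sigma> C) $ (x, y) $ (z, w) = R_inverse \<sigma> C $ (y, x) $ (z, w)"
      by (simp add: matrix_matrix_mult_def if_distrib[of "\<lambda>t. t * _"] sum.delta cong: if_cong)
    then show ?thesis using True by (auto simp: R_inverse_simps mat_def)
  next
    case False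
    then obtain i j where [simp]: "x = Some i" "y = Some j" by auto
    have "(R_matrix \<sigma> C ** R_inverse \<sigma> C) $ (x, y) $ (z, w)
        = (\<Sum>k\<in>UNIV. C $ (i, j) $ k * R_inverse \<sigma> C $ (None, Some k) $ (z, w))
          + (\<Sum>k\<in>UNIV. \<Sum>l\<in>UNIV. \<sigma> $ (i, j) $ (k, l) * R_inverse \<sigma> C $ (Some k, Some l) $ (z, w))"
      by (simp add: matrix_matrix_mult_def sum_UNIV_pair sum_option R_matrix_simps)
    also have "\<dots> = mat 1 $ (x, y) $ (z, w)"
      by (cases z; cases w)
        (auto simp: R_inverse_simps ss sc sum_negf mat_def if_distrib[of "(*) _"] sum.delta cong: if_cong)
    finally show ?thesis .
  qed
  then show 1: "R_matrix \<sigma> C ** R_inverse \<sigma> C = mat 1"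
    by (simp add: vec_eq_iff)
  then show "R_inverse \<sigma> C ** R_matrix \<sigma> C = mat 1"
    by (simp add: matrix_left_right_inverse)
qed

section \<open>Words with a 0\<close>

definition zero_free :: "('n option list, 'u::ring_1) endo" where
  "zero_free = lin_endo (\<lambda>I a. if None \<in> set I then 0 else mon I a)"

text \<open>The letter 0 stands for the unit and may be dropped from a chain. Words with a further 0
  are sent to 0, so the image has only words without 0.\<close>

definition remove_zero :: "nat \<Rightarrow> nat \<Rightarrow> ('n option list, 'u::ring_1) endo" where
  "remove_zero n q = lin_endo (\<lambda>I a.
     if length I = n \<and> 1 \<le> q \<and> q \<le> n \<and> I ! (q - 1) = None \<and> None \<notin> set (take (q - 1) I @ drop q I)
     then mon (take (q - 1) I @ drop q I) a else 0)"

lemma app_zero_free [simp]: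
  "app zero_free (mon I a) = (if None \<in> set I then 0 else mon I a)"
  unfolding zero_free_def by (subst app_lin_endo_single) (auto simp: single_add)

lemma app_remove_zero:
  "app (remove_zero n q) (mon I a) =
     (if length I = n \<and> 1 \<le> q \<and> q \<le> n \<and> I ! (q - 1) = None \<and> None \<notin> set (take (q - 1) I @ drop q I)
     then mon (take (q - 1) I @ drop q I) a else 0)"
  unfolding remove_zero_def by (subst app_lin_endo_single) (auto simp: single_add)

lemma app_remove_zero_local:
  assumes "q = Suc (length P)" "n = length P + 1 + length S"
  shows "app (remove_zero n q) (mon (P @ [x] @ S) a)
    = (if x = None \<and> None \<notin> set P \<and> None \<notin> set S then mon (P @ S) a else 0)"
  using assms by (auto simp: app_remove_zero)

lemma zero_free_idem [simp]: "zero_free * zero_free = zero_free"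
  by (rule endo_eqI) auto

lemma zero_free_remove_zero [simp]: "zero_free * remove_zero n q = 0"
proof (rule endo_eqI)
  fix I :: "'a option list" and a :: 'b
  have "None \<in> set I" if "q \<le> length I" "1 \<le> q" "I ! (q - 1) = None"
    using that by (metis One_nat_def Suc_le_lessD Suc_pred' less_eq_Suc_le nth_mem)
  then show "app (zero_free * remove_zero n q) (mon I a) = app 0 (mon I a)"
    by (auto simp: app_remove_zero)
qed

lemma remove_zero_zero_free [simp]: "remove_zero n q * zero_free = remove_zero n q"
  by (rule endo_eqI) (auto simp: app_remove_zero)

text \<open>The words containing a 0 span an invariant subspace: zeros may be created but do not
  disappear. Hence \<open>zero_free\<close> can be inserted at any point of a product of such
  operators that ends in \<open>zero_free\<close>.\<close>

definition preserves_zeros :: "('n option list, 'u::ring_1) endo \<Rightarrow> bool" where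
  "preserves_zeros x \<longleftrightarrow> x * zero_free = zero_free * x * zero_free"

lemma preserves_zeros_simps [intro]:
  "preserves_zeros 1" "preserves_zeros x \<Longrightarrow> preserves_zeros y \<Longrightarrow> preserves_zeros (x + y)"
  "preserves_zeros x \<Longrightarrow> preserves_zeros y \<Longrightarrow> preserves_zeros (x - y)"
  by (simp_all add: preserves_zeros_def algebra_simps)

lemma preserves_zeros_mult [intro]:
  assumes "preserves_zeros x" "preserves_zeros y"
  shows "preserves_zeros (x * y)"
proof -
  note px = assms(1)[unfolded preserves_zeros_def] and py = assms(2)[unfolded preserves_zeros_def]
  have "x * y * zero_free = x * (zero_free * y * zero_free)"
    by (simp only: py[symmetric] mult.assoc[of x y])
  also have "\<dots> = (x * zero_free) * (y * zero_free)" by (simp only: mult.assoc)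
  also have "\<dots> = (zero_free * x * zero_free) * (y * zero_free)" by (simp only: px[symmetric])
  also have "\<dots> = zero_free * x * (zero_free * y * zero_free)" by (simp only: mult.assoc)
  also have "\<dots> = zero_free * (x * y) * zero_free" by (simp only: py[symmetric]) (simp only: mult.assoc)
  finally show ?thesis unfolding preserves_zeros_def .
qed

text \<open>An operator of the form \<open>zero_free * z\<close> vanishes on words with a 0. Such
  operators are the error terms below, and this form survives multiplication by x from the
  left.\<close>

lemma preserves_zeros_factor:
  assumes "preserves_zeros x"
  obtains z where "x * (zero_free * y) = zero_free * z"
proof
  have "x * (zero_free * y) = (x * zero_free) * y" by (simp only: mult.assoc)
  also have "\<dots> = (zero_free * x * zero_free) * y"
    by (simp only: assms[unfolded preserves_zeros_def, symmetric])
  finally show "x * (zero_free * y) = zero_free * (x * zero_free * y)" by (simp only: mult.assoc)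
qed

lemma preserves_zeros_prod_list [intro]:
  "(\<And>i. i \<in> set ks \<Longrightarrow> preserves_zeros (x i)) \<Longrightarrow> preserves_zeros (prod_list (map x ks))"
  by (induction ks) auto

lemma preserves_zeros_neg_one_power: "preserves_zeros x \<Longrightarrow> preserves_zeros ((-1) ^ k * x)"
  by (cases "even k") (simp_all add: preserves_zeros_def)

context quantum_lie_algebra
begin

abbreviation R_op :: "nat \<Rightarrow> nat \<Rightarrow> ('n option list, 'u) endo" where
  "R_op n k \<equiv> factor_op n k (R_matrix \<sigma> C)"

abbreviation S_op :: "nat \<Rightarrow> nat \<Rightarrow> ('n option list, 'u) endo" where
  "S_op n k \<equiv> factor_op n k (R_inverse \<sigma> C)"

lemma invertible_braid_R_op: "invertible_braid (R_op n) (S_op n) 1 n"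
proof -
  interpret braid "R_op n" by (rule braid_factor_op) (rule yang_baxter_R)
  show ?thesis
    by unfold_locales (simp_all add: factor_op_mult R_matrix_inverse[OF invertible_sigma] factor_op_one)
qed

definition bracket_op :: "nat \<Rightarrow> nat \<Rightarrow> ('n option list, 'u) endo" where
  "bracket_op n p = lin_endo (\<lambda>I a.
     if length I = n \<and> 1 \<le> p \<and> p < n then
       (case (I ! (p - 1), I ! p) of
          (Some i, Some j) \<Rightarrow> (\<Sum>k\<in>UNIV. mon (take (p - 1) I @ [Some k] @ drop (Suc p) I)
             (smul (C $ (i, j) $ k) a))
        | _ \<Rightarrow> 0)
     else 0)"

lemma app_bracket_op:
  "app (bracket_op n p) (mon I a) =
     (if length I = n \<and> 1 \<le> p \<and> p < n then
       (case (I ! (p - 1), I ! p) of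
          (Some i, Some j) \<Rightarrow> (\<Sum>k\<in>UNIV. mon (take (p - 1) I @ [Some k] @ drop (Suc p) I)
             (smul (C $ (i, j) $ k) a))
        | _ \<Rightarrow> 0)
     else 0)"
  unfolding bracket_op_def
  by (subst app_lin_endo_single)
    (auto simp: single_add scale_right_distrib sum.distrib split: option.splits)

lemma app_bracket_op_local:
  assumes "p = Suc (length P)" "n = length P + 2 + length S"
  shows "app (bracket_op n p) (mon (P @ [Some i, Some j] @ S) a)
    = (\<Sum>k\<in>UNIV. mon (P @ [Some k] @ S) (smul (C $ (i, j) $ k) a))"
  using assms by (simp add: app_bracket_op nth_append)

text \<open>A 0 found at place p after R was at place p + 1 before, or was created by C from two
  nonzero letters. For place p + 1, in \<open>R_remove_zero_right\<close>, there is no second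
  source: R never creates a 0 in the second of its places.\<close>

lemma R_remove_zero_left:
  assumes "1 \<le> p" "p < n"
  shows "R_op n p * remove_zero n p = remove_zero n (Suc p) + zero_free * bracket_op n p"
proof (rule factor_op_cases[of n _ _ p])
  fix P S :: "'n option list" and x y :: "'n option" and a :: 'u
  assume *: "p = Suc (length P)" "n = length P + 2 + length S"
  have 1: "app (remove_zero n p) (mon (P @ [A, B] @ S) b)
      = (if A = None \<and> None \<notin> set P \<and> None \<notin> set (B # S) then mon (P @ [B] @ S) b else 0)" for A B b
    using app_remove_zero_local[of p P n "B # S" A b] * by simp
  have 2: "app (remove_zero n (Suc p)) (mon (P @ [x, y] @ S) a)
      = (if y = None \<and> None \<notin> set (P @ [x]) \<and> None \<notin> set S then mon (P @ [x] @ S) a else 0)"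
    using app_remove_zero_local[of "Suc p" "P @ [x]" n S y a] * by simp
  show "app (R_op n p * remove_zero n p) (mon (P @ [x, y] @ S) a)
      = app (remove_zero n (Suc p) + zero_free * bracket_op n p) (mon (P @ [x, y] @ S) a)"
    unfolding app_simps app_factor_op_local[OF *] app_sum 1 2
    by (cases x; cases y)
      (auto simp: sum_option R_matrix_simps app_bracket_op_local[OF *, simplified] if_distrib[of "\<lambda>c. smul c _"]
        if_distrib[of "mon _"] sum.delta cong: if_cong)
qed (use assms in \<open>auto simp: app_factor_op app_remove_zero app_bracket_op\<close>)

lemma R_remove_zero_right:
  assumes "1 \<le> p" "p < n"
  shows "R_op n p * remove_zero n (Suc p) = remove_zero n p"
proof (rule factor_op_cases[of n _ _ p])
  fix P S :: "'n option list" and x y :: "'n option" and a :: 'u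
  assume *: "p = Suc (length P)" "n = length P + 2 + length S"
  have 1: "app (remove_zero n p) (mon (P @ [x, y] @ S) b)
      = (if x = None \<and> None \<notin> set P \<and> None \<notin> set (y # S) then mon (P @ [y] @ S) b else 0)" for b
    using app_remove_zero_local[of p P n "y # S" x b] * by simp
  have 2: "app (remove_zero n (Suc p)) (mon (P @ [A, B] @ S) b)
      = (if B = None \<and> None \<notin> set (P @ [A]) \<and> None \<notin> set S then mon (P @ [A] @ S) b else 0)"
    for A B b
    using app_remove_zero_local[of "Suc p" "P @ [A]" n S B b] * by simp
  show "app (R_op n p * remove_zero n (Suc p)) (mon (P @ [x, y] @ S) a)
      = app (remove_zero n p) (mon (P @ [x, y] @ S) a)"
    unfolding app_simps app_factor_op_local[OF *] app_sum 1 2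
    by (cases x; cases y)
      (auto simp: sum_option R_matrix_simps if_distrib[of "\<lambda>c. smul c _"]
        if_distrib[of "mon _"] sum.delta cong: if_cong)
qed (use assms in \<open>auto simp: app_factor_op app_remove_zero\<close>)

lemma app_R_zero_free:
  assumes "k = Suc (length P)" "n = length P + 2 + length S"
  shows "app zero_free (app (R_op n k) (mon (P @ [x, y] @ S) a))
    = (if None \<in> set (P @ [x, y] @ S) then 0 else
        \<Sum>i\<in>UNIV. \<Sum>j\<in>UNIV. mon (P @ [Some i, Some j] @ S) (smul (\<sigma> $ (the x, the y) $ (i, j)) a))"
  unfolding app_factor_op_local[OF assms] app_sum app_zero_free
  by (cases x; cases y) (auto simp: sum_option R_matrix_simps cong: if_cong)

lemma app_S_zero_free:
  assumes "k = Suc (length P)" "n = length P + 2 + length S"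
  shows "app zero_free (app (S_op n k) (mon (P @ [x, y] @ S) a))
    = (if None \<in> set (P @ [x, y] @ S) then 0 else
        \<Sum>i\<in>UNIV. \<Sum>j\<in>UNIV. mon (P @ [Some i, Some j] @ S) (smul (matrix_inv \<sigma> $ (the x, the y) $ (i, j)) a))"
  unfolding app_factor_op_local[OF assms] app_sum app_zero_free
  by (cases x; cases y) (auto simp: sum_option R_inverse_simps cong: if_cong)

lemma preserves_zeros_R_op [intro]: "preserves_zeros (R_op n k)"
  and preserves_zeros_S_op [intro]: "preserves_zeros (S_op n k)"
proof -
  have *: "preserves_zeros (factor_op n k M)"
    if "\<And>P S x y a. k = Suc (length P) \<Longrightarrow> n = length P + 2 + length S \<Longrightarrow> None \<in> set (P @ [x, y] @ S)
      \<Longrightarrow> app zero_free (app (factor_op n k M) (mon (P @ [x, y] @ S) a)) = 0" for M :: "'a^('n option \<times> 'n option)^('n option \<times> 'n option)"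
    unfolding preserves_zeros_def
  proof (rule factor_op_cases[of n _ _ k])
    fix P S :: "'n option list" and x y :: "'n option" and a :: 'u
    assume "k = Suc (length P)" "n = length P + 2 + length S"
    from that[OF this, of x y a]
    show "app (factor_op n k M * zero_free) (mon (P @ [x, y] @ S) a)
      = app (zero_free * factor_op n k M * zero_free) (mon (P @ [x, y] @ S) a)"
      unfolding app_simps app_zero_free by (cases "None \<in> set (P @ [x, y] @ S)") simp_all
  qed (auto simp: app_factor_op on_factors_out)
  show "preserves_zeros (R_op n k)" by (rule *, subst app_R_zero_free) auto
  show "preserves_zeros (S_op n k)" by (rule *, subst app_S_zero_free) auto
qed

text \<open>The final \<open>zero_free\<close> is there because R may itself create a 0. On the left
  such a word has two zeros and is sent to 0 by \<open>remove_zero\<close>; on the right the first 0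
  is gone by then.\<close>

lemma R_remove_zero_far:
  assumes "Suc k < q" "q \<le> n"
  shows "R_op n k * remove_zero n q = remove_zero n q * R_op (n - 1) k * zero_free"
proof (rule factor_op_cases[of n _ _ k])
  fix P S :: "'n option list" and x y :: "'n option" and a :: 'u
  assume *: "k = Suc (length P)" "n = length P + 2 + length S"
  define T z U where "T = take (q - k - 2) S" and "z = S ! (q - k - 2)" and "U = drop (Suc (q - k - 2)) S"
  have S: "S = T @ [z] @ U"
    using assms * id_take_nth_drop[of "q - k - 2" S] by (simp add: T_def z_def U_def)
  have lT: "length T = q - k - 2" using assms * by (simp add: T_def)
  have 1: "app (remove_zero n q) (mon (P @ [A, B] @ S) b)
      = (if z = None \<and> None \<notin> set (P @ [A, B] @ T) \<and> None \<notin> set U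
         then mon (P @ [A, B] @ (T @ U)) b else 0)" for A B b
  proof -
    have "q = Suc (length (P @ [A, B] @ T))" "n = length (P @ [A, B] @ T) + 1 + length U"
      using assms * S lT by simp_all
    from app_remove_zero_local[OF this, of z b] show ?thesis by (simp add: S)
  qed
  have n': "n - 1 = length P + 2 + length (T @ U)" using * S by simp
  show "app (R_op n k * remove_zero n q) (mon (P @ [x, y] @ S) a)
      = app (remove_zero n q * R_op (n - 1) k * zero_free) (mon (P @ [x, y] @ S) a)"
    unfolding app_simps app_factor_op_local[OF *] app_sum 1 if_distrib[of "app _"]
      app_R_zero_free[OF *(1) n'] app_zero
    by (cases x; cases y) (auto simp: sum_option R_matrix_simps cong: if_cong)
next
  fix I :: "'n option list" and a :: 'u
  assume I: "length I = n" "\<not> (1 \<le> k \<and> k < n)"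
  then have "app (R_op (n - 1) k) (mon (take (q - 1) I @ drop q I) a) = 0"
    using assms by (intro app_factor_op_out) auto
  then show "app (R_op n k * remove_zero n q) (mon I a)
      = app (remove_zero n q * R_op (n - 1) k * zero_free) (mon I a)"
    using I by (simp add: app_factor_op_out app_remove_zero)
qed (simp add: app_remove_zero app_factor_op)

lemma R_remove_zero_first:
  assumes "1 \<le> k"
  shows "R_op n (Suc k) * remove_zero n 1 = remove_zero n 1 * R_op (n - 1) k * zero_free"
proof (rule factor_op_cases[of n _ _ "Suc k"])
  fix P S :: "'n option list" and x y :: "'n option" and a :: 'u
  assume *: "Suc k = Suc (length P)" "n = length P + 2 + length S"
  then obtain z Q where P: "P = z # Q" using assms by (cases P) auto
  have 1: "app (remove_zero n 1) (mon (P @ [A, B] @ S) b)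
      = (if z = None \<and> None \<notin> set (Q @ [A, B] @ S)
         then mon (Q @ [A, B] @ S) b else 0)" for A B b
    using app_remove_zero_local[of 1 "[]" n "Q @ [A, B] @ S" z b] * P by simp
  have n': "k = Suc (length Q)" "n - 1 = length Q + 2 + length S" using * P by simp_all
  show "app (R_op n (Suc k) * remove_zero n 1) (mon (P @ [x, y] @ S) a)
      = app (remove_zero n 1 * R_op (n - 1) k * zero_free) (mon (P @ [x, y] @ S) a)"
    unfolding app_simps app_factor_op_local[OF *] app_sum 1 if_distrib[of "app _"]
      app_R_zero_free[OF n'] app_zero
    by (cases x; cases y) (auto simp: sum_option R_matrix_simps cong: if_cong)
next
  fix I :: "'n option list" and a :: 'u
  assume I: "length I = n" "\<not> (1 \<le> Suc k \<and> Suc k < n)"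
  then have "app (R_op (n - 1) k) (mon (drop 1 I) a) = 0"
    using assms by (intro app_factor_op_out) auto
  then show "app (R_op n (Suc k) * remove_zero n 1) (mon I a)
      = app (remove_zero n 1 * R_op (n - 1) k * zero_free) (mon I a)"
    using I by (simp add: app_factor_op_out app_remove_zero)
qed (simp add: app_remove_zero app_factor_op)

definition multiply_first :: "nat \<Rightarrow> ('n option list, 'u) endo" where
  "multiply_first n = lin_endo (\<lambda>I a. if length I = n
     then (case I of Some i # J \<Rightarrow> mon J (a * gen i) | _ \<Rightarrow> 0) else 0)"

lemma app_multiply_first:
  "app (multiply_first n) (mon I a) = (if length I = n
     then (case I of Some i # J \<Rightarrow> mon J (a * gen i) | _ \<Rightarrow> 0) else 0)"
  unfolding multiply_first_def
  by (subst app_lin_endo_single) (auto simp: single_add distrib_right split: list.splits option.splits)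

lemma R_multiply_first:
  assumes "1 \<le> k"
  shows "R_op n (Suc k) * multiply_first n = multiply_first n * R_op (n - 1) k"
proof (rule factor_op_cases[of n _ _ "Suc k"])
  fix P S :: "'n option list" and x y :: "'n option" and a :: 'u
  assume *: "Suc k = Suc (length P)" "n = length P + 2 + length S"
  then obtain z Q where P: "P = z # Q" using assms by (cases P) auto
  have 1: "app (multiply_first n) (mon (P @ [A, B] @ S) b)
      = (case z of None \<Rightarrow> 0 | Some i \<Rightarrow> mon (Q @ [A, B] @ S) (b * gen i))" for A B b
    using * P by (simp add: app_multiply_first split: option.splits)
  have n': "k = Suc (length Q)" "n - 1 = length Q + 2 + length S" using * P by simp_all
  show "app (R_op n (Suc k) * multiply_first n) (mon (P @ [x, y] @ S) a)
      = app (multiply_first n * R_op (n - 1) k) (mon (P @ [x, y] @ S) a)"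
    unfolding app_simps app_factor_op_local[OF *] app_sum 1
    by (cases z) (simp_all only: option.case app_zero app_factor_op_local[OF n'] smul_mult_left sum.neutral_const)
next
  fix I :: "'n option list" and a :: 'u
  assume I: "length I = n" "\<not> (1 \<le> Suc k \<and> Suc k < n)"
  then have "app (R_op (n - 1) k) (mon J b) = 0" if "I = z # J" for z J b
    using assms that by (intro app_factor_op_out) auto
  then show "app (R_op n (Suc k) * multiply_first n) (mon I a)
      = app (multiply_first n * R_op (n - 1) k) (mon I a)"
    using I by (simp add: app_factor_op_out app_multiply_first split: list.splits option.splits)
qed (simp add: app_multiply_first app_factor_op)

lemma R_remove_zeros:
  assumes "1 \<le> p" "p < n"
  shows "(1 - R_op n p) * (remove_zero n p + remove_zero n (Suc p)) = - (zero_free * bracket_op n p)"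
  using R_remove_zero_left[OF assms] R_remove_zero_right[OF assms] by (simp add: algebra_simps)

lemma ascending_remove_zero_last:
  assumes "1 \<le> i" "i \<le> q" "q \<le> n"
  shows "ascending (R_op n) i q * remove_zero n q = remove_zero n i"
  using assms(2,3)
proof (induction q rule: dec_induct)
  case (step q)
  have "R_op n q * remove_zero n (Suc q) = remove_zero n q"
    using step assms by (intro R_remove_zero_right) auto
  then show ?case using step by (simp add: ascending_snoc mult.assoc)
qed simp

text \<open>By \<open>ascending_remove_zero_last\<close> a 0 arriving in the last place was already
  a letter of the word, at the place from which the summand starts. Words without 0 offer
  none.\<close>

lemma zero_free_shuffle_remove_last:
  assumes "1 \<le> n"
  shows "zero_free * last_shuffle (R_op n) 1 (n - 1) * remove_zero n n = 0"
proof -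
  have "last_shuffle (R_op n) 1 (n - 1) * remove_zero n n
      = (\<Sum>j<n. (-1) ^ j * remove_zero n (n - j))"
    unfolding last_shuffle_sum sum_distrib_right using assms
    by (intro sum.cong) (auto simp: ascending_remove_zero_last mult.assoc)
  moreover have "zero_free * ((-1) ^ j * remove_zero n (n - j)) = (0 :: ('n option list, 'u) endo)" for j
    by (cases "even j") simp_all
  ultimately show ?thesis by (simp add: mult.assoc sum_distrib_left)
qed

lemma zero_free_antisymmetrizer_remove_last:
  assumes "1 \<le> n"
  shows "zero_free * antisymmetrizer (R_op n) 1 (n - 1) * remove_zero n n = 0"
proof (cases "n - 1")
  case (Suc m)
  have "antisymmetrizer (R_op n) 1 m * remove_zero n n
      = remove_zero n n * antisymmetrizer (\<lambda>k. R_op (n - 1) k * zero_free) 1 m"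
    using Suc by (intro antisymmetrizer_intertwine) (simp add: R_remove_zero_far mult.assoc)
  then have "zero_free * antisymmetrizer (R_op n) 1 (n - 1) * remove_zero n n
      = (zero_free * last_shuffle (R_op n) 1 (n - 1) * remove_zero n n)
        * antisymmetrizer (\<lambda>k. R_op (n - 1) k * zero_free) 1 m"
    by (simp only: Suc antisymmetrizer.simps mult.assoc)
  then show ?thesis using zero_free_shuffle_remove_last[OF assms] by simp
qed simp

lemma preserves_zeros_last_twist: "preserves_zeros (last_twist (R_op n) e i)"
  unfolding last_twist_def ascending_def mult.assoc
  by (intro preserves_zeros_neg_one_power preserves_zeros_mult preserves_zeros_prod_list preserves_zeros_R_op)

lemma preserves_zeros_twist_product: "preserves_zeros (twist_product (R_op n) e k)"
  by (induction k) (auto intro!: preserves_zeros_last_twist)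

text \<open>\<open>AXA\<close> records this operator only for lower indices without 0; the lemma
  says that on other words it vanishes. It starts from k = 1: two R's return a 0 to the last place
  up to a bracket, so \<open>1 - R^2\<close> leaves the bracket alone.\<close>

lemma twist_product_remove_last:
  assumes "1 \<le> k" "k < n"
  obtains y where "twist_product (R_op n) n k * remove_zero n n = zero_free * y"
proof -
  let ?\<rho> = "remove_zero n n" and ?c = "zero_free * bracket_op n (n - 1)"
  have R: "R_op n (n - 1) * ?\<rho> = remove_zero n (n - 1)"
    "R_op n (n - 1) * remove_zero n (n - 1) = ?\<rho> + ?c"
    using assms R_remove_zero_right[of "n - 1" n] R_remove_zero_left[of "n - 1" n] by simp_all
  have tw: "last_twist (R_op n) n i * ?\<rho>
      = (-1) ^ i * (ascending (R_op n) (n - 1 - i) (n - 1) * (?\<rho> + ?c))" for i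
  proof -
    have "ascending (R_op n) (n - 1 - i) n = ascending (R_op n) (n - 1 - i) (n - 1) * R_op n (n - 1)"
      using ascending_snoc[of "n - 1 - i" "n - 1" "R_op n"] assms by simp
    then show ?thesis by (simp add: last_twist_def mult.assoc R del: One_nat_def)
  qed
  have asc_c: "\<exists>y. ascending (R_op n) i j * ?c = zero_free * y" for i j
  proof -
    have "preserves_zeros (ascending (R_op n) i j)" by (auto simp: ascending_def)
    from preserves_zeros_factor[OF this] show ?thesis by blast
  qed
  have asc_\<rho>: "\<exists>y. ascending (R_op n) i (n - 1) * ?\<rho> = ?\<rho> * y" for i
  proof -
    have "prod_list (map (R_op n) [i..<n - 1]) * ?\<rho>
        = ?\<rho> * prod_list (map (\<lambda>k. R_op (n - 1) k * zero_free) [i..<n - 1])"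
      by (rule prod_list_intertwine) (auto simp: R_remove_zero_far mult.assoc)
    then show ?thesis unfolding ascending_def by blast
  qed
  have "\<exists>y. twist_product (R_op n) n k * ?\<rho> = zero_free * y"
    using assms
  proof (induction k rule: dec_induct)
    case base
    have "twist_product (R_op n) n 1 * ?\<rho> = - ?c"
      using tw[of 0] by (simp add: left_diff_distrib)
    then show ?case by (metis mult_minus_right)
  next
    case (step k)
    let ?T = "twist_product (R_op n) n k"
    from asc_c obtain y1 where y1: "ascending (R_op n) (n - 1 - k) (n - 1) * ?c = zero_free * y1" by blast
    from asc_\<rho> obtain y2 where y2: "ascending (R_op n) (n - 1 - k) (n - 1) * ?\<rho> = ?\<rho> * y2" by blast
    from step obtain y3 where y3: "?T * ?\<rho> = zero_free * y3" by auto
    obtain z where "?T * (zero_free * y1) = zero_free * z"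
      by (rule preserves_zeros_factor[OF preserves_zeros_twist_product])
    then have z: "?T * zero_free * y1 = zero_free * z" by (simp only: mult.assoc)
    have "twist_product (R_op n) n (Suc k) * ?\<rho>
        = ?T * ?\<rho> - ?T * ((-1) ^ k * (?\<rho> * y2 + zero_free * y1))"
      by (simp only: twist_product.simps left_diff_distrib right_diff_distrib mult.assoc[of ?T]
          mult_1_left tw distrib_left y1 y2)
    also have "\<dots> = ?T * ?\<rho> - (-1) ^ k * ((?T * ?\<rho>) * y2 + (?T * zero_free) * y1)"
      by (cases "even k") (simp_all add: distrib_left right_diff_distrib mult.assoc)
    also have "\<dots> = zero_free * (y3 - (-1) ^ k * (y3 * y2 + z))"
      unfolding y3 z by (cases "even k") (simp_all add: algebra_simps)
    finally show ?case by blast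
  qed
  then show thesis using that by blast
qed

end

section \<open>The actions of the generators\<close>

lemma sum_rotate:
  "(\<Sum>a\<in>A. \<Sum>b\<in>B. \<Sum>c\<in>D. F a b c) = (\<Sum>c\<in>D. \<Sum>a\<in>A. \<Sum>b\<in>B. F a b c)"
proof -
  have "(\<Sum>a\<in>A. \<Sum>b\<in>B. \<Sum>c\<in>D. F a b c) = (\<Sum>a\<in>A. \<Sum>c\<in>D. \<Sum>b\<in>B. F a b c)"
    by (rule sum.cong[OF refl], rule sum.swap)
  also have "\<dots> = (\<Sum>c\<in>D. \<Sum>a\<in>A. \<Sum>b\<in>B. F a b c)" by (rule sum.swap)
  finally show ?thesis .
qed

section \<open>Homogeneous families and the extended alphabet\<close>

definition homogeneous :: "nat \<Rightarrow> ('w list \<Rightarrow>\<^sub>0 'u::zero) \<Rightarrow> bool" where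
  "homogeneous n u \<longleftrightarrow> (\<forall>I. Poly_Mapping.lookup u I \<noteq> 0 \<longrightarrow> length I = n)"

lemma homogeneous_simps [intro]:
  fixes u v :: "'w list \<Rightarrow>\<^sub>0 'u::ab_group_add"
  shows "homogeneous n (0 :: 'w list \<Rightarrow>\<^sub>0 'u)"
    and "homogeneous n u \<Longrightarrow> homogeneous n v \<Longrightarrow> homogeneous n (u + v)"
    and "homogeneous n u \<Longrightarrow> homogeneous n (- u)"
    and "homogeneous n u \<Longrightarrow> homogeneous n v \<Longrightarrow> homogeneous n (u - v)"
    and "length I = n \<Longrightarrow> homogeneous n (mon I a)"
  by (auto simp: homogeneous_def lookup_add lookup_minus lookup_single when_def)
    (metis add_cancel_left_left, metis diff_zero)

lemma homogeneous_sum [intro]: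
  fixes f :: "'i \<Rightarrow> ('w list \<Rightarrow>\<^sub>0 'u::ab_group_add)"
  shows "(\<And>i. i \<in> A \<Longrightarrow> homogeneous n (f i)) \<Longrightarrow> homogeneous n (sum f A)"
  by (induction A rule: infinite_finite_induct) auto

lemma homogeneous_image:
  fixes f :: "('w list \<Rightarrow>\<^sub>0 'u::ab_group_add) \<Rightarrow> ('v list \<Rightarrow>\<^sub>0 'u)"
  assumes "\<And>x y. f (x + y) = f x + f y"
    and "\<And>I a. length I = n \<Longrightarrow> homogeneous m (f (mon I a))"
    and "homogeneous n u"
  shows "homogeneous m (f u)"
proof -
  have "f u = (\<Sum>w\<in>Poly_Mapping.keys u. f (mon w (Poly_Mapping.lookup u w)))"
    by (subst poly_mapping_sum_single[of u]) (simp only: additive_sum[of f, OF assms(1)])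
  moreover have "homogeneous m (f (mon w (Poly_Mapping.lookup u w)))"
    if "w \<in> Poly_Mapping.keys u" for w
    using assms(2,3) that by (auto simp: homogeneous_def in_keys_iff)
  ultimately show ?thesis by auto
qed

lemma homogeneous_eqI:
  fixes f g :: "('w list \<Rightarrow>\<^sub>0 'u::ab_group_add) \<Rightarrow> 'v::ab_group_add"
  assumes "\<And>x y. f (x + y) = f x + f y" "\<And>x y. g (x + y) = g x + g y"
    and "\<And>I a. length I = n \<Longrightarrow> f (mon I a) = g (mon I a)"
    and "homogeneous n u"
  shows "f u = g u"
proof -
  have "f (\<Sum>w\<in>Poly_Mapping.keys u. mon w (Poly_Mapping.lookup u w))
      = g (\<Sum>w\<in>Poly_Mapping.keys u. mon w (Poly_Mapping.lookup u w))"
    unfolding additive_sum[of f, OF assms(1)] additive_sum[of g, OF assms(2)]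
    using assms(3,4) by (intro sum.cong) (auto simp: homogeneous_def in_keys_iff)
  then show ?thesis by (simp flip: poly_mapping_sum_single)
qed

lemma gamma_act_add: "gamma_act j (u + v) = gamma_act j u + gamma_act j v"
  unfolding gamma_act_def by (rule lin_ext_add) (simp add: single_add)

lemma gamma_act_zero [simp]: "gamma_act j 0 = 0"
  by (rule additive_zero) (rule gamma_act_add)

lemma gamma_act_single [simp]: "gamma_act j (mon I a) = mon (I @ [j]) a"
  unfolding gamma_act_def by (subst lin_ext_single) simp_all

lemma homogeneous_gamma_act [intro]: "homogeneous n u \<Longrightarrow> homogeneous (Suc n) (gamma_act j u)"
  by (rule homogeneous_image[of "gamma_act j"]) (auto simp: gamma_act_add)

definition append_op :: "'w list \<Rightarrow> ('w list, 'u::ring_1) endo" where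
  "append_op T = lin_endo (\<lambda>I a. mon (I @ T) a)"

text \<open>The restriction to one length makes \<open>S_op_suffix\<close> an identity of operators:
  with the length fixed, the appended letters sit exactly at the places on which \<open>S_op\<close>
  acts.\<close>

definition suffix_op :: "nat \<Rightarrow> 'w list \<Rightarrow> ('w list, 'u::ring_1) endo" where
  "suffix_op n T = lin_endo (\<lambda>I a. if length I = n then mon (I @ T) a else 0)"

lemma app_append_op [simp]: "app (append_op T) (mon I a) = mon (I @ T) a"
  unfolding append_op_def by (subst app_lin_endo_single) (simp_all add: single_add)

lemma app_suffix_op:
  "app (suffix_op n T) (mon I a) = (if length I = n then mon (I @ T) a else 0)"
  unfolding suffix_op_def by (subst app_lin_endo_single) (simp_all add: single_add)

lemma append_op_append: "append_op T * append_op U = append_op (T @ U)"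
  by (rule endo_eqI) simp

lemma app_append_op_append: "app (append_op U) (app (append_op T) v) = app (append_op (T @ U)) v"
  by (simp flip: append_op_append)

definition lift :: "('n list \<Rightarrow>\<^sub>0 'u::ring_1) \<Rightarrow> ('n option list \<Rightarrow>\<^sub>0 'u)" where
  "lift = lin_ext (\<lambda>I a. mon (map Some I) a)"

lemma lift_add: "lift (u + v) = lift u + lift v"
  unfolding lift_def by (rule lin_ext_add) (simp add: single_add)

lemma lift_single [simp]: "lift (mon I a) = mon (map Some I) a"
  unfolding lift_def by (subst lin_ext_single) simp_all

lemma lift_sum: "lift (sum f A) = (\<Sum>i\<in>A. lift (f i))"
  by (rule additive_sum) (rule lift_add)

lemma lift_zero [simp]: "lift 0 = 0"
  by (rule additive_zero) (rule lift_add)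

lemma lift_uminus: "lift (- u) = - lift u"
  using lift_add[of u "- u"] by (simp add: eq_neg_iff_add_eq_0 add.commute)

lemma lift_minus: "lift (u - v) = lift u - lift v"
  using lift_add[of u "- v"] by (simp add: lift_uminus)

lemma lift_gamma_act: "lift (gamma_act j u) = app (append_op [Some j]) (lift u)"
  by (rule additive_eqI[of "\<lambda>u. lift (gamma_act j u)"]) (simp_all add: lift_add gamma_act_add app_add)

lemma lift_fold_gamma_act: "lift (fold gamma_act I u) = app (append_op (map Some I)) (lift u)"
proof (induction I arbitrary: u)
  case Nil
  have "lift u = app (append_op []) (lift u)"
    by (rule additive_eqI[of lift "\<lambda>u. app (append_op []) (lift u)"]) (simp_all add: lift_add app_add)
  then show ?case by simp
next
  case (Cons i I)
  then show ?case by (simp add: lift_gamma_act app_append_op_append)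
qed

lemma zero_free_lift [simp]: "app zero_free (lift u) = lift u"
  by (rule additive_eqI[of "\<lambda>u. app zero_free (lift u)"]) (auto simp: lift_add app_add)

lemma suffix_op_lift: "homogeneous n u \<Longrightarrow> app (suffix_op n T) (lift u) = app (append_op T) (lift u)"
  by (rule homogeneous_eqI[of "\<lambda>u. app (suffix_op n T) (lift u)"]) (simp_all add: lift_add app_add app_suffix_op)

lemma zero_free_suffix_op: "None \<notin> set T \<Longrightarrow> suffix_op n T * zero_free = zero_free * suffix_op n T"
  by (rule endo_eqI) (simp add: app_suffix_op)

context algebra_over_field
begin

lemma wscale_single [simp]: "wscale smul c (mon I a) = mon I (smul c a)"
  by (simp add: wscale_def)

lemma wscale_add: "wscale smul c (u + v) = wscale smul c u + wscale smul c v"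
  by (rule poly_mapping_eqI)
    (auto simp: wscale_def Poly_Mapping.map.rep_eq lookup_add when_def scale_right_distrib simp flip: scale_right_distrib)

lemma wscale_zero [simp]: "wscale smul c 0 = 0"
  by (rule additive_zero) (rule wscale_add)

lemma homogeneous_wscale [intro]: "homogeneous n u \<Longrightarrow> homogeneous n (wscale smul c u)"
  by (rule homogeneous_image[of "wscale smul c"]) (auto simp: wscale_add)

definition smul_op :: "'a \<Rightarrow> ('w list, 'u) endo" where
  "smul_op c = lin_endo (\<lambda>I a. mon I (smul c a))"

lemma app_smul_op [simp]: "app (smul_op c) (mon I a) = mon I (smul c a)"
  unfolding smul_op_def by (subst app_lin_endo_single) (simp_all add: single_add scale_right_distrib)

lemma lift_wscale: "lift (wscale smul c u) = app (smul_op c) (lift u)"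
  by (rule additive_eqI[of "\<lambda>u. lift (wscale smul c u)"]) (simp_all add: lift_add wscale_add app_add)

lemma factor_op_suffix_op:
  fixes M :: "'a^('c \<times> 'c)^('c::finite \<times> 'c)"
  assumes "1 \<le> k" "k < m" "n = m + length T"
  shows "factor_op m k M * suffix_op m T = suffix_op m T * factor_op n k M"
proof (rule factor_op_cases[of m _ _ k])
  fix P S :: "'c list" and x y :: 'c and a :: 'u
  assume *: "k = Suc (length P)" "m = length P + 2 + length S"
  then have "app (factor_op n k M) (mon (P @ [x, y] @ (S @ T)) a)
    = (\<Sum>A\<in>UNIV. \<Sum>B\<in>UNIV. mon (P @ [A, B] @ (S @ T)) (smul (M $ (x, y) $ (A, B)) a))"
    using assms by (intro app_factor_op_local) auto
  then show "app (factor_op m k M * suffix_op m T) (mon (P @ [x, y] @ S) a)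
      = app (suffix_op m T * factor_op n k M) (mon (P @ [x, y] @ S) a)"
    using * unfolding app_simps app_factor_op_local[OF *] by (simp add: app_sum app_suffix_op)
qed (use assms in \<open>auto simp: app_factor_op app_suffix_op\<close>)

end

context quantum_lie_algebra
begin

section \<open>The \<Omega>'s as shuffles in the inverse of R\<close>

lemma omega_monomial_add:
  "omega_monomial \<sigma> smul I (a + b) j = omega_monomial \<sigma> smul I a j + omega_monomial \<sigma> smul I b j"
proof (induction I arbitrary: j)
  case (Cons i I)
  then show ?case by (simp add: gamma_act_add wscale_add sum.distrib single_add)
qed simp

lemma omega_act_add: "omega_act \<sigma> smul j (u + v) = omega_act \<sigma> smul j u + omega_act \<sigma> smul j v"
  unfolding omega_act_def by (rule lin_ext_add) (rule omega_monomial_add)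

lemma omega_act_single: "omega_act \<sigma> smul j (mon I a) = omega_monomial \<sigma> smul (rev I) a j"
  unfolding omega_act_def
  by (subst lin_ext_single) (auto intro: additive_zero simp: omega_monomial_add)

lemma homogeneous_omega_monomial [intro]:
  "length I = Suc n \<Longrightarrow> homogeneous n (omega_monomial \<sigma> smul I a j)"
proof (induction I arbitrary: j n)
  case (Cons i I)
  show ?case
  proof (cases n)
    case 0
    then show ?thesis using Cons.prems by auto
  next
    case (Suc m)
    have "homogeneous n (- (\<Sum>m\<in>UNIV. \<Sum>k\<in>UNIV. wscale smul (matrix_inv \<sigma> $ (m, i) $ (k, j))
          (gamma_act k (omega_monomial \<sigma> smul I a m))))"
      unfolding Suc using Cons Suc
      by (intro homogeneous_simps homogeneous_sum homogeneous_wscale homogeneous_gamma_act) auto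
    moreover have "homogeneous n (if i = j then mon (rev I) a else 0)"
      using Cons.prems by auto
    ultimately show ?thesis unfolding omega_monomial.simps by (rule homogeneous_simps(2))
  qed
qed simp

lemma homogeneous_omega_act [intro]: "homogeneous (Suc n) u \<Longrightarrow> homogeneous n (omega_act \<sigma> smul j u)"
  by (rule homogeneous_image[of "omega_act \<sigma> smul j"]) (auto simp: omega_act_add omega_act_single)

lemma omega_act_homogeneous_0: "homogeneous 0 u \<Longrightarrow> omega_act \<sigma> smul j u = 0"
  by (rule homogeneous_eqI[of "omega_act \<sigma> smul j" "\<lambda>_. 0" 0]) (auto simp: omega_act_add omega_act_single)

lemma S_op_suffix:
  "zero_free * suffix_op m [Some i, Some j] * S_op (m + 2) (Suc m) * zero_free
    = (\<Sum>k\<in>UNIV. \<Sum>l\<in>UNIV. zero_free * smul_op (matrix_inv \<sigma> $ (i, j) $ (k, l)) * suffix_op m [Some k, Some l])"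
proof (rule endo_eqI)
  fix I :: "'n option list" and a :: 'u
  show "app (zero_free * suffix_op m [Some i, Some j] * S_op (m + 2) (Suc m) * zero_free) (mon I a)
    = app (\<Sum>k\<in>UNIV. \<Sum>l\<in>UNIV. zero_free * smul_op (matrix_inv \<sigma> $ (i, j) $ (k, l)) * suffix_op m [Some k, Some l])
        (mon I a)"
    using app_S_zero_free[of "Suc m" I "m + 2" "[]" "Some i" "Some j" a]
    by (auto simp: app_suffix_op app_sum_left)
qed

text \<open>\<Omega> with index j removes a letter; appending j puts one back and turns the family
  of all \<Omega>'s into a single operator on words of the same length. The cross relation then is
  the recursion of \<open>last_shuffle\<close>, with its Kronecker delta as the summand 1. The
  components of \<open>S_op\<close> with a 0 are discarded by \<open>zero_free\<close>.\<close>

lemma omega_shuffle_monomial: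
  assumes "I \<noteq> []"
  shows "(\<Sum>j\<in>UNIV. app (append_op [Some j]) (lift (omega_monomial \<sigma> smul (rev I) a j)))
    = app (last_shuffle (S_op (length I)) 1 (length I - 1) * zero_free) (mon (map Some I) a)"
  using assms
proof (induction I rule: rev_nonempty_induct)
  case (single i)
  then show ?case by (simp add: lift_uminus app_sum if_distrib[of lift] if_distrib[of "app _"] sum.delta cong: if_cong)
next
  case (snoc i I)
  let ?n = "length I" and ?om = "\<lambda>m. lift (omega_monomial \<sigma> smul (rev I) a m)"
  obtain m where m: "?n = Suc m" using snoc.hyps by (cases I) auto
  have om: "homogeneous m (omega_monomial \<sigma> smul (rev I) a l)" for l
    using m by auto
  have suf: "last_shuffle (S_op ?n) 1 m * suffix_op ?n [Some i]
      = suffix_op ?n [Some i] * last_shuffle (S_op (Suc ?n)) 1 m"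
    by (rule last_shuffle_intertwine) (use m in \<open>auto intro!: factor_op_suffix_op\<close>)
  have inner: "app (last_shuffle (S_op (Suc ?n)) 1 m * zero_free) (mon (map Some (I @ [i])) a)
      = (\<Sum>l\<in>UNIV. app (append_op [Some l, Some i]) (?om l))"
  proof -
    define u where "u = (\<Sum>l\<in>UNIV. gamma_act l (omega_monomial \<sigma> smul (rev I) a l))"
    have u: "homogeneous ?n u" unfolding u_def m by (intro homogeneous_sum homogeneous_gamma_act om)
    have lift_u: "lift u = app (last_shuffle (S_op ?n) 1 m * zero_free) (mon (map Some I) a)"
      using snoc.IH m by (simp add: u_def lift_sum lift_gamma_act)
    have "(\<Sum>l\<in>UNIV. app (append_op [Some l, Some i]) (?om l)) = app (append_op [Some i]) (lift u)"
      by (simp add: u_def lift_sum lift_gamma_act app_sum app_append_op_append)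
    also have "\<dots> = app (last_shuffle (S_op ?n) 1 m * zero_free * suffix_op ?n [Some i]) (mon (map Some I) a)"
      using suffix_op_lift[OF u, of "[Some i]"] lift_u by simp
    also have "last_shuffle (S_op ?n) 1 m * zero_free * suffix_op ?n [Some i]
        = suffix_op ?n [Some i] * last_shuffle (S_op (Suc ?n)) 1 m * zero_free"
    proof -
      have "suffix_op ?n [Some i] * zero_free = (zero_free * suffix_op ?n [Some i] :: ('n option list, 'u) endo)"
        by (rule zero_free_suffix_op) simp
      then have "last_shuffle (S_op ?n) 1 m * zero_free * suffix_op ?n [Some i]
          = (last_shuffle (S_op ?n) 1 m * suffix_op ?n [Some i]) * zero_free"
        by (simp only: mult.assoc)
      then show ?thesis by (simp only: suf)
    qed
    finally show ?thesis by (simp add: app_suffix_op)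
  qed
  have step: "app (S_op (Suc ?n) (Suc m) * zero_free) (app (append_op [Some l, Some i]) (?om l))
      = (\<Sum>k\<in>UNIV. \<Sum>j\<in>UNIV. app (append_op [Some j])
           (lift (wscale smul (matrix_inv \<sigma> $ (l, i) $ (k, j)) (gamma_act k (omega_monomial \<sigma> smul (rev I) a l)))))" for l
  proof -
    have "app (append_op [Some l, Some i]) (?om l) = app (zero_free * suffix_op m [Some l, Some i]) (?om l)"
      using suffix_op_lift[OF om] by simp
    then have "app (S_op (Suc ?n) (Suc m) * zero_free) (app (append_op [Some l, Some i]) (?om l))
        = app (zero_free * suffix_op m [Some l, Some i] * S_op (m + 2) (Suc m) * zero_free) (?om l)"
      by (simp add: m)
    also have "\<dots> = (\<Sum>k\<in>UNIV. \<Sum>j\<in>UNIV. app (suffix_op m [Some k, Some j])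
        (lift (wscale smul (matrix_inv \<sigma> $ (l, i) $ (k, j)) (omega_monomial \<sigma> smul (rev I) a l))))"
      unfolding S_op_suffix by (simp add: app_sum_left lift_wscale)
    also have "\<dots> = (\<Sum>k\<in>UNIV. \<Sum>j\<in>UNIV. app (append_op [Some j])
           (lift (wscale smul (matrix_inv \<sigma> $ (l, i) $ (k, j)) (gamma_act k (omega_monomial \<sigma> smul (rev I) a l)))))"
    proof -
      have c: "smul_op c * append_op T = append_op T * smul_op c" for c and T :: "'n option list"
        by (rule endo_eqI) simp
      have "app (smul_op c) (app (append_op [Some k]) v) = app (append_op [Some k]) (app (smul_op c) v)"
        for c k and v :: "'n option list \<Rightarrow>\<^sub>0 'u"
        using arg_cong[OF c, of "\<lambda>x. app x v"] by simp
      moreover have "app (suffix_op m T) (lift (wscale smul c (omega_monomial \<sigma> smul (rev I) a l)))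
          = app (append_op T) (lift (wscale smul c (omega_monomial \<sigma> smul (rev I) a l)))" for c T
        by (intro suffix_op_lift homogeneous_wscale om)
      ultimately show ?thesis by (simp add: lift_wscale lift_gamma_act app_append_op_append)
    qed
    finally show ?thesis .
  qed
  let ?L = "last_shuffle (S_op (Suc ?n)) 1 m" and ?s = "mon (map Some (I @ [i])) a"
  have "app (last_shuffle (S_op (Suc ?n)) 1 (Suc m) * zero_free) ?s
      = ?s - app (?L * S_op (Suc ?n) (Suc m) * zero_free) ?s"
    by (simp add: app_minus)
  also have "?L * S_op (Suc ?n) (Suc m) * zero_free = ?L * zero_free * (S_op (Suc ?n) (Suc m) * zero_free)"
    using preserves_zeros_S_op[of "Suc ?n" "Suc m"] unfolding preserves_zeros_def by (simp only: mult.assoc)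
  also have "app (?L * zero_free * (S_op (Suc ?n) (Suc m) * zero_free)) ?s
      = (\<Sum>l\<in>UNIV. \<Sum>k\<in>UNIV. \<Sum>j\<in>UNIV. app (append_op [Some j])
           (lift (wscale smul (matrix_inv \<sigma> $ (l, i) $ (k, j)) (gamma_act k (omega_monomial \<sigma> smul (rev I) a l)))))"
    using inner step by (simp only: app_simps(6)[of "?L * zero_free"] app_sum)
  also have "\<dots> = (\<Sum>j\<in>UNIV. \<Sum>l\<in>UNIV. \<Sum>k\<in>UNIV. app (append_op [Some j])
           (lift (wscale smul (matrix_inv \<sigma> $ (l, i) $ (k, j)) (gamma_act k (omega_monomial \<sigma> smul (rev I) a l)))))"
    by (rule sum_rotate)
  finally show ?case
    using m by (simp add: lift_minus lift_sum app_minus app_sum sum_subtractf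
      if_distrib[of lift] if_distrib[of "app _"] sum.delta cong: if_cong)
qed

lemma omega_shuffle:
  assumes "homogeneous (Suc n) u"
  shows "(\<Sum>j\<in>UNIV. app (append_op [Some j]) (lift (omega_act \<sigma> smul j u)))
    = app (last_shuffle (S_op (Suc n)) 1 n * zero_free) (lift u)"
proof (rule homogeneous_eqI[where n = "Suc n" and u = u
      and f = "\<lambda>u. \<Sum>j\<in>UNIV. app (append_op [Some j]) (lift (omega_act \<sigma> smul j u))"
      and g = "\<lambda>u. app (last_shuffle (S_op (Suc n)) 1 n * zero_free) (lift u)"])
  fix I :: "'n list" and a :: 'u
  assume "length I = Suc n"
  then show "(\<Sum>j\<in>UNIV. app (append_op [Some j]) (lift (omega_act \<sigma> smul j (mon I a))))
    = app (last_shuffle (S_op (Suc n)) 1 n * zero_free) (lift (mon I a))"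
    using omega_shuffle_monomial[of I a] by (cases I) (auto simp: omega_act_single)
qed (use assms in \<open>simp_all add: omega_act_add lift_add app_add sum.distrib\<close>)

section \<open>The \<chi>'s as products of R's\<close>

lemma wscale_sum: "wscale smul c (sum f A) = (\<Sum>i\<in>A. wscale smul c (f i))"
  by (rule additive_sum) (rule wscale_add)

lemma wscale_gamma_act: "wscale smul c (gamma_act j u) = gamma_act j (wscale smul c u)"
  by (rule additive_eqI[of "\<lambda>u. wscale smul c (gamma_act j u)"]) (simp_all add: wscale_add gamma_act_add)

lemma wscale_wscale: "wscale smul c (wscale smul d u) = wscale smul d (wscale smul c u)"
  by (rule additive_eqI[of "\<lambda>u. wscale smul c (wscale smul d u)"]) (simp_all add: wscale_add mult.commute)

lemma chi_monomial_add:
  "chi_monomial \<sigma> C smul gen I (a + b) j = chi_monomial \<sigma> C smul gen I a j + chi_monomial \<sigma> C smul gen I b j"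
proof (induction I arbitrary: j)
  case (Cons i I)
  then show ?case by (simp add: gamma_act_add wscale_add sum.distrib single_add scale_right_distrib)
qed (simp add: single_add distrib_right)

lemma chi_monomial_smul:
  "chi_monomial \<sigma> C smul gen I (smul c a) j = wscale smul c (chi_monomial \<sigma> C smul gen I a j)"
proof (induction I arbitrary: j)
  case (Cons i I)
  then show ?case
    by (simp add: wscale_add wscale_sum wscale_gamma_act wscale_wscale[of c] mult.commute)
qed (simp add: smul_mult_left)

lemma chi_act_add: "chi_act \<sigma> C smul gen j (u + v) = chi_act \<sigma> C smul gen j u + chi_act \<sigma> C smul gen j v"
  unfolding chi_act_def by (rule lin_ext_add) (rule chi_monomial_add)

lemma chi_act_single: "chi_act \<sigma> C smul gen j (mon I a) = chi_monomial \<sigma> C smul gen (rev I) a j"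
  unfolding chi_act_def
  by (subst lin_ext_single) (auto intro: additive_zero simp: chi_monomial_add)

lemma homogeneous_chi_monomial: "homogeneous (length I) (chi_monomial \<sigma> C smul gen I a j)"
proof (induction I arbitrary: j)
  case (Cons i I)
  show ?case unfolding chi_monomial.simps length_Cons
    by (intro homogeneous_simps homogeneous_sum homogeneous_wscale homogeneous_gamma_act Cons) simp
qed auto

lemma homogeneous_chi_act [intro]: "homogeneous n u \<Longrightarrow> homogeneous n (chi_act \<sigma> C smul gen j u)"
  by (rule homogeneous_image[of "chi_act \<sigma> C smul gen j"])
    (use homogeneous_chi_monomial[of "rev I" for I] in \<open>auto simp: chi_act_add chi_act_single\<close>)

text \<open>
  The action of \<open>\<chi>\<^sub>j\<close> is that of \<open>R\<close>'s, followed by the multiplication of the first letter into the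
  coefficient: the letter \<open>0\<close> acts as \<open>\<chi>\<^sub>0 = 1\<close>.
\<close>

definition absorb_first :: "nat \<Rightarrow> ('n option list, 'u) endo" where
  "absorb_first n = zero_free * multiply_first n + remove_zero n 1"

lemma descending_move_zero:
  assumes "n = length P + 1 + length S"
  shows "app (descending (R_op n) 1 (Suc (length P))) (mon (P @ [None] @ S) a)
    = mon (None # P @ S) a"
  using assms
proof (induction P arbitrary: S rule: rev_induct)
  case (snoc x P)
  have "(\<Sum>A\<in>UNIV. \<Sum>B\<in>UNIV. mon (P @ [A, B] @ S)
      (smul (R_matrix \<sigma> C $ (x, None) $ (A, B)) a)) = mon (P @ [None] @ x # S) a"
    by (cases x) (simp_all add: sum_option R_matrix_simps if_distrib[of "\<lambda>c. smul c _"]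
        if_distrib[of "mon _"] sum.delta cong: if_cong)
  then have "app (R_op n (Suc (length P))) (mon (P @ [x, None] @ S) a)
      = mon (P @ [None] @ x # S) a"
    using snoc.prems by (subst app_factor_op_local) simp_all
  moreover have "descending (R_op n) 1 (Suc (length (P @ [x])))
      = R_op n (Suc (length P)) * descending (R_op n) 1 (Suc (length P))"
    by (simp add: descending_snoc)
  ultimately show ?case using snoc.IH[of "x # S"] snoc.prems by simp
qed simp

lemma suffix_op_absorb_first:
  "absorb_first (Suc n) * append_op [Some l] = suffix_op (Suc n) [Some l] * absorb_first (Suc (Suc n))"
proof (rule endo_eqI)
  fix I :: "'n option list" and a :: 'u
  show "app (absorb_first (Suc n) * append_op [Some l]) (mon I a)
      = app (suffix_op (Suc n) [Some l] * absorb_first (Suc (Suc n))) (mon I a)"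
    by (cases I) (auto simp: absorb_first_def app_suffix_op app_multiply_first app_remove_zero
        split: option.splits)
qed

text \<open>The two sums of the cross relation are the components of R at the last two places. A
  \<sigma> term goes on with the shorter word and has l appended afterwards; a C term yields a 0,
  which mere transpositions take to the front, where it is read as the unit.\<close>

lemma chi_shuffle_monomial:
  "lift (chi_monomial \<sigma> C smul gen (rev I) a j)
    = app (descending (R_op (Suc (length I))) 1 (Suc (length I)) * absorb_first (Suc (length I)))
        (mon (map Some (I @ [j])) a)"
proof (induction I arbitrary: a j rule: rev_induct)
  case Nil
  then show ?case by (simp add: absorb_first_def app_multiply_first app_remove_zero)
next
  case (snoc i I)
  let ?n = "length I" and ?P = "map Some I :: 'n option list"
  define D where "D = descending (R_op (Suc (Suc ?n))) 1 (Suc ?n) * absorb_first (Suc (Suc ?n))"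
  have suf: "descending (R_op (Suc ?n)) 1 (Suc ?n) * suffix_op (Suc ?n) [Some l]
      = suffix_op (Suc ?n) [Some l] * descending (R_op (Suc (Suc ?n))) 1 (Suc ?n)" for l
    unfolding descending_def by (rule prod_list_intertwine) (auto intro!: factor_op_suffix_op)
  have sigma: "app D (mon (?P @ [Some k, Some l]) b)
      = lift (gamma_act l (chi_monomial \<sigma> C smul gen (rev I) b k))" for k l b
  proof -
    have "lift (gamma_act l (chi_monomial \<sigma> C smul gen (rev I) b k))
      = app (descending (R_op (Suc ?n)) 1 (Suc ?n) * (absorb_first (Suc ?n) * append_op [Some l]))
          (mon (map Some (I @ [k])) b)"
      by (simp add: lift_gamma_act snoc.IH)
    also have "descending (R_op (Suc ?n)) 1 (Suc ?n) * (absorb_first (Suc ?n) * append_op [Some l])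
        = suffix_op (Suc ?n) [Some l] * D"
      unfolding D_def suffix_op_absorb_first by (simp only: suf mult.assoc[symmetric])
    finally show ?thesis by (simp add: app_suffix_op)
  qed
  have zero: "app D (mon (?P @ [None, Some k]) b) = mon (map Some (I @ [k])) b" for k b
    using descending_move_zero[of "Suc (Suc ?n)" ?P "[Some k]" b]
    by (auto simp: D_def absorb_first_def app_multiply_first app_remove_zero)
  have "app (R_op (Suc (Suc ?n)) (Suc ?n)) (mon (?P @ [Some i, Some j]) a)
      = (\<Sum>k\<in>UNIV. mon (?P @ [None, Some k]) (smul (C $ (i, j) $ k) a))
        + (\<Sum>k\<in>UNIV. \<Sum>l\<in>UNIV. mon (?P @ [Some k, Some l]) (smul (\<sigma> $ (i, j) $ (k, l)) a))"
    using app_factor_op_local[of "Suc ?n" ?P "Suc (Suc ?n)" "[]"]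
    by (simp add: sum_option R_matrix_simps)
  moreover have "descending (R_op (Suc (Suc ?n))) 1 (Suc (Suc ?n)) * absorb_first (Suc (Suc ?n))
      = R_op (Suc (Suc ?n)) (Suc ?n) * D"
    by (simp add: D_def descending_snoc mult.assoc)
  ultimately show ?case
    by (simp add: app_add app_sum sigma zero chi_monomial_smul lift_add lift_sum wscale_gamma_act)
qed

lemma chi_shuffle:
  assumes "homogeneous n u"
  shows "lift (chi_act \<sigma> C smul gen j u)
    = app (append_op [Some j] * descending (R_op (Suc n)) 1 (Suc n) * absorb_first (Suc n)) (lift u)"
proof (rule homogeneous_eqI[where n = n and u = u and f = "\<lambda>u. lift (chi_act \<sigma> C smul gen j u)"
      and g = "\<lambda>u. app (append_op [Some j] * descending (R_op (Suc n)) 1 (Suc n) * absorb_first (Suc n)) (lift u)"])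
  fix I :: "'n list" and a :: 'u
  assume "length I = n"
  then show "lift (chi_act \<sigma> C smul gen j (mon I a))
    = app (append_op [Some j] * descending (R_op (Suc n)) 1 (Suc n) * absorb_first (Suc n)) (lift (mon I a))"
    using chi_shuffle_monomial[of I a j] by (simp add: chi_act_single)
qed (use assms in \<open>simp_all add: chi_act_add lift_add app_add\<close>)

end

lemma map_plus_upt: "map (\<lambda>k. f (d + k)) [i..<j] = map f [d + i..<d + j]"
  by (induction j) auto

lemma sum_words_Some:
  "(\<Sum>L | length L = r. if None \<in> set L then 0 else F L) = (\<Sum>K | length K = r. F (map Some K))"
  for F :: "'n::finite option list \<Rightarrow> 'v::ab_group_add"
proof (induction r arbitrary: F)
  case (Suc r)
  have "(\<Sum>L | length L = Suc r. if None \<in> set L then 0 else F L)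
      = (\<Sum>x\<in>UNIV. \<Sum>L | length L = r. if None \<in> set L then 0 else F (Some x # L))"
    by (simp add: sum_words_Suc sum_option)
  then show ?case by (simp add: Suc sum_words_Suc)
qed simp

lemma preserves_zeros_sum [intro]:
  "(\<And>i. i \<in> A \<Longrightarrow> preserves_zeros (x i)) \<Longrightarrow> preserves_zeros (sum x A)"
  by (induction A rule: infinite_finite_induct) (auto simp: preserves_zeros_def distrib_left distrib_right)

lemma iterated_shuffle_snoc:
  "iterated_shuffle s p m (Suc k) = iterated_shuffle s p m k * last_shuffle s p (m - k)"
proof (induction k arbitrary: m)
  case (Suc k)
  have "iterated_shuffle s p m (Suc (Suc k)) = last_shuffle s p m * iterated_shuffle s p (m - 1) (Suc k)"
    by (rule iterated_shuffle.simps)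
  also have "\<dots> = last_shuffle s p m * iterated_shuffle s p (m - 1) k * last_shuffle s p (m - 1 - k)"
    unfolding Suc by (simp only: mult.assoc)
  finally show ?case by simp
qed simp

lemma preserves_zeros_shuffles:
  assumes "\<And>k. preserves_zeros (r k)"
  shows "preserves_zeros (last_shuffle r p m)" "preserves_zeros (antisymmetrizer r p m)"
    "preserves_zeros (first_unshuffle r p m)" "preserves_zeros (to_end r p m k)"
    "preserves_zeros (iterated_shuffle r p m k)" "preserves_zeros (ascending r i j)"
    "preserves_zeros (descending r i j)"
proof -
  show asc: "preserves_zeros (ascending r i j)" "preserves_zeros (descending r i j)" for i j
    unfolding ascending_def descending_def using assms by auto
  show last: "preserves_zeros (last_shuffle r p m)" for p m
    by (induction m) (use assms in auto)
  show "preserves_zeros (antisymmetrizer r p m)"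
    by (induction m) (use assms last in \<open>auto simp del: last_shuffle.simps\<close>)
  show "preserves_zeros (first_unshuffle r p m)"
    by (induction m arbitrary: p) (use assms in auto)
  show "preserves_zeros (to_end r p m k)"
  proof (induction m arbitrary: p k)
    case 0
    show ?case by (cases k) (auto simp: preserves_zeros_def)
  next
    case (Suc m)
    show ?case
      by (cases k) (use Suc asc in \<open>auto simp: mult.assoc simp del: power_Suc
        intro!: preserves_zeros_simps preserves_zeros_neg_one_power preserves_zeros_mult\<close>)
  qed
  show "preserves_zeros (iterated_shuffle r p m k)"
    by (induction k arbitrary: m) (use last in auto)
qed

section \<open>Matrices of operators modulo words with a 0\<close>

context quantum_lie_algebra
begin

lemmas preserves_zeros_R_shuffles [intro] = preserves_zeros_shuffles[of "R_op n" for n, OF preserves_zeros_R_op]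
  and preserves_zeros_S_shuffles [intro] = preserves_zeros_shuffles[of "S_op n" for n, OF preserves_zeros_S_op]

text \<open>
  \<open>M\<close> is the matrix of \<open>x\<close> on the last \<open>m\<close> letters of the words with prefix \<open>P\<close>, modulo words
  that contain a zero.
\<close>

definition represents ::
    "'n list \<Rightarrow> nat \<Rightarrow> ('n option list, 'u) endo \<Rightarrow> ('n, 'a) word_matrix \<Rightarrow> bool" where
  "represents P m x M \<longleftrightarrow> acts (\<lambda>I. map Some (P @ I)) m m (x * zero_free) M \<and> preserves_zeros x"

lemma represents_one: "represents P m 1 (wm_one m)"
proof -
  have 1: "acts (\<lambda>I. map Some (P @ I)) m m (1 :: ('n option list, 'u) endo) (wm_one m)" by (rule acts_one)
  have "app zero_free (mon (map Some (P @ I)) a) = app 1 (mon (map Some (P @ I)) a)"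
    for I :: "'n list" and a :: 'u by auto
  then show ?thesis
    using actsD[OF 1] unfolding represents_def acts_def by (auto simp only: mult_1_left)
qed

lemma represents_mult:
  assumes "represents P m x M" "represents P m y M'"
  shows "represents P m (x * y) (wm_mult m M M')"
proof -
  have "(x * zero_free) * (y * zero_free) = x * y * zero_free"
    using assms(2) unfolding represents_def preserves_zeros_def by (simp only: mult.assoc)
  then show ?thesis
    using acts_mult[of _ m m "x * zero_free" M m "y * zero_free" M'] assms
    unfolding represents_def by auto
qed

lemma represents_neg_one_power:
  "represents P m x M \<Longrightarrow> represents P m ((-1) ^ k * x) (\<lambda>I J. (-1) ^ k * M I J)"
  unfolding represents_def mult.assoc by (auto intro: acts_neg_one_power preserves_zeros_neg_one_power)

lemma represents_sum:
  "(\<And>i. i \<in> A \<Longrightarrow> represents P m (x i) (M i)) \<Longrightarrow> represents P m (\<Sum>i\<in>A. x i) (\<lambda>I J. \<Sum>i\<in>A. M i I J)"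
  unfolding represents_def sum_distrib_right by (auto intro: acts_sum)

lemma represents_wm_prod:
  "(\<And>i. i \<in> set ks \<Longrightarrow> represents P m (x i) (M i))
    \<Longrightarrow> represents P m (prod_list (map x ks)) (wm_prod m (map M ks))"
  by (induction ks) (simp_all add: wm_prod_def represents_one represents_mult)

lemma represents_R_op:
  assumes "n = length P + m" "1 \<le> k" "k < m"
  shows "represents P m (R_op n (length P + k)) (on_factors k \<sigma>)"
  unfolding represents_def acts_def
proof (intro conjI allI impI)
  fix I :: "'n list" and a assume I: "length I = m"
  with assms have "1 \<le> k" "k < length I" by auto
  then obtain Q x y T where Q: "I = Q @ [x, y] @ T" "k = Suc (length Q)"
    by (rule word_split2)
  have "app zero_free (app (R_op n (length P + k)) (mon (map Some (P @ Q) @ [Some x, Some y] @ map Some T) a))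
      = (\<Sum>i\<in>UNIV. \<Sum>j\<in>UNIV. mon (map Some (P @ Q) @ [Some i, Some j] @ map Some T) (smul (\<sigma> $ (x, y) $ (i, j)) a))"
    using I Q assms by (subst app_R_zero_free) auto
  also have "\<dots> = (\<Sum>J | length J = m. mon (map Some (P @ J)) (smul (on_factors k \<sigma> (Q @ [x, y] @ T) J) a))"
    using I Q by (subst sum_on_factors) auto
  finally show "app (R_op n (length P + k) * zero_free) (mon (map Some (P @ I)) a)
      = (\<Sum>J | length J = m. mon (map Some (P @ J)) (smul (on_factors k \<sigma> I J) a))"
    using Q by simp
qed auto

text \<open>The indices differ by one because \<open>antisym_on\<close> counts letters and
  \<open>antisymmetrizer\<close> counts generators.\<close>

lemma represents_antisymmetrizer:
  assumes "n = length P + m" "j < m"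
  shows "represents P m (antisymmetrizer (R_op n) (Suc (length P)) j) (antisym_on \<sigma> m (Suc j))"
  using assms(2)
proof (induction j)
  case 0
  then show ?case by (simp add: represents_one)
next
  case (Suc j)
  have "represents P m (last_shuffle (R_op n) (Suc (length P)) l) (partial_antisym \<sigma> m (Suc l))"
    if "Suc l \<le> m" for l
    unfolding partial_antisym_def last_shuffle_sum
  proof (intro represents_sum represents_neg_one_power)
    fix i assume i: "i \<in> {..<Suc l}"
    have "ascending (R_op n) (Suc (length P) + l - i) (Suc (length P) + l)
        = prod_list (map (\<lambda>k. R_op n (length P + k)) [Suc l - i..<Suc l])"
    proof -
      have "Suc (length P) + l - i = length P + (Suc l - i)" "Suc (length P) + l = length P + Suc l"
        using i by auto
      then show ?thesis by (simp only: ascending_def map_plus_upt[of "R_op n" "length P"])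
    qed
    then show "represents P m (ascending (R_op n) (Suc (length P) + l - i) (Suc (length P) + l))
        (wm_prod m (map (\<lambda>k. on_factors k \<sigma>) [Suc l - i..<Suc l]))"
      using i that assms by (auto intro!: represents_wm_prod represents_R_op simp del: upt_Suc)
  qed
  from this[of "Suc j"] show ?case using Suc by (auto intro!: represents_mult simp del: last_shuffle.simps)
qed

lemma represents_antisym:
  assumes "n = length P + m"
  shows "represents P m (antisymmetrizer (R_op n) (Suc (length P)) (m - 1)) (antisym \<sigma> m)"
proof (cases m)
  case 0
  then show ?thesis by (simp add: represents_one)
next
  case (Suc j)
  then show ?thesis using represents_antisymmetrizer[of n P m j] assms by simp
qed

lemma wedge_single:
  "wedge \<sigma> smul (mon I a)
    = (\<Sum>K | length K = length I. mon K (smul (antisym \<sigma> (length I) I K) a))"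
  unfolding wedge_def by (subst lin_ext_single) simp_all

lemma wedge_add: "wedge \<sigma> smul (u + v) = wedge \<sigma> smul u + wedge \<sigma> smul v"
  unfolding wedge_def by (rule lin_ext_add) (simp add: scale_right_distrib single_add sum.distrib)

text \<open>Using R in place of \<sigma> only adds words with a 0, which the final
  \<open>zero_free\<close> takes away.\<close>

lemma wedge_shuffle:
  assumes "homogeneous m u"
  shows "lift (wedge \<sigma> smul u) = app (antisymmetrizer (R_op m) 1 (m - 1) * zero_free) (lift u)"
proof (rule homogeneous_eqI[where n = m and u = u and f = "\<lambda>u. lift (wedge \<sigma> smul u)"
      and g = "\<lambda>u. app (antisymmetrizer (R_op m) 1 (m - 1) * zero_free) (lift u)"])
  fix I :: "'n list" and a :: 'u
  assume I: "length I = m"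
  have "represents [] m (antisymmetrizer (R_op m) 1 (m - 1)) (antisym \<sigma> m)"
    using represents_antisym[of m "[]" m] by simp
  then show "lift (wedge \<sigma> smul (mon I a))
      = app (antisymmetrizer (R_op m) 1 (m - 1) * zero_free) (lift (mon I a))"
    using I unfolding represents_def by (simp add: wedge_single lift_sum acts_def del: app_simps(6))
qed (use assms in \<open>simp_all add: wedge_add lift_add app_add\<close>)

lemma homogeneous_fold_omega_act:
  "homogeneous (length js + n) w \<Longrightarrow> homogeneous n (fold (omega_act \<sigma> smul) js w)"
  by (induction js arbitrary: w) auto

lemma fold_omega_act_zero [simp]: "fold (omega_act \<sigma> smul) js 0 = 0"
proof -
  have "omega_act \<sigma> smul j 0 = 0" for j by (rule additive_zero) (rule omega_act_add)
  then show ?thesis by (induction js) simp_all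
qed

lemma fold_omega_act_eq_0:
  "homogeneous n w \<Longrightarrow> n < length js \<Longrightarrow> fold (omega_act \<sigma> smul) js w = 0"
proof (induction js arbitrary: n w)
  case (Cons j js)
  show ?case
  proof (cases n)
    case 0
    then show ?thesis using Cons.prems by (simp add: omega_act_homogeneous_0)
  next
    case (Suc m)
    then show ?thesis using Cons by (auto intro: homogeneous_omega_act)
  qed
qed simp

text \<open>J is read backwards since the \<Omega> that acts first belongs to the last letter, where
  the first factor of \<open>iterated_shuffle\<close> puts it. A later \<Omega> contributes a
  shuffle that leaves the letters already at the end alone.\<close>

lemma iterated_omega_shuffle:
  assumes "homogeneous n w" "m \<le> n"
  shows "(\<Sum>J | length J = m. app (append_op (map Some J)) (lift (fold (omega_act \<sigma> smul) (rev J) w)))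
    = app (iterated_shuffle (S_op n) 1 (n - 1) m * zero_free) (lift w)"
  using assms(2)
proof (induction m)
  case 0
  have "lift w = app (append_op []) (lift w)"
    using lift_fold_gamma_act[of "[]" w] by simp
  then show ?case by simp
next
  case (Suc m)
  define N where "N = n - 1 - m"
  have N: "n - m = Suc N" "n = m + Suc N" using Suc.prems by (simp_all add: N_def)
  let ?u = "\<lambda>J. fold (omega_act \<sigma> smul) (rev J) w"
  let ?L = "last_shuffle (S_op n) 1 N * zero_free"
  have u: "homogeneous (Suc N) (?u J)" if "length J = m" for J
    using that assms(1) N by (intro homogeneous_fold_omega_act) simp
  have inner: "app (append_op (map Some J)) (\<Sum>j\<in>UNIV. app (append_op [Some j]) (lift (omega_act \<sigma> smul j (?u J))))
      = app ?L (app (append_op (map Some J)) (lift (?u J)))" if J: "length J = m" for J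
  proof -
    define v where "v = (\<Sum>j\<in>UNIV. gamma_act j (omega_act \<sigma> smul j (?u J)))"
    have v: "homogeneous (Suc N) v"
      unfolding v_def by (intro homogeneous_sum homogeneous_gamma_act homogeneous_omega_act u J)
    have lift_v: "lift v = (\<Sum>j\<in>UNIV. app (append_op [Some j]) (lift (omega_act \<sigma> smul j (?u J))))"
      by (simp add: v_def lift_sum lift_gamma_act)
    have suf: "last_shuffle (S_op (Suc N)) 1 N * suffix_op (Suc N) (map Some J)
        = suffix_op (Suc N) (map Some J) * last_shuffle (S_op n) 1 N"
      by (rule last_shuffle_intertwine) (use J N in \<open>auto intro!: factor_op_suffix_op\<close>)
    have zf: "suffix_op (Suc N) (map Some J) * zero_free = (zero_free * suffix_op (Suc N) (map Some J) :: ('n option list, 'u) endo)"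
      by (rule zero_free_suffix_op) auto
    have "last_shuffle (S_op (Suc N)) 1 N * zero_free * suffix_op (Suc N) (map Some J)
        = last_shuffle (S_op (Suc N)) 1 N * suffix_op (Suc N) (map Some J) * zero_free"
      by (simp only: mult.assoc zf)
    also have "\<dots> = suffix_op (Suc N) (map Some J) * ?L" by (simp only: suf mult.assoc)
    finally have *: "app (last_shuffle (S_op (Suc N)) 1 N * zero_free * suffix_op (Suc N) (map Some J)) (lift (?u J))
        = app (suffix_op (Suc N) (map Some J) * ?L) (lift (?u J))" by simp
    have "app (append_op (map Some J)) (lift v) = app (suffix_op (Suc N) (map Some J)) (lift v)"
      using suffix_op_lift[OF v] by simp
    also have "\<dots> = app (last_shuffle (S_op (Suc N)) 1 N * zero_free * suffix_op (Suc N) (map Some J)) (lift (?u J))"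
      unfolding lift_v omega_shuffle[OF u[OF J]] by simp
    also have "\<dots> = app ?L (app (append_op (map Some J)) (lift (?u J)))"
      unfolding * using suffix_op_lift[OF u[OF J]] by simp
    finally show ?thesis by (simp add: lift_v)
  qed
  have "(\<Sum>J | length J = Suc m. app (append_op (map Some J)) (lift (?u J)))
      = (\<Sum>J | length J = m. app (append_op (map Some J)) (\<Sum>j\<in>UNIV. app (append_op [Some j]) (lift (omega_act \<sigma> smul j (?u J)))))"
    by (simp add: sum_words_Suc app_sum app_append_op_append) (rule sum.swap)
  also have "\<dots> = app ?L (\<Sum>J | length J = m. app (append_op (map Some J)) (lift (?u J)))"
    unfolding app_sum[of ?L] by (intro sum.cong refl inner) simp
  also have "\<dots> = app (iterated_shuffle (S_op n) 1 (n - 1) m * zero_free * ?L) (lift w)"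
    using Suc by simp
  also have "iterated_shuffle (S_op n) 1 (n - 1) m * zero_free * ?L
      = iterated_shuffle (S_op n) 1 (n - 1) m * (zero_free * last_shuffle (S_op n) 1 N * zero_free)"
    by (simp only: mult.assoc)
  also have "zero_free * last_shuffle (S_op n) 1 N * zero_free = ?L"
    using preserves_zeros_S_shuffles(1)[of n 1 N] unfolding preserves_zeros_def by simp
  finally show ?case
    by (simp only: iterated_shuffle_snoc N_def mult.assoc)
qed

end

section \<open>The BRST operator\<close>

lemma twist_product_prod_list:
  "twist_product r e k = prod_list (map (\<lambda>i. 1 - last_twist r e i) [0..<k])"
  by (induction k) simp_all

definition length_op :: "nat \<Rightarrow> ('w list, 'u::ring_1) endo" where
  "length_op n = lin_endo (\<lambda>I a. if length I = n then mon I a else 0)"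

lemma app_length_op [simp]:
  "app (length_op n) (mon I a) = (if length I = n then mon I a else 0)"
  unfolding length_op_def by (subst app_lin_endo_single) (simp_all add: single_add)

lemma length_op_remove_zero: "length_op n * remove_zero n q = remove_zero n q"
  by (rule endo_eqI) (simp add: app_remove_zero)

lemma length_op_zero_free: "length_op n * zero_free = zero_free * length_op n"
  by (rule endo_eqI) simp

lemma twist_product_intertwine:
  assumes "\<And>k. r k * y = y * r k"
  shows "twist_product r e k * y = y * twist_product r e k"
  unfolding twist_product_prod_list
proof (rule prod_list_intertwine)
  fix i
  have "ascending r (e - 1 - i) e * y = y * ascending r (e - 1 - i) e"
    unfolding ascending_def by (rule prod_list_intertwine) (rule assms)
  then have "ascending r (e - 1 - i) e * (r (e - 1) * y) = y * (ascending r (e - 1 - i) e * r (e - 1))"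
    by (simp only: assms mult.assoc[symmetric])
  then have "last_twist r e i * y = y * last_twist r e i"
    unfolding last_twist_def by (cases "even i") (simp_all add: mult.assoc)
  then show "(1 - last_twist r e i) * y = y * (1 - last_twist r e i)"
    by (simp add: left_diff_distrib right_diff_distrib)
qed

lemma homogeneous_fold_gamma_act:
  "homogeneous n u \<Longrightarrow> homogeneous (n + length I) (fold gamma_act I u)"
proof (induction I arbitrary: n u)
  case (Cons i I)
  from Cons.IH[OF homogeneous_gamma_act[OF Cons.prems]] show ?case by simp
qed simp

lemma (in algebra_over_field) factor_op_length_op:
  fixes M :: "'a^('c \<times> 'c)^('c::finite \<times> 'c)"
  shows "factor_op n k M * length_op m = length_op m * factor_op n k M"
  by (rule endo_eqI) (simp add: app_factor_op app_sum cong: if_cong)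

context quantum_lie_algebra
begin

lemma preserves_zeros_unshuffles [intro]: "preserves_zeros (unshuffles (R_op n) p d m)"
  by (induction d arbitrary: p) (auto simp del: first_unshuffle.simps)

text \<open>The middle of a term of Q: the r + 1 indices taken out by the \<Omega>'s stand at the
  end of the word and are exchanged for the r indices of the \<gamma>'s. \<open>X r\<close> has no
  components with index 0, hence the value 0 on words containing it.\<close>

definition insert_op :: "nat \<Rightarrow> nat \<Rightarrow> ('n, 'a) word_matrix \<Rightarrow> ('n option list, 'u) endo" where
  "insert_op n r M = lin_endo (\<lambda>L a. if length L = n \<and> None \<notin> set L
     then \<Sum>I | length I = r. mon (take (n - Suc r) L @ map Some I)
            (smul (M (map the (drop (n - Suc r) L)) I) a)
     else 0)"

lemma app_insert_op:
  "app (insert_op n r M) (mon L a) = (if length L = n \<and> None \<notin> set L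
     then \<Sum>I | length I = r. mon (take (n - Suc r) L @ map Some I)
            (smul (M (map the (drop (n - Suc r) L)) I) a)
     else 0)"
  unfolding insert_op_def
  by (subst app_lin_endo_single) (auto simp: single_add scale_right_distrib sum.distrib)

lemma acts_insert_op:
  assumes "n = length P + Suc r"
  shows "acts (\<lambda>I. map Some (P @ I)) (Suc r) r (insert_op n r M) M"
  unfolding acts_def using assms by (auto simp: app_insert_op comp_def)

lemma length_op_insert_op: "length_op n * insert_op n r M = insert_op n r M"
  by (rule endo_eqI) (simp add: app_insert_op)

lemma insert_op_append_op:
  assumes "homogeneous N u" "length J = Suc r" "n = N + Suc r"
  shows "app (insert_op n r M) (app (append_op (map Some J)) (lift u))
    = (\<Sum>I | length I = r. app (append_op (map Some I)) (app (smul_op (M J I)) (lift u)))"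
proof (rule homogeneous_eqI[where n = N and u = u
      and f = "\<lambda>u. app (insert_op n r M) (app (append_op (map Some J)) (lift u))"
      and g = "\<lambda>u. \<Sum>I | length I = r. app (append_op (map Some I)) (app (smul_op (M J I)) (lift u))"])
  fix P :: "'n list" and a :: 'u
  assume "length P = N"
  then show "app (insert_op n r M) (app (append_op (map Some J)) (lift (mon P a)))
    = (\<Sum>I | length I = r. app (append_op (map Some I)) (app (smul_op (M J I)) (lift (mon P a))))"
    using actsD[OF acts_insert_op[of n P r M], of J a] assms by simp
qed (use assms in \<open>simp_all add: lift_add app_add sum.distrib\<close>)

lemma BRST_term_shuffle:
  assumes "homogeneous n w" "r < n"
  shows "lift (BRST_term \<sigma> smul X r w)
    = app (iterated_shuffle (S_op n) 1 (n - 1) (Suc r) * zero_free * insert_op n r (X r)) (lift w)"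
proof -
  let ?u = "\<lambda>J. fold (omega_act \<sigma> smul) (rev J) w"
  have "homogeneous (n - Suc r) (?u J)" if "length J = Suc r" for J
    using that assms by (intro homogeneous_fold_omega_act) simp
  then have "app (insert_op n r (X r)) (app (append_op (map Some J)) (lift (?u J)))
      = (\<Sum>I | length I = r. app (append_op (map Some I)) (app (smul_op (X r J I)) (lift (?u J))))"
    if "length J = Suc r" for J
    using that assms by (intro insert_op_append_op) auto
  then have "lift (BRST_term \<sigma> smul X r w)
      = app (insert_op n r (X r)) (\<Sum>J | length J = Suc r. app (append_op (map Some J)) (lift (?u J)))"
    by (simp add: BRST_term_def lift_sum lift_fold_gamma_act lift_wscale app_sum)
  then show ?thesis
    using iterated_omega_shuffle[OF assms(1), of "Suc r"] assms(2) by simp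
qed

lemma homogeneous_BRST_term:
  assumes "homogeneous n w" "r < n"
  shows "homogeneous (n - 1) (BRST_term \<sigma> smul X r w)"
  unfolding BRST_term_def
proof (intro homogeneous_sum)
  fix J I :: "'n list" assume "J \<in> {J. length J = r + 1}" "I \<in> {I. length I = r}"
  then have l: "length J = Suc r" "length I = r" by auto
  have "homogeneous (n - Suc r) (fold (omega_act \<sigma> smul) (rev J) w)"
    using assms l by (intro homogeneous_fold_omega_act) simp
  from homogeneous_fold_gamma_act[OF homogeneous_wscale[OF this], of I]
  show "homogeneous (n - 1) (fold gamma_act I (wscale smul (X r J I) (fold (omega_act \<sigma> smul) (rev J) w)))"
    using assms l by simp
qed

lemma BRST_term_eq_0:
  assumes "homogeneous n w" "n \<le> r"
  shows "BRST_term \<sigma> smul X r w = 0"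
proof -
  have "fold gamma_act I (0 :: 'n list \<Rightarrow>\<^sub>0 'u) = 0" for I by (induction I) simp_all
  moreover have "fold (omega_act \<sigma> smul) (rev J) w = 0" if "length J = r + 1" for J
    using assms that by (intro fold_omega_act_eq_0) auto
  ultimately show ?thesis by (simp add: BRST_term_def)
qed

text \<open>Factor i of \<open>twist_product\<close> is the factor k = r - i of \<open>AXA\<close>.
  As it is counted from the end of the word, the prefix P only shifts the places.\<close>

lemma acts_twist_product:
  assumes "n = length P + Suc r"
  shows "acts (\<lambda>L. P @ L) (Suc r) (Suc r) (twist_product (R_op n) n r)
    (wm_prod (Suc r) (map (AXA_factor \<sigma> C r) (rev [1..<r + 1])))"
proof -
  have fac: "acts (\<lambda>L. P @ L) (Suc r) (Suc r) (R_op n (length P + k)) (on_factors k (R_matrix \<sigma> C))"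
    if "1 \<le> k" "k < Suc r" for k
    using acts_factor_op[of n P "Suc r" "[]" k "R_matrix \<sigma> C"] that assms by simp
  have "acts (\<lambda>L. P @ L) (Suc r) (Suc r) (1 - last_twist (R_op n) n i) (AXA_factor \<sigma> C r (r - i))"
    if i: "i < r" for i
  proof -
    have "n - 1 - i = length P + (r - i)" "n = length P + Suc r" "n - 1 = length P + r"
      using assms i by auto
    then have "ascending (R_op n) (n - 1 - i) n * R_op n (n - 1)
        = prod_list (map (\<lambda>k. R_op n (length P + k)) ([r - i..<r] @ [r, r]))"
      using i map_plus_upt[of "R_op n" "length P" "r - i" r]
      by (simp add: ascending_def mult.assoc)
    then have "last_twist (R_op n) n i
        = (-1) ^ i * prod_list (map (\<lambda>k. R_op n (length P + k)) ([r - i..<r] @ [r, r]))"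
      by (simp only: last_twist_def mult.assoc)
    moreover have "acts (\<lambda>L. P @ L) (Suc r) (Suc r)
        (prod_list (map (\<lambda>k. R_op n (length P + k)) ([r - i..<r] @ [r, r])))
        (wm_prod (Suc r) (map (\<lambda>k. on_factors k (R_matrix \<sigma> C)) ([r - i..<r] @ [r, r])))"
      using i by (intro acts_wm_prod fac) auto
    moreover have "r - (r - i) = i" using i by simp
    ultimately show ?thesis
      unfolding AXA_factor_def by (auto intro!: acts_diff acts_one acts_neg_one_power simp del: map_append)
  qed
  then have "acts (\<lambda>L. P @ L) (Suc r) (Suc r) (twist_product (R_op n) n r)
      (wm_prod (Suc r) (map (\<lambda>i. AXA_factor \<sigma> C r (r - i)) [0..<r]))"
    unfolding twist_product_prod_list by (intro acts_wm_prod) auto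
  moreover have "map (\<lambda>i. AXA_factor \<sigma> C r (r - i)) [0..<r] = map (AXA_factor \<sigma> C r) (rev [1..<r + 1])"
    by (rule nth_equalityI) (simp_all add: rev_nth Suc_diff_Suc del: upt_Suc)
  ultimately show ?thesis by simp
qed

text \<open>\<open>remove_zero n n\<close> selects the upper index 0 at the end of the bracket of
  \<open>AXA\<close>, and since it tolerates no other 0, the remaining upper indices run over
  nonzero letters only.\<close>

lemma twist_product_AXA:
  assumes n: "n = length P + Suc r" and J: "length J = Suc r"
  shows "app (twist_product (R_op n) n r * remove_zero n n * antisymmetrizer (R_op (n - 1)) (n - r) (r - 1) * zero_free)
      (mon (map Some (P @ J)) a)
    = (\<Sum>I | length I = r. mon (map Some (P @ I)) (smul ((-1) ^ (r + 1) * AXA \<sigma> C r J I) a))"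
proof -
  let ?A = "antisymmetrizer (R_op (n - 1)) (n - r) (r - 1)"
  define W where "W = wm_prod (Suc r) (map (AXA_factor \<sigma> C r) (rev [1..<r + 1]))"
  have rz: "app (remove_zero n n) (mon (map Some P @ L @ [x]) b)
      = (if None \<in> set L then 0 else if x = None then mon (map Some P @ L) b else 0)"
    if "length L = r" for L x and b :: 'u
    using app_remove_zero_local[of n "map Some P @ L" n "[]" x b] n that by auto
  have A: "app (?A * zero_free) (mon (map Some (P @ K)) b)
      = (\<Sum>I | length I = r. mon (map Some (P @ I)) (smul (antisym \<sigma> r K I) b))"
    if "length K = r" for K b
  proof -
    have "n - r = Suc (length P)" using n by simp
    then show ?thesis
      using represents_antisym[of "n - 1" P r] n that unfolding represents_def acts_def by simp
  qed
  have "app (twist_product (R_op n) n r) (mon (map Some (P @ J)) a)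
      = (\<Sum>L | length L = r. \<Sum>x\<in>UNIV. mon (map Some P @ L @ [x]) (smul (W (map Some J) (L @ [x])) a))"
    using actsD[OF acts_twist_product[of n "map Some P" r], of "map Some J" a] n J
    by (simp add: sum_words_snoc W_def del: upt_Suc)
  moreover have "app (remove_zero n n) (\<Sum>x\<in>UNIV. mon (map Some P @ L @ [x]) (smul (W (map Some J) (L @ [x])) a))
      = (if None \<in> set L then 0
          else mon (map Some P @ L) (smul (W (map Some J) (L @ [None])) a))"
    if "length L = r" for L
    unfolding app_sum rz[OF that] by (simp add: sum_option)
  ultimately have "app (twist_product (R_op n) n r * remove_zero n n) (mon (map Some (P @ J)) a)
      = (\<Sum>L | length L = r. if None \<in> set L then 0
          else mon (map Some P @ L) (smul (W (map Some J) (L @ [None])) a))"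
    unfolding app_simps by (simp only:) (subst app_sum, intro sum.cong refl, simp)
  also have "\<dots> = (\<Sum>K | length K = r.
      mon (map Some (P @ K)) (smul (W (map Some J) (map Some K @ [None])) a))"
    by (simp add: sum_words_Some del: upt_Suc)
  finally have "app (twist_product (R_op n) n r * remove_zero n n * (?A * zero_free)) (mon (map Some (P @ J)) a)
      = (\<Sum>K | length K = r. \<Sum>I | length I = r. mon (map Some (P @ I))
          (smul (W (map Some J) (map Some K @ [None]) * antisym \<sigma> r K I) a))"
    unfolding app_simps(6)[of _ "?A * zero_free"]
    by (simp only:) (subst app_sum, intro sum.cong refl, simp add: A mult.commute del: app_simps map_append One_nat_def)
  also have "\<dots> = (\<Sum>I | length I = r. mon (map Some (P @ I))
          (smul (\<Sum>K | length K = r. W (map Some J) (map Some K @ [None]) * antisym \<sigma> r K I) a))"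
    unfolding single_smul_sum by (rule sum.swap)
  also have "\<dots> = (\<Sum>I | length I = r. mon (map Some (P @ I)) (smul ((-1) ^ (r + 1) * AXA \<sigma> C r J I) a))"
    by (simp add: AXA_def W_def power_mult_distrib[symmetric] flip: mult.assoc power_add)
  finally show ?thesis by (simp only: mult.assoc)
qed

text \<open>The defining equation of \<open>X r\<close> as an identity of operators. It concerns
  words of length n without 0, so all other words have to be seen to give 0 on both sides.\<close>

lemma antisymmetrize_insert_op:
  assumes X: "BRST_coefficients \<sigma> C X" and r: "1 \<le> r" "r < n"
  defines "A \<equiv> antisymmetrizer (R_op (n - 1)) (n - r) (r - 1)"
  shows "zero_free * antisymmetrizer (R_op n) (n - r) r * zero_free * insert_op n r (X r) * A * zero_free
    = (-1) ^ (r + 1) * (zero_free * twist_product (R_op n) n r * remove_zero n n * A * zero_free)"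
  (is "?l = ?r")
proof (rule endo_eqI)
  fix L :: "'n option list" and a :: 'u
  let ?B = "antisymmetrizer (R_op n) (n - r) r" and ?T = "twist_product (R_op n) n r"
  have B: "?B * length_op n = length_op n * ?B"
    by (rule antisymmetrizer_intertwine) (rule factor_op_length_op)
  have T: "?T * length_op n = length_op n * ?T"
    by (rule twist_product_intertwine) (rule factor_op_length_op)
  show "app ?l (mon L a) = app ?r (mon L a)"
  proof (cases "length L = n \<and> None \<notin> set L")
    case True
    define I where "I = map the L"
    have "map Some I = L" unfolding I_def map_map
      using True by (intro map_idI) (metis comp_apply option.collapse)
    define P J where "P = take (n - Suc r) I" and "J = drop (n - Suc r) I"
    have PJ: "L = map Some (P @ J)" using \<open>map Some I = L\<close> by (simp add: P_def J_def)
    have l: "length J = Suc r" "n = length P + Suc r" using True r by (auto simp: P_def J_def I_def)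
    have nr: "n - r = Suc (length P)" using l by simp
    have "acts (\<lambda>I. map Some (P @ I)) (Suc r) r (?B * zero_free * insert_op n r (X r) * (A * zero_free))
        (wm_mult r (wm_mult (Suc r) (antisym \<sigma> (Suc r)) (X r)) (antisym \<sigma> r))"
      using represents_antisym[of n P "Suc r"] represents_antisym[of "n - 1" P r] l r
      unfolding A_def nr represents_def by (intro acts_mult acts_insert_op) auto
    moreover have "wm_mult r (wm_mult (Suc r) (antisym \<sigma> (Suc r)) (X r)) (antisym \<sigma> r) = AXA \<sigma> C r"
      using X r by (auto simp: BRST_coefficients_def)
    ultimately have "app (?B * zero_free * insert_op n r (X r) * (A * zero_free)) (mon L a)
        = (\<Sum>I | length I = r. mon (map Some (P @ I)) (smul (AXA \<sigma> C r J I) a))"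
      using l unfolding PJ acts_def by auto
    moreover have "app (?T * remove_zero n n * A * zero_free) (mon L a)
        = (\<Sum>I | length I = r. mon (map Some (P @ I)) (smul ((-1) ^ (r + 1) * AXA \<sigma> C r J I) a))"
      unfolding PJ A_def by (rule twist_product_AXA[OF l(2,1)])
    ultimately show ?thesis
      using True by (cases "even r") (simp_all add: mult.assoc single_uminus scale_minus_left sum_negf app_uminus)
  next
    case False
    \<comment> \<open>\<open>length_op n\<close> is extracted on the left of both sides, next to
      \<open>zero_free\<close>; together they annihilate the words of this case.\<close>
    have l: "?l = length_op n * ?l"
    proof -
      have "length_op n * ?l = zero_free * (length_op n * ?B) * zero_free * insert_op n r (X r) * A * zero_free"
        by (simp only: mult.assoc[symmetric] length_op_zero_free)
      also have "\<dots> = zero_free * ?B * (length_op n * zero_free) * insert_op n r (X r) * A * zero_free"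
        by (simp only: mult.assoc B[symmetric])
      also have "\<dots> = zero_free * ?B * zero_free * (length_op n * insert_op n r (X r)) * A * zero_free"
        by (simp only: mult.assoc length_op_zero_free)
      finally show ?thesis by (simp only: length_op_insert_op)
    qed
    have rr: "zero_free * ?T * remove_zero n n * A * zero_free = length_op n * (zero_free * ?T * remove_zero n n * A * zero_free)"
    proof -
      have "length_op n * (zero_free * ?T * remove_zero n n * A * zero_free)
          = zero_free * (length_op n * ?T) * remove_zero n n * A * zero_free"
        by (simp only: mult.assoc[symmetric] length_op_zero_free)
      also have "\<dots> = zero_free * ?T * (length_op n * remove_zero n n) * A * zero_free"
        by (simp only: mult.assoc T[symmetric])
      finally show ?thesis by (simp only: length_op_remove_zero)
    qed
    have "app ?l (mon L a) = app (length_op n * ?l) (mon L a)"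
      using l by simp
    also have "\<dots> = 0" using False by (auto simp: mult.assoc)
    also have "0 = app ((-1) ^ (r + 1) * (length_op n * (zero_free * ?T * remove_zero n n * A * zero_free))) (mon L a)"
      using False unfolding app_neg_one_power by (auto simp: mult.assoc)
    finally show ?thesis using rr by simp
  qed
qed

lemma to_end_1: "1 \<le> n \<Longrightarrow> to_end (S_op n) 1 (n - 1) (Suc 0) = last_shuffle (S_op n) 1 (n - 1)"
proof -
  assume "1 \<le> n"
  interpret invertible_braid "R_op n" "S_op n" 1 n by (rule invertible_braid_R_op)
  show ?thesis using iterated_shuffle_to_end[of 1 "n - 1" 0] \<open>1 \<le> n\<close> by simp
qed

text \<open>The result does not contain X: after \<open>wedge\<close> a term of Q depends on
  \<open>AXA\<close> alone.\<close>

lemma wedge_BRST_term: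
  assumes X: "BRST_coefficients \<sigma> C X" and r: "1 \<le> r" "r < n" and w: "homogeneous n w"
  shows "lift (wedge \<sigma> smul (BRST_term \<sigma> smul X r w))
    = app ((-1) ^ (r + 1) * (to_end (S_op n) 1 (n - 1) (Suc r) * twist_product (R_op n) n r
        * remove_zero n n * antisymmetrizer (R_op (n - 1)) 1 (n - 2) * zero_free)) (lift w)"
proof -
  interpret n: invertible_braid "R_op n" "S_op n" 1 n by (rule invertible_braid_R_op)
  interpret n': invertible_braid "R_op (n - 1)" "S_op (n - 1)" 1 "n - 1" by (rule invertible_braid_R_op)
  let ?I = "iterated_shuffle (S_op n) 1 (n - 1) (Suc r)" and ?N = "to_end (S_op n) 1 (n - 1) (Suc r)"
  let ?B = "antisymmetrizer (R_op n) (n - r) r" and ?T = "twist_product (R_op n) n r"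
  let ?A = "antisymmetrizer (R_op (n - 1)) (n - r) (r - 1)"
  let ?U = "unshuffles (R_op (n - 1)) 1 (n - 1 - r) (r - 1)"
  let ?ins = "insert_op n r (X r)" and ?\<rho> = "remove_zero n n"
  have I: "?I = ?N * ?B"
    using n.iterated_shuffle_to_end[of 1 "n - 1" r] r by simp
  have A: "antisymmetrizer (R_op (n - 1)) 1 (n - 2) = ?A * ?U"
  proof -
    have "n - 2 = (n - 1 - r) + (r - 1)" "n - r = 1 + (n - 1 - r)" using r by auto
    then show ?thesis using n'.antisymmetrizer_unshuffles[of 1 "n - 1 - r" "r - 1"] by simp
  qed
  have B: "?B * zero_free = zero_free * ?B * zero_free"
    using preserves_zeros_R_shuffles(2)[of n "n - r" r] by (simp add: preserves_zeros_def)
  have U: "?U * zero_free = zero_free * ?U * zero_free"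
    using preserves_zeros_unshuffles[of "n - 1" 1 "n - 1 - r" "r - 1"] by (simp add: preserves_zeros_def)
  obtain y where "?T * ?\<rho> = zero_free * y" using twist_product_remove_last[of r n] r by blast
  \<comment> \<open>This removes the \<open>zero_free\<close> that
    \<open>antisymmetrize_insert_op\<close> leaves in front of the twist product. Without it the
    terms have the shape summed in \<open>sum_to_end_twist_product\<close>.\<close>
  then have T: "zero_free * ?T * ?\<rho> = ?T * ?\<rho>"
    by (metis mult.assoc zero_free_idem)
  have "?I * zero_free * ?ins * (antisymmetrizer (R_op (n - 1)) 1 (n - 2) * zero_free)
      = ?N * (?B * zero_free) * ?ins * ?A * (?U * zero_free)"
    unfolding I A by (simp only: mult.assoc)
  also have "\<dots> = ?N * (zero_free * ?B * zero_free) * ?ins * ?A * (zero_free * ?U * zero_free)"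
    by (simp only: B[symmetric] U[symmetric])
  also have "\<dots> = ?N * (zero_free * ?B * zero_free * ?ins * ?A * zero_free) * ?U * zero_free"
    by (simp only: mult.assoc)
  also have "\<dots> = ?N * ((-1) ^ (r + 1) * (zero_free * ?T * ?\<rho> * ?A * zero_free)) * ?U * zero_free"
    by (simp only: antisymmetrize_insert_op[OF X r])
  also have "\<dots> = ?N * ((-1) ^ (r + 1) * (?T * ?\<rho>)) * ?A * (zero_free * ?U * zero_free)"
    unfolding T by (simp only: mult.assoc)
  also have "\<dots> = (-1) ^ (r + 1) * (?N * ?T * ?\<rho> * (?A * ?U) * zero_free)"
    unfolding U[symmetric] by (cases "even r") (simp_all add: mult.assoc)
  finally have *: "?I * zero_free * ?ins * (antisymmetrizer (R_op (n - 1)) 1 (n - 2) * zero_free)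
      = (-1) ^ (r + 1) * (?N * ?T * ?\<rho> * antisymmetrizer (R_op (n - 1)) 1 (n - 2) * zero_free)"
    by (simp only: A)
  have "lift (wedge \<sigma> smul (BRST_term \<sigma> smul X r w))
      = app (antisymmetrizer (R_op (n - 1)) 1 (n - 2) * zero_free) (lift (BRST_term \<sigma> smul X r w))"
    using wedge_shuffle[OF homogeneous_BRST_term[OF w r(2)]] by (simp add: numeral_2_eq_2)
  also have "\<dots> = app (?I * zero_free * ?ins * (antisymmetrizer (R_op (n - 1)) 1 (n - 2) * zero_free)) (lift w)"
    by (simp add: BRST_term_shuffle[OF w r(2)])
  finally show ?thesis unfolding * .
qed

section \<open>Truncation at the height\<close>

lemma antisym_above_height:
  assumes "\<not> enat r < height \<sigma>"
  shows "antisym \<sigma> (Suc r) = (\<lambda>_ _. 0)"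
proof -
  have "\<exists>h. is_height \<sigma> h" using assms by (auto simp: height_def split: if_splits)
  then obtain h where h: "is_height \<sigma> h" by blast
  have "h' = h" if "is_height \<sigma> h'" for h'
  proof (rule ccontr)
    assume "h' \<noteq> h"
    then consider "h < h'" | "h' < h" by linarith
    then show False using h that unfolding is_height_def by cases blast+
  qed
  then have "(THE h. is_height \<sigma> h) = h" using h by (intro the_equality)
  then have "height \<sigma> = enat h" unfolding height_def using h by (subst if_P) auto
  then have "h < Suc r" using assms by (simp only: enat_ord_simps not_less less_Suc_eq_le)
  then show ?thesis using h unfolding is_height_def by blast
qed

text \<open>Above the height the left antisymmetrizer is 0, so replacing \<open>X r\<close> by 0
  again gives admissible coefficients. As the formula in \<open>wedge_BRST_term\<close> does not
  depend on X, the term equals the one with \<open>X r\<close> = 0. Thus the sum may be extended to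
  all r < n.\<close>

lemma wedge_BRST_term_above_height:
  assumes X: "BRST_coefficients \<sigma> C X" and r: "1 \<le> r" "r < n" and w: "homogeneous n w"
    and h: "\<not> enat r < height \<sigma>"
  shows "lift (wedge \<sigma> smul (BRST_term \<sigma> smul X r w)) = 0"
proof -
  let ?Y = "X(r := \<lambda>_ _. 0)"
  have "wm_mult r (wm_mult (r + 1) (antisym \<sigma> (r + 1)) M) M' = (\<lambda>_ _. 0)" for M M'
    using antisym_above_height[OF h] by (simp add: wm_mult_def)
  then have "BRST_coefficients \<sigma> C ?Y"
    using X unfolding BRST_coefficients_def by (metis fun_upd_apply)
  from wedge_BRST_term[OF this r w] wedge_BRST_term[OF X r w]
  have "lift (wedge \<sigma> smul (BRST_term \<sigma> smul X r w)) = lift (wedge \<sigma> smul (BRST_term \<sigma> smul ?Y r w))"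
    by simp
  also have "BRST_term \<sigma> smul ?Y r w = 0"
  proof -
    have "wscale smul 0 u = (0 :: 'n list \<Rightarrow>\<^sub>0 'u)" for u :: "'n list \<Rightarrow>\<^sub>0 'u"
      by (rule additive_eqI[of "wscale smul 0" "\<lambda>_. 0"]) (simp_all add: wscale_add)
    moreover have "fold gamma_act I (0 :: 'n list \<Rightarrow>\<^sub>0 'u) = 0" for I by (induction I) simp_all
    ultimately show ?thesis by (simp add: BRST_term_def)
  qed
  finally show ?thesis using additive_zero[of "wedge \<sigma> smul"] by (simp add: wedge_add)
qed

section \<open>Assembly of Q\<close>

lemma descending_remove_first:
  assumes "1 \<le> i" "i \<le> q" "q \<le> n"
  shows "\<exists>y. descending (R_op n) i q * remove_zero n i = remove_zero n q + zero_free * y"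
  using assms
proof (induction "q - i" arbitrary: i)
  case 0
  then show ?case by (intro exI[of _ 0]) simp
next
  case (Suc d)
  then have "d = q - Suc i" "Suc i \<le> q" by simp_all
  from Suc.hyps(1)[OF this(1) _ this(2) \<open>q \<le> n\<close>] obtain y
    where y: "descending (R_op n) (Suc i) q * remove_zero n (Suc i) = remove_zero n q + zero_free * y"
    by auto
  obtain z where z: "descending (R_op n) (Suc i) q * (zero_free * bracket_op n i) = zero_free * z"
    by (rule preserves_zeros_factor[OF preserves_zeros_R_shuffles(7)])
  have "descending (R_op n) i q * remove_zero n i
      = descending (R_op n) (Suc i) q * (remove_zero n (Suc i) + zero_free * bracket_op n i)"
    using Suc R_remove_zero_left[of i n] by (simp add: descending_Cons[of i q] mult.assoc)
  also have "\<dots> = remove_zero n q + zero_free * (y + z)"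
    by (simp add: distrib_left y z)
  finally show ?case by blast
qed

text \<open>Among words with a 0 this operator sees only those whose single 0 is in the last place;
  it takes the 0 to the front and drops it. All zeros created by C on the way belong to the part of
  the form \<open>zero_free * z\<close>.\<close>

lemma descending_absorb_first:
  assumes "1 \<le> n"
  shows "zero_free * (descending (R_op n) 1 n * absorb_first n) = descending (R_op n) 1 n * absorb_first n - remove_zero n n"
proof -
  obtain y where y: "descending (R_op n) 1 n * remove_zero n 1 = remove_zero n n + zero_free * y"
    using descending_remove_first[of 1 n n] assms by auto
  obtain z where z: "descending (R_op n) 1 n * (zero_free * multiply_first n) = zero_free * z"
    by (rule preserves_zeros_factor[OF preserves_zeros_R_shuffles(7)])
  have *: "descending (R_op n) 1 n * absorb_first n = zero_free * (y + z) + remove_zero n n"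
    unfolding absorb_first_def distrib_left y z by simp
  have "zero_free * (zero_free * u) = zero_free * u" for u :: "('n option list, 'u) endo"
    by (simp flip: mult.assoc)
  then show ?thesis unfolding * by (simp add: distrib_left)
qed

text \<open>\<open>absorb_first\<close> drops the first letter, so the antisymmetrizer of the n - 1
  remaining letters becomes that of the letters 2, ..., n in front of it, ready to be completed by
  \<open>first_shuffle\<close>.\<close>

lemma antisymmetrizer_absorb_first:
  assumes "1 \<le> n"
  shows "absorb_first n * (antisymmetrizer (R_op (n - 1)) 1 m * zero_free)
    = antisymmetrizer (R_op n) 2 m * absorb_first n"
proof -
  have mz: "multiply_first n * zero_free = zero_free * multiply_first n"
    by (rule endo_eqI) (auto simp: app_multiply_first split: list.splits option.splits)
  have az: "absorb_first n * zero_free = absorb_first n"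
    unfolding absorb_first_def distrib_right mult.assoc mz
    by (simp only: remove_zero_zero_free mult.assoc[symmetric] zero_free_idem)
  have 1: "R_op n (2 + i) * absorb_first n = absorb_first n * (R_op (n - 1) (1 + i) * zero_free)" for i
  proof -
    have "R_op n (Suc (Suc i)) * (zero_free * multiply_first n)
        = (R_op n (Suc (Suc i)) * zero_free) * multiply_first n" by (simp only: mult.assoc)
    also have "\<dots> = zero_free * R_op n (Suc (Suc i)) * zero_free * multiply_first n"
      using preserves_zeros_R_op[of n "Suc (Suc i)"] by (simp only: preserves_zeros_def)
    also have "\<dots> = zero_free * (R_op n (Suc (Suc i)) * multiply_first n) * zero_free"
      by (simp only: mult.assoc mz[symmetric])
    also have "\<dots> = zero_free * multiply_first n * (R_op (n - 1) (Suc i) * zero_free)"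
      using R_multiply_first[of "Suc i" n] by (simp add: mult.assoc)
    finally show ?thesis
      using R_remove_zero_first[of "Suc i" n]
      by (simp add: absorb_first_def distrib_left distrib_right mult.assoc)
  qed
  have 2: "antisymmetrizer (R_op (n - 1)) 1 m * zero_free
      = zero_free * antisymmetrizer (\<lambda>k. R_op (n - 1) k * zero_free) 1 m"
    using preserves_zeros_R_op[of "n - 1"]
    by (intro antisymmetrizer_intertwine) (simp add: preserves_zeros_def mult.assoc)
  have "antisymmetrizer (R_op n) 2 m * absorb_first n
      = absorb_first n * antisymmetrizer (\<lambda>k. R_op (n - 1) k * zero_free) 1 m"
    by (rule antisymmetrizer_intertwine) (rule 1)
  also have "\<dots> = (absorb_first n * zero_free) * antisymmetrizer (\<lambda>k. R_op (n - 1) k * zero_free) 1 m"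
    by (simp only: az)
  also have "\<dots> = absorb_first n * (antisymmetrizer (R_op (n - 1)) 1 m * zero_free)"
    by (simp only: mult.assoc 2)
  finally show ?thesis by simp
qed

lemma BRST_operator_identity:
  assumes n: "1 \<le> n"
  defines "A \<equiv> antisymmetrizer (R_op (n - 1)) 1 (n - 2) * zero_free"
  shows "zero_free * (last_shuffle (S_op n) 1 (n - 1) * zero_free * descending (R_op n) 1 n * absorb_first n * A
      + (\<Sum>r = 1..<n. (-1) ^ (r + 1) * (to_end (S_op n) 1 (n - 1) (Suc r) * twist_product (R_op n) n r
        * remove_zero n n * A)))
    = zero_free * ((-1) ^ (n - 1) * (antisymmetrizer (R_op n) 1 (n - 1) * absorb_first n))"
proof -
  interpret invertible_braid "R_op n" "S_op n" 1 n by (rule invertible_braid_R_op)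
  let ?L = "last_shuffle (S_op n) 1 (n - 1)" and ?D = "descending (R_op n) 1 n"
  let ?N = "to_end (S_op n) 1 (n - 1)" and ?T = "twist_product (R_op n) n" and ?\<rho> = "remove_zero n n"
  have "(\<Sum>k\<le>n - 1. (-1) ^ k * ?N (Suc k) * ?T k) = last_shuffle (R_op n) 1 (n - 1)"
    using sum_to_end_twist_product[of 1 "n - 1"] n by simp
  moreover have "{..n - 1} = insert 0 {1..<n}" using n by auto
  ultimately have "last_shuffle (R_op n) 1 (n - 1) = ?L + (\<Sum>r = 1..<n. (-1) ^ r * ?N (Suc r) * ?T r)"
    using to_end_1[OF n] by simp
  then have "zero_free * ?L * ?\<rho> + zero_free * (\<Sum>r = 1..<n. (-1) ^ r * ?N (Suc r) * ?T r) * ?\<rho> = 0"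
    using zero_free_shuffle_remove_last[OF n] by (simp only: distrib_left distrib_right)
  \<comment> \<open>The summand k = 0 of \<open>sum_to_end_twist_product\<close> is the shuffle in
    the inverse of R, which is \<open>?L\<close>. As the total carries no 0 to the last place, the
    summands with k \<ge> 1, which come from the terms of Q, compensate it.\<close>
  then have L_rho: "zero_free * ?L * ?\<rho> = - (zero_free * (\<Sum>r = 1..<n. (-1) ^ r * ?N (Suc r) * ?T r) * ?\<rho>)"
    by (simp only: eq_neg_iff_add_eq_0)
  have "(\<Sum>r = 1..<n. (-1) ^ (r + 1) * (?N (Suc r) * ?T r * ?\<rho> * A))
      = - ((\<Sum>r = 1..<n. (-1) ^ r * ?N (Suc r) * ?T r) * ?\<rho> * A)"
    by (simp add: sum_distrib_right sum_negf mult.assoc)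
  then have 1: "zero_free * (\<Sum>r = 1..<n. (-1) ^ (r + 1) * (?N (Suc r) * ?T r * ?\<rho> * A))
      = zero_free * ?L * ?\<rho> * A"
    unfolding L_rho by (simp only: mult_minus_right mult_minus_left mult.assoc)
  \<comment> \<open>The \<open>zero_free\<close> between \<open>?L\<close> and \<open>?D\<close>
    reflects that no \<Omega> has index 0. Removing it costs the term with \<open>?\<rho>\<close>,
    which is exactly the sum in 1.\<close>
  have 2: "zero_free * (?L * zero_free * ?D * absorb_first n * A)
      = zero_free * ?L * (?D * absorb_first n) * A - zero_free * ?L * ?\<rho> * A"
  proof -
    have "zero_free * (?L * zero_free * ?D * absorb_first n * A)
        = zero_free * ?L * (zero_free * (?D * absorb_first n)) * A" by (simp only: mult.assoc)
    then show ?thesis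
      unfolding descending_absorb_first[OF n] by (simp only: right_diff_distrib left_diff_distrib)
  qed
  have LD: "?L * ?D = (-1) ^ (n - 1) * first_shuffle (R_op n) 1 (n - 1)"
    using shuffle_to_first_shuffle[of 1 "n - 1"] n by simp
  have gA: "first_shuffle (R_op n) 1 (n - 1) * antisymmetrizer (R_op n) 2 (n - 2) = antisymmetrizer (R_op n) 1 (n - 1)"
  proof (cases "n = 1")
    case False
    then have "n - 1 = Suc (n - 2)" using n by simp
    then show ?thesis using antisymmetrizer_first_shuffle[of 1 "n - 2"] by (simp add: numeral_2_eq_2)
  qed simp
  have "?L * (?D * absorb_first n) * A = (?L * ?D) * (absorb_first n * A)" by (simp only: mult.assoc)
  also have "\<dots> = (-1) ^ (n - 1) * (first_shuffle (R_op n) 1 (n - 1) * antisymmetrizer (R_op n) 2 (n - 2)) * absorb_first n"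
    unfolding LD A_def antisymmetrizer_absorb_first[OF n] by (simp only: mult.assoc)
  finally have 3: "?L * (?D * absorb_first n) * A = (-1) ^ (n - 1) * (antisymmetrizer (R_op n) 1 (n - 1) * absorb_first n)"
    unfolding gA by (simp only: mult.assoc)
  have "zero_free * ?L * (?D * absorb_first n) * A = zero_free * (?L * (?D * absorb_first n) * A)"
    by (simp only: mult.assoc)
  then show ?thesis unfolding distrib_left 1 2 3 by (simp only: diff_add_cancel)
qed

lemma BRST_coeff_homogeneous:
  assumes "homogeneous n w"
  shows "BRST_coeff \<sigma> C smul gen X w = (\<Sum>i\<in>UNIV. chi_act \<sigma> C smul gen i (omega_act \<sigma> smul i w))
    + (\<Sum>r = 1..<n. if enat r < height \<sigma> then BRST_term \<sigma> smul X r w else 0)"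
proof -
  let ?f = "\<lambda>r. if 1 \<le> r \<and> enat r < height \<sigma> then BRST_term \<sigma> smul X r w else 0"
  have "Sum_any ?f = sum ?f {1..<n}"
    using BRST_term_eq_0[OF assms]
    by (intro Sum_any.expand_superset) (auto split: if_splits, meson not_le)
  also have "\<dots> = (\<Sum>r = 1..<n. if enat r < height \<sigma> then BRST_term \<sigma> smul X r w else 0)"
    by (intro sum.cong) auto
  finally show ?thesis unfolding BRST_coeff_def by simp
qed

lemma wedge_sum: "wedge \<sigma> smul (sum f A) = (\<Sum>i\<in>A. wedge \<sigma> smul (f i))"
  by (rule additive_sum) (rule wedge_add)

lemma wedge_zero [simp]: "wedge \<sigma> smul 0 = 0"
  by (rule additive_zero) (rule wedge_add)

lemma BRST_shuffle:
  assumes X: "BRST_coefficients \<sigma> C X" and n: "1 \<le> n" and w: "homogeneous n w"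
  shows "lift (wedge \<sigma> smul (BRST_coeff \<sigma> C smul gen X w))
    = app ((-1) ^ (n - 1) * (antisymmetrizer (R_op n) 1 (n - 1) * absorb_first n)) (lift w)"
proof -
  define A where "A = antisymmetrizer (R_op (n - 1)) 1 (n - 2) * zero_free"
  let ?L = "last_shuffle (S_op n) 1 (n - 1)" and ?D = "descending (R_op n) 1 n"
  let ?c = "\<Sum>i\<in>UNIV. chi_act \<sigma> C smul gen i (omega_act \<sigma> smul i w)"
  have n1: "Suc (n - 1) = n" using n by simp
  have om: "homogeneous (n - 1) (omega_act \<sigma> smul i w)" for i
    using w n1 by (intro homogeneous_omega_act) simp
  have "lift ?c = app (?D * absorb_first n) (\<Sum>i\<in>UNIV. app (append_op [Some i]) (lift (omega_act \<sigma> smul i w)))"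
    using chi_shuffle[OF om] by (simp add: lift_sum app_sum n1 del: One_nat_def)
  also have "\<dots> = app (?L * zero_free * ?D * absorb_first n) (lift w)"
    using omega_shuffle[of "n - 1" w] w by (simp add: n1 del: One_nat_def)
  finally have "lift ?c = app (?L * zero_free * ?D * absorb_first n) (lift w)" .
  moreover have "lift (wedge \<sigma> smul ?c) = app A (lift ?c)"
    using wedge_shuffle[of "n - 1" ?c] om by (auto simp: A_def numeral_2_eq_2 intro!: homogeneous_sum)
  ultimately have c: "lift (wedge \<sigma> smul ?c) = app (?L * zero_free * ?D * absorb_first n * A) (lift w)"
    by simp
  have t: "lift (wedge \<sigma> smul (if enat r < height \<sigma> then BRST_term \<sigma> smul X r w else 0))
      = app ((-1) ^ (r + 1) * (to_end (S_op n) 1 (n - 1) (Suc r) * twist_product (R_op n) n r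
        * remove_zero n n * A)) (lift w)" if "r \<in> {1..<n}" for r
    using that wedge_BRST_term[OF X _ _ w, of r] wedge_BRST_term_above_height[OF X _ _ w, of r]
    by (auto simp: A_def mult.assoc)
  have "lift (wedge \<sigma> smul (BRST_coeff \<sigma> C smul gen X w))
      = app (?L * zero_free * ?D * absorb_first n * A
        + (\<Sum>r = 1..<n. (-1) ^ (r + 1) * (to_end (S_op n) 1 (n - 1) (Suc r) * twist_product (R_op n) n r
        * remove_zero n n * A))) (lift w)"
    unfolding BRST_coeff_homogeneous[OF w] wedge_add lift_add c app_simps(3) app_sum_left
      wedge_sum[of _ "{1..<n}"] lift_sum[of _ "{1..<n}"]
    by (simp only: t cong: sum.cong)
  also have "\<dots> = app (zero_free * ((-1) ^ (n - 1) * (antisymmetrizer (R_op n) 1 (n - 1) * absorb_first n))) (lift w)"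
    unfolding BRST_operator_identity[OF n, folded A_def, symmetric] by simp
  finally show ?thesis by simp
qed

lemma BRST_coeff_degree_0:
  assumes "homogeneous 0 w"
  shows "BRST_coeff \<sigma> C smul gen X w = 0"
proof -
  have "chi_act \<sigma> C smul gen i 0 = 0" for i by (rule additive_zero) (rule chi_act_add)
  then show ?thesis unfolding BRST_coeff_homogeneous[OF assms] by (simp add: omega_act_homogeneous_0[OF assms])
qed

end

section \<open>The bar differential\<close>

text \<open>A linear map with kernel S replaces the quotient by S. It kills a basis of S and fixes
  the other vectors of a basis of the whole space that extends it.\<close>

lemma (in vector_space) subspace_is_kernel:
  assumes "subspace S"
  shows "\<exists>\<psi>. Vector_Spaces.linear scale scale \<psi> \<and> (\<forall>x. \<psi> x = 0 \<longleftrightarrow> x \<in> S)"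
proof -
  interpret vp: vector_space_pair scale scale ..
  obtain B where B: "B \<subseteq> S" "independent B" "S \<subseteq> span B"
    using maximal_independent_subset[of S] by blast
  then have S: "span B = S" using span_subspace assms by blast
  obtain B' where B': "B \<subseteq> B'" "independent B'" "UNIV \<subseteq> span B'"
    using maximal_independent_subset_extend[of B UNIV] B(2) by auto
  obtain \<psi> where \<psi>: "Vector_Spaces.linear scale scale \<psi>" "\<forall>x\<in>B'. \<psi> x = (if x \<in> B then 0 else x)"
    using vp.linear_independent_extend[OF B'(2), of "\<lambda>x. if x \<in> B then 0 else x"] by blast
  have "\<psi> b = 0" if "b \<in> B" for b using \<psi>(2) B'(1) that by auto
  then have kernel: "\<psi> x = 0" if "x \<in> S" for x
    using vp.linear_eq_0_on_span[OF \<psi>(1), of B x] S that by blast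
  have "x \<in> S" if "\<psi> x = 0" for x
  proof -
    have "B \<union> (B' - B) = B'" using B'(1) by auto
    then have "x \<in> span (B \<union> (B' - B))" using B'(3) by auto
    then obtain y z where x: "x = y + z" "y \<in> span B" "z \<in> span (B' - B)"
      unfolding span_Un by blast
    have "Vector_Spaces.linear scale scale (\<lambda>x. x)"
      by (simp add: Vector_Spaces.linear_iff vector_space_axioms)
    from vp.linear_eq_on[OF \<psi>(1) this, of z "B' - B"] have "\<psi> z = z"
      using \<psi>(2) x(3) by auto
    moreover have "\<psi> x = \<psi> y + \<psi> z" unfolding x(1) using \<psi>(1) by (simp add: Vector_Spaces.linear_iff)
    ultimately show ?thesis using kernel[of y] x S that by simp
  qed
  with kernel \<psi>(1) show ?thesis by blast
qed

lemma free_scale_single [simp]: "free_scale c (mon w d) = mon w (c * d)"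
  by (simp add: free_scale_def)

section \<open>The bar differential squares to zero\<close>

definition multiply_at :: "nat \<Rightarrow> 'u::ring_1 list \<Rightarrow> 'u list" where
  "multiply_at p as = take p as @ [as ! p * as ! (p + 1)] @ drop (p + 2) as"

lemma length_multiply_at: "p + 1 < length as \<Longrightarrow> length (multiply_at p as) = length as - 1"
  by (simp add: multiply_at_def)

lemma bar_free_single:
  "bar_free (mon as c)
    = (\<Sum>p<length as - 1. mon (multiply_at p as) ((-1) ^ (length as - 2 - p) * c))"
  unfolding bar_free_def multiply_at_def by (subst lin_ext_single) simp_all

lemma bar_free_add: "bar_free (x + y) = bar_free x + bar_free y"
  unfolding bar_free_def by (rule lin_ext_add) (simp add: distrib_left single_add sum.distrib)

lemma bar_free_sum: "bar_free (sum f A) = (\<Sum>i\<in>A. bar_free (f i))"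
  by (rule additive_sum) (rule bar_free_add)

lemma bar_free_zero [simp]: "bar_free 0 = 0"
  by (rule additive_zero) (rule bar_free_add)

lemma bar_free_minus: "bar_free (x - y) = bar_free x - bar_free y"
  using bar_free_add[of "x - y" y] by (simp add: algebra_simps)

text \<open>The simplicial identity of the bar construction. Associativity enters only for p = q,
  where the two products overlap.\<close>

lemma multiply_at_twice:
  assumes "p \<le> q" "q + 2 < length as"
  shows "multiply_at q (multiply_at p as) = multiply_at p (multiply_at (Suc q) as)"
proof (rule nth_equalityI)
  show "length (multiply_at q (multiply_at p as)) = length (multiply_at p (multiply_at (Suc q) as))"
    using assms by (simp add: length_multiply_at)
  fix i assume "i < length (multiply_at q (multiply_at p as))"
  then have i: "i < length as - 2" using assms by (simp add: length_multiply_at)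
  have nth: "multiply_at k bs ! j = (if j < k then bs ! j else if j = k then bs ! k * bs ! (k + 1) else bs ! Suc j)"
    if "k + 1 < length bs" "j < length bs - 1" for k j and bs :: "'a list"
    using that by (auto simp: multiply_at_def nth_append)
  show "multiply_at q (multiply_at p as) ! i = multiply_at p (multiply_at (Suc q) as) ! i"
    using assms i by (auto simp: nth length_multiply_at mult.assoc)
qed

text \<open>The pair (p, q) with p \<le> q cancels against (q + 1, p), and these pairs exhaust the
  rectangle.\<close>

lemma alternating_double_sum:
  fixes T :: "nat \<Rightarrow> nat \<Rightarrow> 'v::ab_group_add"
  assumes "\<And>p q. p \<le> q \<Longrightarrow> q < m \<Longrightarrow> T (Suc q) p = - T p q"
  shows "(\<Sum>p<Suc m. \<Sum>q<m. T p q) = 0"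
  using assms
proof (induction m)
  case (Suc m)
  have "(\<Sum>p<Suc (Suc m). \<Sum>q<Suc m. T p q)
      = (\<Sum>p<Suc m. \<Sum>q<m. T p q) + (\<Sum>p<Suc m. T p m) + (\<Sum>q<Suc m. T (Suc m) q)"
    by (simp add: sum.distrib)
  also have "(\<Sum>q<Suc m. T (Suc m) q) = (\<Sum>q<Suc m. - T q m)"
    using Suc.prems by (intro sum.cong) auto
  also have "\<dots> = - (\<Sum>p<Suc m. T p m)" by (rule sum_negf)
  also have "(\<Sum>p<Suc m. \<Sum>q<m. T p q) = 0" using Suc by simp
  finally show ?case by (simp only: add_0_left add.right_inverse)
qed simp

lemma bar_free_bar_free: "bar_free (bar_free x) = 0"
proof (rule additive_eqI[of "\<lambda>x. bar_free (bar_free x)" "\<lambda>_. 0"])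
  fix as :: "'a list" and c :: 'b
  define T where "T p q = mon (multiply_at q (multiply_at p as))
      ((-1) ^ (length as - 3 - q) * ((-1) ^ (length as - 2 - p) * c))" for p q
  show "bar_free (bar_free (mon as c)) = 0"
  proof (cases "length as < 2")
    case True
    then show ?thesis by (simp add: bar_free_single)
  next
    case False
    then obtain m where m: "length as = Suc (Suc m)" by (metis add_2_eq_Suc le_Suc_ex not_less)
    have "bar_free (bar_free (mon as c)) = (\<Sum>p<Suc m. \<Sum>q<m. T p q)"
      unfolding bar_free_single[of as] bar_free_sum using m
      by (intro sum.cong) (auto simp: bar_free_single T_def length_multiply_at numeral_3_eq_3)
    also have "\<dots> = 0"
    proof (rule alternating_double_sum)
      fix p q assume pq: "p \<le> q" "q < m"
      have "m - p = Suc (m - Suc p)" "m - q = Suc (m - Suc q)" using pq by auto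
      then show "T (Suc q) p = - T p q"
        using multiply_at_twice[of p q as] pq m
        by (simp add: T_def numeral_3_eq_3 single_uminus[symmetric] mult.left_commute mult.commute)
    qed
    finally show ?thesis .
  qed
qed (simp_all add: bar_free_add)

lemma bar_free_scale: "bar_free (free_scale c x) = free_scale c (bar_free x)"
  by (rule additive_eqI[of "\<lambda>x. bar_free (free_scale c x)"])
    (simp_all add: bar_free_add free.scale_right_distrib bar_free_single free.scale_sum_right mult.left_commute)

section \<open>Tensor powers and multilinearity\<close>

context algebra_over_field
begin

text \<open>With a linear map that vanishes exactly on the multilinear relations, equality of cosets
  becomes equality of values, and calculations stay in one vector space.\<close>

definition tensor_proj :: "('u list \<Rightarrow>\<^sub>0 'a) \<Rightarrow> ('u list \<Rightarrow>\<^sub>0 'a)" where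
  "tensor_proj = (SOME \<psi>. Vector_Spaces.linear free_scale free_scale \<psi>
     \<and> (\<forall>x. \<psi> x = 0 \<longleftrightarrow> x \<in> multilinear_relations smul))"

lemma linear_tensor_proj: "Vector_Spaces.linear free_scale free_scale tensor_proj"
  and tensor_proj_eq_0: "tensor_proj x = 0 \<longleftrightarrow> x \<in> multilinear_relations smul"
proof -
  have "free.subspace (multilinear_relations smul)"
    unfolding multilinear_relations_def by (rule free.subspace_span)
  from someI_ex[OF free.subspace_is_kernel[OF this], folded tensor_proj_def]
  show "Vector_Spaces.linear free_scale free_scale tensor_proj"
    "tensor_proj x = 0 \<longleftrightarrow> x \<in> multilinear_relations smul" by blast+
qed

lemma tensor_proj_add: "tensor_proj (x + y) = tensor_proj x + tensor_proj y"
  and tensor_proj_scale: "tensor_proj (free_scale c x) = free_scale c (tensor_proj x)"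
  using linear_tensor_proj unfolding Vector_Spaces.linear_iff by blast+

lemma tensor_proj_sum: "tensor_proj (sum f A) = (\<Sum>i\<in>A. tensor_proj (f i))"
  by (rule additive_sum) (rule tensor_proj_add)

lemma tensor_proj_minus: "tensor_proj (x - y) = tensor_proj x - tensor_proj y"
  using tensor_proj_add[of "x - y" y] by (simp add: algebra_simps)

lemma tensor_proj_zero [simp]: "tensor_proj 0 = 0"
  by (rule additive_zero) (rule tensor_proj_add)

lemma tensor_class_eq_iff: "tensor_class smul x = tensor_class smul y \<longleftrightarrow> tensor_proj x = tensor_proj y"
proof -
  have mem: "z \<in> tensor_class smul x \<longleftrightarrow> tensor_proj z = tensor_proj x" for z x
    unfolding tensor_class_def mem_Collect_eq tensor_proj_eq_0[symmetric] tensor_proj_minus by simp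
  then show ?thesis by (auto simp: set_eq_iff)
qed

lemma tensor_proj_entry_add:
  "tensor_proj (mon (xs @ [a + b] @ ys) 1)
    = tensor_proj (mon (xs @ [a] @ ys) 1) + tensor_proj (mon (xs @ [b] @ ys) 1)"
proof -
  have "mon (xs @ [a + b] @ ys) 1 - mon (xs @ [a] @ ys) 1
         - mon (xs @ [b] @ ys) 1 \<in> multilinear_relations smul"
    unfolding multilinear_relations_def by (rule free.span_base) blast
  from this[folded tensor_proj_eq_0, unfolded tensor_proj_minus] show ?thesis
    by (simp only: diff_diff_eq right_minus_eq)
qed

lemma tensor_proj_single: "tensor_proj (mon w c) = free_scale c (tensor_proj (mon w 1))"
  using tensor_proj_scale[of c "mon w 1"] by simp

lemma tensor_proj_entry_smul:
  "tensor_proj (mon (xs @ [smul c a] @ ys) 1)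
    = free_scale c (tensor_proj (mon (xs @ [a] @ ys) 1))"
proof -
  have "mon (xs @ [smul c a] @ ys) 1 - mon (xs @ [a] @ ys) c
      \<in> multilinear_relations smul"
    unfolding multilinear_relations_def by (rule free.span_base) blast
  from this[folded tensor_proj_eq_0] show ?thesis
    by (simp add: tensor_proj_minus tensor_proj_single[of _ c])
qed

text \<open>Seen as a function of one entry, a product of neighbours leaves it alone or multiplies
  it from one side, and so is linear in it. Hence \<open>bar_free\<close> maps the multilinear
  relations to relations.\<close>

lemma multiply_at_entry:
  assumes "p < length xs + length ys"
  shows "\<exists>xs' ys' L. (\<forall>a. multiply_at p (xs @ [a] @ ys) = xs' @ [L a] @ ys')
    \<and> (\<forall>a b. L (a + b) = L a + L b) \<and> (\<forall>c a. L (smul c a) = smul c (L a))"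
proof -
  consider "p + 1 < length xs" | "p + 1 = length xs" | "p = length xs" | "length xs < p" by linarith
  then show ?thesis
  proof cases
    case 1
    show ?thesis
      by (rule exI[of _ "multiply_at p xs"], rule exI[of _ ys], rule exI[of _ "\<lambda>a. a"]) (use 1 in \<open>auto simp: multiply_at_def nth_append\<close>)
  next
    case 2
    show ?thesis
      by (rule exI[of _ "take p xs"], rule exI[of _ ys], rule exI[of _ "\<lambda>a. xs ! p * a"])
        (use 2 in \<open>auto simp: multiply_at_def nth_append distrib_left smul_mult_right\<close>)
  next
    case 3
    then obtain y zs where "ys = y # zs" using assms by (cases ys) auto
    then show ?thesis
      by (intro exI[of _ xs] exI[of _ zs] exI[of _ "\<lambda>a. a * y"])
        (use 3 in \<open>auto simp: multiply_at_def nth_append distrib_right smul_mult_left\<close>)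
  next
    case 4
    then obtain q where q: "p = Suc (length xs + q)" by (metis less_imp_Suc_add)
    show ?thesis
      by (rule exI[of _ xs], rule exI[of _ "multiply_at q ys"], rule exI[of _ "\<lambda>a. a"])
        (use q in \<open>auto simp: multiply_at_def nth_append numeral_3_eq_3\<close>)
  qed
qed

lemma tensor_proj_bar_free_relation:
  assumes "x \<in> multilinear_relations smul"
  shows "tensor_proj (bar_free x) = 0"
proof -
  have add: "tensor_proj (bar_free (mon (xs @ [a + b] @ ys) 1 - mon (xs @ [a] @ ys) 1
         - mon (xs @ [b] @ ys) 1)) = 0" (is "tensor_proj (bar_free ?g) = 0") for xs ys a b
  proof -
    let ?l = "length xs + length ys"
    have "tensor_proj (mon (multiply_at p (xs @ [a + b] @ ys)) 1)
        = tensor_proj (mon (multiply_at p (xs @ [a] @ ys)) 1)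
          + tensor_proj (mon (multiply_at p (xs @ [b] @ ys)) 1)" if p: "p < ?l" for p
    proof -
      obtain xs' ys' L where "\<forall>a. multiply_at p (xs @ [a] @ ys) = xs' @ [L a] @ ys'"
        "\<forall>a b. L (a + b) = L a + L b" "\<forall>c a. L (smul c a) = smul c (L a)"
        using multiply_at_entry[OF p] by blast
      then show ?thesis by (simp only: tensor_proj_entry_add)
    qed
    then show ?thesis
      by (simp add: bar_free_minus bar_free_single tensor_proj_minus tensor_proj_sum tensor_proj_single[of _ "(-1) ^ _"]
          free.scale_right_distrib sum.distrib)
  qed
  have smul: "tensor_proj (bar_free (mon (xs @ [smul c a] @ ys) 1 - mon (xs @ [a] @ ys) c)) = 0" for xs ys a c
  proof -
    let ?l = "length xs + length ys"
    have "tensor_proj (mon (multiply_at p (xs @ [smul c a] @ ys)) 1)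
        = free_scale c (tensor_proj (mon (multiply_at p (xs @ [a] @ ys)) 1))" if p: "p < ?l" for p
    proof -
      obtain xs' ys' L where "\<forall>a. multiply_at p (xs @ [a] @ ys) = xs' @ [L a] @ ys'"
        "\<forall>a b. L (a + b) = L a + L b" "\<forall>c a. L (smul c a) = smul c (L a)"
        using multiply_at_entry[OF p] by blast
      then show ?thesis by (simp only: tensor_proj_entry_smul)
    qed
    then show ?thesis
      by (simp add: bar_free_minus bar_free_single tensor_proj_minus tensor_proj_sum tensor_proj_single[of _ "(-1) ^ _"]
          tensor_proj_single[of _ "(-1) ^ _ * _"] free.scale_scale)
  qed
  show ?thesis
    using assms unfolding multilinear_relations_def
  proof (induction rule: free.span_induct_alt)
    case base
    show ?case by simp
  next
    case (step c x y)
    from step(1) have "tensor_proj (bar_free x) = 0" using add smul by blast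
    then show ?case using step(2) by (simp add: bar_free_add bar_free_scale tensor_proj_add tensor_proj_scale)
  qed
qed

lemma tensor_proj_bar_free_cong:
  assumes "tensor_proj x = tensor_proj y"
  shows "tensor_proj (bar_free x) = tensor_proj (bar_free y)"
proof -
  have "x - y \<in> multilinear_relations smul"
    using assms by (simp add: tensor_proj_eq_0[symmetric] tensor_proj_minus)
  from tensor_proj_bar_free_relation[OF this] show ?thesis
    by (simp add: bar_free_minus tensor_proj_minus)
qed

lemma bar_tensor_class: "bar smul (tensor_class smul x) = tensor_class smul (bar_free x)"
  unfolding bar_def
proof (rule the_equality)
  show "\<exists>p. tensor_class smul x = tensor_class smul p \<and> tensor_class smul (bar_free x) = tensor_class smul (bar_free p)"
    by blast
next
  fix T
  assume "\<exists>p. tensor_class smul x = tensor_class smul p \<and> T = tensor_class smul (bar_free p)"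
  then show "T = tensor_class smul (bar_free x)"
    using tensor_proj_bar_free_cong by (metis tensor_class_eq_iff)
qed

end

section \<open>The chain map\<close>

context quantum_lie_algebra
begin

lemma gen_relation:
  "gen i * gen j = (\<Sum>k\<in>UNIV. \<Sum>l\<in>UNIV. smul (\<sigma> $ (i, j) $ (k, l)) (gen k * gen l))
     + (\<Sum>k\<in>UNIV. smul (C $ (i, j) $ k) (gen k))"
proof -
  let ?p = "mon [i, j] 1
      - (\<Sum>k\<in>UNIV. \<Sum>l\<in>UNIV. mon [k, l] (\<sigma> $ (i, j) $ (k, l)))
      - (\<Sum>k\<in>UNIV. mon [k] (C $ (i, j) $ k))"
  have add: "eval_free smul gen (x + y) = eval_free smul gen x + eval_free smul gen y" for x y
    unfolding eval_free_def by (rule lin_ext_add) (rule scale_left_distrib)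
  have minus: "eval_free smul gen (x - y) = eval_free smul gen x - eval_free smul gen y" for x y
    using add[of "x - y" y] by (simp add: algebra_simps)
  have single: "eval_free smul gen (mon w c) = smul c (prod_list (map gen w))" for w c
    unfolding eval_free_def by (subst lin_ext_single) simp_all
  have "?p \<in> relation_ideal \<sigma> C"
    unfolding relation_ideal_def 
    by (rule free.span_base, rule CollectI, rule exI[of _ "[]"], rule exI[of _ i], rule exI[of _ j],
        rule exI[of _ "[]"]) simp
  then have "eval_free smul gen ?p = 0" by (simp add: relations)
  from this[unfolded minus additive_sum[of "eval_free smul gen", OF add] single]
  show ?thesis by (simp add: algebra_simps)
qed

text \<open>The undefined value of \<open>the\<close> at 0 does no harm: below,
  \<open>chain_class\<close> and \<open>contract\<close> are evaluated on words without 0, after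
  \<open>zero_free\<close>, \<open>remove_zero\<close> or \<open>absorb_first\<close>.\<close>

definition chain_class :: "('n option list \<Rightarrow>\<^sub>0 'u) \<Rightarrow> ('u list \<Rightarrow>\<^sub>0 'a)" where
  "chain_class = lin_ext (\<lambda>L a. tensor_proj (mon (a # map (gen \<circ> the) L) 1))"

definition contract :: "nat \<Rightarrow> nat \<Rightarrow> ('n option list \<Rightarrow>\<^sub>0 'u) \<Rightarrow> ('u list \<Rightarrow>\<^sub>0 'a)" where
  "contract n p = lin_ext (\<lambda>L a. if length L = n \<and> p < n
     then tensor_proj (mon (multiply_at p (a # map (gen \<circ> the) L)) 1) else 0)"

lemma tensor_proj_first_add:
  "tensor_proj (mon ((a + b) # ys) 1)
    = tensor_proj (mon (a # ys) 1) + tensor_proj (mon (b # ys) 1)"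
  using tensor_proj_entry_add[of "[]"] by simp

lemma tensor_proj_contract_add:
  assumes "p < length ys"
  shows "tensor_proj (mon (multiply_at p ((a + b) # ys)) 1)
    = tensor_proj (mon (multiply_at p (a # ys)) 1)
      + tensor_proj (mon (multiply_at p (b # ys)) 1)"
proof -
  obtain xs' ys' L where "\<forall>a. multiply_at p ([] @ [a] @ ys) = xs' @ [L a] @ ys'"
    "\<forall>a b. L (a + b) = L a + L b"
    using multiply_at_entry[of p "[]" ys] assms by auto
  then show ?thesis using tensor_proj_entry_add[of xs' "L a" "L b" ys'] by simp
qed

lemma chain_class_add: "chain_class (u + v) = chain_class u + chain_class v"
  unfolding chain_class_def by (rule lin_ext_add) (rule tensor_proj_first_add)

lemma chain_class_single: "chain_class (mon L a) = tensor_proj (mon (a # map (gen \<circ> the) L) 1)"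
  unfolding chain_class_def
  by (subst lin_ext_single) (auto intro: additive_zero simp: tensor_proj_first_add)

lemma contract_add: "contract n p (u + v) = contract n p u + contract n p v"
  unfolding contract_def by (rule lin_ext_add) (simp add: tensor_proj_contract_add)

lemma contract_single: "contract n p (mon L a) = (if length L = n \<and> p < n
     then tensor_proj (mon (multiply_at p (a # map (gen \<circ> the) L)) 1) else 0)"
  unfolding contract_def
  by (subst lin_ext_single)
    (auto intro: additive_zero[of "\<lambda>a. tensor_proj (mon (multiply_at p (a # _)) 1)"] simp: tensor_proj_contract_add)

lemma chain_class_zero [simp]: "chain_class 0 = 0"
  by (rule additive_zero) (rule chain_class_add)

lemma contract_zero [simp]: "contract n p 0 = 0"
  by (rule additive_zero) (rule contract_add)

lemma chain_class_sum: "chain_class (sum f A) = (\<Sum>i\<in>A. chain_class (f i))"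
  by (rule additive_sum) (rule chain_class_add)

lemma contract_sum: "contract n p (sum f A) = (\<Sum>i\<in>A. contract n p (f i))"
  by (rule additive_sum) (rule contract_add)

lemma chain_class_uminus: "chain_class (- u) = - chain_class u"
  using chain_class_add[of u "- u"] by (simp add: eq_neg_iff_add_eq_0 add.commute)

lemma contract_minus: "contract n p (u - v) = contract n p u - contract n p v"
  using contract_add[of n p "u - v" v] by (simp add: algebra_simps)

lemma chain_class_neg_one_power: "chain_class (app ((-1) ^ k * x) v) = free_scale ((-1) ^ k) (chain_class (app x v))"
  by (cases "even k") (simp_all add: chain_class_uminus free.scale_minus_left)

abbreviation chain :: "('n list \<Rightarrow>\<^sub>0 'u) \<Rightarrow> ('u list \<Rightarrow>\<^sub>0 'a)" where
  "chain \<equiv> lin_ext (\<lambda>K a. mon (a # map gen K) 1)"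

lemma tensor_proj_chain: "tensor_proj (chain u) = chain_class (lift u)"
proof -
  have "tensor_proj (chain u) = lin_ext (\<lambda>K a. tensor_proj (mon (a # map gen K) 1)) u"
    by (simp add: lin_ext_def tensor_proj_sum)
  also have "\<dots> = chain_class (lift u)"
  proof (rule additive_eqI[where g = "\<lambda>u. chain_class (lift u)"])
    fix K :: "'n list" and a :: 'u
    show "lin_ext (\<lambda>K a. tensor_proj (mon (a # map gen K) 1)) (mon K a)
        = chain_class (lift (mon K a))"
      by (subst lin_ext_single) (auto intro: additive_zero simp: tensor_proj_first_add chain_class_single comp_def)
  qed (simp_all add: lin_ext_add tensor_proj_first_add lift_add chain_class_add)
  finally show ?thesis .
qed

lemma bar_chain:
  assumes "homogeneous n u"
  shows "tensor_proj (bar_free (chain u)) = (\<Sum>p<n. free_scale ((-1) ^ (n - 1 - p)) (contract n p (lift u)))"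
proof (rule homogeneous_eqI[where n = n and u = u and f = "\<lambda>u. tensor_proj (bar_free (chain u))"
      and g = "\<lambda>u. \<Sum>p<n. free_scale ((-1) ^ (n - 1 - p)) (contract n p (lift u))"])
  fix u v :: "'n list \<Rightarrow>\<^sub>0 'u"
  \<comment> \<open>\<open>chain\<close> itself is not additive, since the coefficient is an entry
    of the list; only its class modulo the multilinear relations is.\<close>
  have "tensor_proj (chain (u + v)) = tensor_proj (chain u + chain v)"
    by (simp add: tensor_proj_chain tensor_proj_add lift_add chain_class_add)
  from tensor_proj_bar_free_cong[OF this]
  show "tensor_proj (bar_free (chain (u + v))) = tensor_proj (bar_free (chain u)) + tensor_proj (bar_free (chain v))"
    by (simp add: bar_free_add tensor_proj_add)
next
  fix K :: "'n list" and a :: 'u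
  assume K: "length K = n"
  have "tensor_proj (chain (mon K a)) = tensor_proj (mon (a # map gen K) 1)"
    by (simp add: tensor_proj_chain chain_class_single comp_def)
  from tensor_proj_bar_free_cong[OF this]
  show "tensor_proj (bar_free (chain (mon K a)))
      = (\<Sum>p<n. free_scale ((-1) ^ (n - 1 - p)) (contract n p (lift (mon K a))))"
    using K by (simp add: bar_free_single tensor_proj_sum tensor_proj_single[of _ "(-1) ^ _"] contract_single comp_def)
qed (use assms in \<open>simp_all add: lift_add contract_add free.scale_right_distrib sum.distrib\<close>)

lemma contract_first: "contract n 0 (app zero_free v) = chain_class (app (zero_free * multiply_first n) v)" if "1 \<le> n"
proof (rule additive_eqI[where p = v and f = "\<lambda>v. contract n 0 (app zero_free v)"
      and g = "\<lambda>v. chain_class (app (zero_free * multiply_first n) v)"])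
  fix L :: "'n option list" and a :: 'u
  show "contract n 0 (app zero_free (mon L a)) = chain_class (app (zero_free * multiply_first n) (mon L a))"
    using that by (cases L) (auto simp: contract_single app_multiply_first chain_class_single multiply_at_def split: option.splits)
qed (simp_all add: app_add contract_add chain_class_add)

text \<open>
  The relations of the algebra say that multiplying two neighbouring entries annihilates
  \<open>1 - R\<close>, when the letter \<open>0\<close> is read as the unit.
\<close>

lemma contract_one_minus_R:
  assumes p: "1 \<le> p" "p < n"
  shows "contract n p (app zero_free (app (1 - R_op n p) v))
    = - (chain_class (app (remove_zero n p) (app (1 - R_op n p) v)) + chain_class (app (remove_zero n (Suc p)) (app (1 - R_op n p) v)))"
proof -
  have "chain_class (app (remove_zero n p) (app (1 - R_op n p) v)) + chain_class (app (remove_zero n (Suc p)) (app (1 - R_op n p) v))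
      = chain_class (app ((1 - R_op n p) * (remove_zero n p + remove_zero n (Suc p))) v)"
    by (simp add: chain_class_add distrib_left)
  also have "\<dots> = - chain_class (app (zero_free * bracket_op n p) v)"
    unfolding R_remove_zeros[OF p] by (simp add: chain_class_uminus)
  also have "\<dots> = - contract n p (app zero_free (app (1 - R_op n p) v))"
  proof -
    have "chain_class (app (zero_free * bracket_op n p) v) = contract n p (app ((1 - R_op n p) * zero_free) v)"
    proof (rule additive_eqI[where p = v and f = "\<lambda>v. chain_class (app (zero_free * bracket_op n p) v)"
          and g = "\<lambda>v. contract n p (app ((1 - R_op n p) * zero_free) v)"])
      fix L :: "'n option list" and a :: 'u
      show "chain_class (app (zero_free * bracket_op n p) (mon L a))
          = contract n p (app ((1 - R_op n p) * zero_free) (mon L a))"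
      proof (cases "length L = n \<and> None \<notin> set L")
        case True
        then obtain P x y S where L: "L = P @ [x, y] @ S" and k: "p = Suc (length P)"
          using word_split2[of p L] p by blast
        then obtain i j where xy: "x = Some i" "y = Some j" using True by (cases x; cases y) auto
        have n: "n = length P + 2 + length S" using L True by auto
        let ?g = "map (gen \<circ> the)"
        define \<phi> where "\<phi> z = tensor_proj (mon ((a # ?g P) @ [z] @ ?g S) 1)" for z
        have \<phi>_add: "\<phi> (y + z) = \<phi> y + \<phi> z" and \<phi>_smul: "\<phi> (smul c z) = free_scale c (\<phi> z)" for y z c
          unfolding \<phi>_def by (rule tensor_proj_entry_add, rule tensor_proj_entry_smul)
        have first_smul: "tensor_proj (mon (smul c a # ys) 1) = free_scale c (tensor_proj (mon (a # ys) 1))" for c ys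
          using tensor_proj_entry_smul[of "[]"] by simp
        have con: "contract n p (mon (P @ Some k # Some l # S) (smul c a)) = free_scale c (\<phi> (gen k * gen l))" for k l c
          using k n by (simp add: contract_single multiply_at_def nth_append first_smul \<phi>_def)
        have "contract n p (app ((1 - R_op n p) * zero_free) (mon L a))
            = \<phi> (gen i * gen j) - (\<Sum>k\<in>UNIV. \<Sum>l\<in>UNIV. free_scale (\<sigma> $ (i, j) $ (k, l)) (\<phi> (gen k * gen l)))"
          using True con[of i j 1] app_R_zero_free[OF k n, of x y a] unfolding L xy
          by (simp add: app_minus contract_minus contract_sum con)
        also have "\<dots> = (\<Sum>k\<in>UNIV. free_scale (C $ (i, j) $ k) (\<phi> (gen k)))"
          unfolding gen_relation[of i j] \<phi>_add additive_sum[of \<phi>, OF \<phi>_add] \<phi>_smul by simp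
        also have "\<dots> = chain_class (app (zero_free * bracket_op n p) (mon L a))"
          using True app_bracket_op_local[OF k n, of i j a] unfolding L xy
          by (simp add: chain_class_sum chain_class_single first_smul \<phi>_def)
        finally show ?thesis by simp
      next
        case False
        have "zero_free * (R_op n p * zero_free) = R_op n p * zero_free"
          using preserves_zeros_R_op[of n p] by (simp add: preserves_zeros_def mult.assoc)
        show ?thesis
        proof (cases "None \<in> set L")
          case None: True
          have "app (R_op n p * zero_free) (mon L a) = 0"
            using arg_cong[OF \<open>zero_free * _ = _\<close>, of "\<lambda>x. app x (mon L a)"] None by simp
          then show ?thesis using None by (simp add: app_minus)
        qed (use False in \<open>auto simp: app_bracket_op app_factor_op app_minus contract_single\<close>)
      qed
    qed (simp_all add: app_add chain_class_add contract_add)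
    then show ?thesis by simp
  qed
  finally show ?thesis by simp
qed

lemma homogeneous_wedge:
  assumes "homogeneous n u"
  shows "homogeneous n (wedge \<sigma> smul u)"
  using assms by (rule homogeneous_image[of "wedge \<sigma> smul", rotated 2]) (auto simp: wedge_add wedge_single)

lemma chain_class_BRST_coeff:
  assumes X: "BRST_coefficients \<sigma> C X" and w: "homogeneous n w"
  shows "chain_class (lift (wedge \<sigma> smul (BRST_coeff \<sigma> C smul gen X w)))
    = tensor_proj (bar_free (chain (wedge \<sigma> smul w)))"
proof (cases "n = 0")
  case True
  then show ?thesis
    using BRST_coeff_degree_0[of w X] bar_chain[OF homogeneous_wedge[OF w]] w by simp
next
  case False
  then have n: "1 \<le> n" by simp
  interpret braid "R_op n" by (rule braid_factor_op) (rule yang_baxter_R)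
  define A where "A = antisymmetrizer (R_op n) 1 (n - 1)"
  \<comment> \<open>The projection to words without 0 is postponed: only before it is v visibly in
    the image of every \<open>1 - R_op n p\<close>.\<close>
  define v where "v = app A (lift w)"
  define t where "t q = chain_class (app (remove_zero n q) v)" for q
  let ?s = "\<lambda>k. free_scale ((-1) ^ k)"
  have "app (zero_free * A * remove_zero n n) (lift w) = 0"
    using zero_free_antisymmetrizer_remove_last[OF n] by (simp add: A_def)
  \<comment> \<open>The upper end of the telescope: no 0 reaches the last place.\<close>
  then have tn: "t n = 0" by (simp add: t_def v_def)
  have con: "contract n p (app zero_free v) = - (t p + t (Suc p))" if p: "p \<in> {1..<n}" for p
  proof -
    have p': "p - 1 < n - 1" "1 + (p - 1) = p" using p by auto
    obtain b where "antisymmetrizer (R_op n) 1 (n - 1) = b * (1 - R_op n (1 + (p - 1)))"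
      by (rule antisymmetrizer_right_factor[OF p'(1)])
    then have b: "A = b * (1 - R_op n p)" unfolding A_def p'(2) .
    have v: "v = app (1 - R_op n p) (app b (lift w))" unfolding v_def b by simp
    show ?thesis unfolding t_def v using p by (intro contract_one_minus_R) auto
  qed
  \<comment> \<open>The t's enter as sums of neighbours with alternating signs; with the sign
    included the sum telescopes. Its lower end t 1 is the part of \<open>absorb_first\<close> that
    reads a first letter 0 as the unit, and \<open>contract n 0\<close> supplies the other
    part.\<close>
  define H where "H q = ?s (n - q) (t q)" for q
  have H: "?s (n - 1 - p) (- (t p + t (Suc p))) = - (H (Suc p) - H p)" if p: "p \<in> {1..<n}" for p
  proof -
    obtain k where "n = Suc (p + k)" using p less_imp_Suc_add by auto
    then have "n - 1 - p = k" "n - p = Suc k" "n - Suc p = k" by simp_all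
    then show ?thesis
      unfolding H_def by (cases "even k") (simp_all add: free.scale_minus_left free.scale_right_distrib)
  qed
  have "lift (wedge \<sigma> smul w) = app zero_free v"
    using wedge_shuffle[OF w] by (simp add: A_def v_def)
  then have "tensor_proj (bar_free (chain (wedge \<sigma> smul w))) = (\<Sum>p<n. ?s (n - 1 - p) (contract n p (app zero_free v)))"
    using bar_chain[OF homogeneous_wedge[OF w]] by simp
  also have "\<dots> = ?s (n - 1) (contract n 0 (app zero_free v)) + (\<Sum>p = 1..<n. ?s (n - 1 - p) (contract n p (app zero_free v)))"
  proof -
    have "{..<n} = insert 0 {1..<n}" using n by auto
    then show ?thesis by simp
  qed
  also have "(\<Sum>p = 1..<n. ?s (n - 1 - p) (contract n p (app zero_free v))) = (\<Sum>p = 1..<n. - (H (Suc p) - H p))"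
    by (intro sum.cong refl) (simp only: con H)
  also have "\<dots> = - (H n - H 1)"
    unfolding sum_negf using sum_Suc_diff'[OF n, of H] by simp
  also have "\<dots> = ?s (n - 1) (t 1)" by (simp add: H_def tn)
  also have "contract n 0 (app zero_free v) = chain_class (app (zero_free * multiply_first n) v)"
    by (rule contract_first[OF n])
  also have "?s (n - 1) (chain_class (app (zero_free * multiply_first n) v)) + ?s (n - 1) (t 1)
      = ?s (n - 1) (chain_class (app (A * absorb_first n) (lift w)))"
    by (simp add: absorb_first_def v_def t_def chain_class_add free.scale_right_distrib)
  also have "\<dots> = chain_class (lift (wedge \<sigma> smul (BRST_coeff \<sigma> C smul gen X w)))"
    unfolding BRST_shuffle[OF X n w] chain_class_neg_one_power A_def ..
  finally show ?thesis by simp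
qed

lemma fold_omega_act_add:
  "fold (omega_act \<sigma> smul) js (u + v) = fold (omega_act \<sigma> smul) js u + fold (omega_act \<sigma> smul) js v"
  by (induction js arbitrary: u v) (simp_all add: omega_act_add)

lemma BRST_term_add: "BRST_term \<sigma> smul X r (u + v) = BRST_term \<sigma> smul X r u + BRST_term \<sigma> smul X r v"
proof -
  have "fold gamma_act I (u + v) = fold gamma_act I u + fold gamma_act I v" for I and u v :: "'n list \<Rightarrow>\<^sub>0 'u"
    by (induction I arbitrary: u v) (simp_all add: gamma_act_add)
  then show ?thesis by (simp add: BRST_term_def fold_omega_act_add wscale_add sum.distrib)
qed

text \<open>\<open>Sum_any\<close> is additive only for families of finite support, so the support
  has to be bounded before Q can be reduced to monomials.\<close>

lemma finite_BRST_terms: "finite {r. BRST_term \<sigma> smul X r w \<noteq> 0}"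
proof -
  \<comment> \<open>The sum of the lengths of all words in w is a crude bound for each of
    them.\<close>
  have "BRST_term \<sigma> smul X r w = 0" if r: "(\<Sum>I\<in>Poly_Mapping.keys w. length I) \<le> r" for r
  proof -
    have "BRST_term \<sigma> smul X r w
        = (\<Sum>I\<in>Poly_Mapping.keys w. BRST_term \<sigma> smul X r (mon I (Poly_Mapping.lookup w I)))"
      by (subst poly_mapping_sum_single[of w]) (simp only: additive_sum[of "BRST_term \<sigma> smul X r", OF BRST_term_add])
    also have "\<dots> = 0"
    proof (rule sum.neutral, rule ballI)
      fix I assume I: "I \<in> Poly_Mapping.keys w"
      have "length I \<le> (\<Sum>I\<in>Poly_Mapping.keys w. length I)"
        using I by (intro member_le_sum) auto
      then show "BRST_term \<sigma> smul X r (mon I (Poly_Mapping.lookup w I)) = 0"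
        using r by (intro BRST_term_eq_0[of "length I"]) auto
    qed
    finally show ?thesis .
  qed
  then have "{r. BRST_term \<sigma> smul X r w \<noteq> 0} \<subseteq> {..<\<Sum>I\<in>Poly_Mapping.keys w. length I}"
    by (auto simp: not_le[symmetric])
  then show ?thesis by (rule finite_subset) simp
qed

lemma BRST_coeff_add:
  "BRST_coeff \<sigma> C smul gen X (u + v) = BRST_coeff \<sigma> C smul gen X u + BRST_coeff \<sigma> C smul gen X v"
proof -
  let ?f = "\<lambda>w r. if 1 \<le> r \<and> enat r < height \<sigma> then BRST_term \<sigma> smul X r w else 0"
  have fin: "finite {r. ?f w r \<noteq> 0}" for w
    by (rule finite_subset[OF _ finite_BRST_terms[of X w]]) auto
  have "Sum_any (?f (u + v)) = Sum_any (\<lambda>r. ?f u r + ?f v r)"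
    by (rule arg_cong[of _ _ Sum_any]) (auto simp: BRST_term_add)
  also have "\<dots> = Sum_any (?f u) + Sum_any (?f v)" by (rule Sum_any.distrib[OF fin fin])
  finally show ?thesis
    by (simp add: BRST_coeff_def omega_act_add chi_act_add sum.distrib)
qed

lemma chain_of_BRST_coeff:
  assumes X: "BRST_coefficients \<sigma> C X"
  shows "chain_of smul gen (wedge \<sigma> smul (BRST_coeff \<sigma> C smul gen X w)) = bar smul (chain_of smul gen (wedge \<sigma> smul w))"
proof -
  have "chain_class (lift (wedge \<sigma> smul (BRST_coeff \<sigma> C smul gen X w))) = tensor_proj (bar_free (chain (wedge \<sigma> smul w)))"
  proof (rule additive_eqI[where p = w and f = "\<lambda>w. chain_class (lift (wedge \<sigma> smul (BRST_coeff \<sigma> C smul gen X w)))"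
        and g = "\<lambda>w. tensor_proj (bar_free (chain (wedge \<sigma> smul w)))"])
    fix I :: "'n list" and a :: 'u
    show "chain_class (lift (wedge \<sigma> smul (BRST_coeff \<sigma> C smul gen X (mon I a))))
        = tensor_proj (bar_free (chain (wedge \<sigma> smul (mon I a))))"
      by (rule chain_class_BRST_coeff[OF X, of "length I"]) auto
  next
    fix u v :: "'n list \<Rightarrow>\<^sub>0 'u"
    have "tensor_proj (chain (wedge \<sigma> smul (u + v))) = tensor_proj (chain (wedge \<sigma> smul u) + chain (wedge \<sigma> smul v))"
      by (simp add: tensor_proj_chain tensor_proj_add wedge_add lift_add chain_class_add)
    from tensor_proj_bar_free_cong[OF this]
    show "tensor_proj (bar_free (chain (wedge \<sigma> smul (u + v))))
        = tensor_proj (bar_free (chain (wedge \<sigma> smul u))) + tensor_proj (bar_free (chain (wedge \<sigma> smul v)))"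
      by (simp add: bar_free_add tensor_proj_add)
  qed (simp add: BRST_coeff_add wedge_add lift_add chain_class_add)
  then show ?thesis
    unfolding chain_of_def bar_tensor_class tensor_class_eq_iff tensor_proj_chain by simp
qed

text \<open>By \<open>chain_of_BRST_coeff\<close> the chain of the result is determined by the wedge
  polynomial, whichever coefficient family is used. So compatibility with the relations of the wedge
  algebra need not be checked directly.\<close>

lemma BRST_wedge:
  assumes X: "BRST_coefficients \<sigma> C X"
    and inj: "inj_on (chain_of smul gen) (wedge_polynomials \<sigma> smul)"
  shows "BRST \<sigma> C smul gen X (wedge \<sigma> smul w) = wedge \<sigma> smul (BRST_coeff \<sigma> C smul gen X w)"
  unfolding BRST_def
proof (rule the_equality)
  fix m assume "\<exists>w'. wedge \<sigma> smul w = wedge \<sigma> smul w' \<and> m = wedge \<sigma> smul (BRST_coeff \<sigma> C smul gen X w')"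
  then obtain w' where w': "wedge \<sigma> smul w = wedge \<sigma> smul w'" "m = wedge \<sigma> smul (BRST_coeff \<sigma> C smul gen X w')"
    by blast
  have "chain_of smul gen m = chain_of smul gen (wedge \<sigma> smul (BRST_coeff \<sigma> C smul gen X w))"
    unfolding w'(2) chain_of_BRST_coeff[OF X] w'(1) ..
  then show "m = wedge \<sigma> smul (BRST_coeff \<sigma> C smul gen X w)"
    using inj w'(2) by (auto simp: wedge_polynomials_def dest: inj_onD)
qed blast

end

theorem proposition5:
  fixes \<sigma> :: "'a::field^('n \<times> 'n)^('n::finite \<times> 'n)" and C :: "'a^'n^('n::finite \<times> 'n)"
    and smul :: "'a \<Rightarrow> 'u::ring_1 \<Rightarrow> 'u" and gen :: "'n::finite \<Rightarrow> 'u"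
    and X :: "nat \<Rightarrow> ('n::finite, 'a) word_matrix"
  assumes "quantum_lie_algebra \<sigma> C smul gen"
    and "BRST_coefficients \<sigma> C X"
    and "inj_on (chain_of smul gen) (wedge_polynomials \<sigma> smul)"
  shows "(\<forall>m \<in> wedge_polynomials \<sigma> smul.
            BRST \<sigma> C smul gen X (BRST \<sigma> C smul gen X m) = 0)
       \<and> (\<forall>m \<in> wedge_polynomials \<sigma> smul.
            bar smul (chain_of smul gen m) = chain_of smul gen (BRST \<sigma> C smul gen X m))"
proof -
  interpret quantum_lie_algebra \<sigma> C smul gen by fact
  let ?Q = "BRST_coeff \<sigma> C smul gen X"
  note BRST = BRST_wedge[OF assms(2,3)] and chain_map = chain_of_BRST_coeff[OF assms(2)]
  have "wedge \<sigma> smul (?Q (?Q w)) = 0" for w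
  proof -
    have "chain_of smul gen (wedge \<sigma> smul (?Q (?Q w))) = bar smul (bar smul (chain_of smul gen (wedge \<sigma> smul w)))"
      by (simp only: chain_map)
    also have "\<dots> = chain_of smul gen (wedge \<sigma> smul 0)"
      unfolding chain_of_def bar_tensor_class bar_free_bar_free by (simp add: lin_ext_def)
    finally show ?thesis
      using assms(3) wedge_zero by (metis inj_onD rangeI wedge_polynomials_def)
  qed
  then show ?thesis by (auto simp: wedge_polynomials_def BRST chain_map)
qed

end
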